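(* Let $V=C^n$ with its standard structures $g_{can},\tau=\tau_{can}$, let $p,q\in\mathbb{N}_0$ with $p+q=n$, and let $L\subset V$ be a fixed $\tau$-invariant maximally isotropic subspace of type $(p,q)$. There is a natural one-to-one correspondence, induced by $\eta\mapsto M(\eta)$, between (isomorphism classes of) complete simply connected flat nearly para-Kähler manifolds of type $(p,q)$, $p+q=n$, and the points of the following orbit space: $$\mathcal{C}^{p,q}_\tau(V)/G\cong\Lambda^-_{reg}L/G_L\subset\Lambda^-L/G_L=\Lambda^3L^+/GL(L^+)\times\Lambda^3L^-/GL(L^-).$$
   Context: $V=C^n=\mathbb{R}^n\oplus e\mathbb{R}^n$ ($e^2=1$) is the real vector space with basis $(e_1,\dots,e_n,f_1,\dots,f_n)$, $f_i=ee_i$, $\tau_{can}e_i=f_i$, $\tau_{can}f_i=e_i$, $g_{can}(e_i,e_j)=-g_{can}(f_i,f_j)=\delta_{ij}$, $g_{can}(e_i,f_j)=0$; $V\cong V^*$ via $g_{can}$. For $\eta\in\Lambda^3V$, $\eta_X$ is defined by $g_{can}(\eta_XY,Z)=\eta(X,Y,Z)$, and $\Sigma_\eta:=\mathrm{span}\{\eta_XY\mid X,Y\in V\}$ is the support. $\mathcal{C}_\tau(V):=\{\eta\in\Lambda^3V\mid\eta_X\eta_Y=0,\ \eta_X\tau+\tau\eta_X=0\ \forall X,Y\in V\}$; for such $\eta$ the support is isotropic and $\tau$-invariant. $\mathcal{C}^{reg}_\tau(V)\subset\mathcal{C}_\tau(V)$ is the subset of elements with $\dim\Sigma_\eta=n$.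 A $\tau$-invariant subspace has type $(p,q)$ if the $\pm1$-eigenspaces of $\tau$ on it have dimensions $p$ and $q$ respectively; $\eta\in\mathcal{C}_\tau(V)$ has type $(p,q)$ if $\Sigma_\eta$ does. $\mathcal{C}^{p,q}_\tau(V)\subset\mathcal{C}_\tau(V)$ is the subset of elements of type $(p,q)$. For a $\tau$-invariant maximally isotropic subspace $L=L^+\oplus L^-$ of type $(p,q)$ ($L^\pm$ the $\pm1$-eigenspaces of $\tau|_L$): $\Lambda^-L:=\Lambda^3L^++\Lambda^3L^-$ and $\Lambda^-_{reg}L:=\Lambda^-L\cap\mathcal{C}^{reg}_\tau(V)\subset\mathcal{C}^{p,q}_\tau(V)$. $G:=\mathrm{Aut}(V,g_{can},\tau_{can})\cong GL(n)$ acts naturally on $\mathcal{C}_\tau(V)$; $G_L$ is the stabilizer of $L$ in $G$, which acts on $\Lambda^-L$ and $\Lambda^-_{reg}L$ through its action on $L$ by elements of $GL(L^+)\times GL(L^-)$. An almost para-Hermitian manifold $(M,\tau,g)$ is a pseudo-Riemannian manifold with an endomorphism field $\tau$, $\tau^2=\mathrm{Id}$, with eigendistributions of equal dimension and $g(\tau\cdot,\tau\cdot)=-g$; it is nearly para-Kähler if its Levi-Civita connection satisfies $(D_X\tau)Y=-(D_Y\tau)X$ for all $X,Y$, and flat if $g$ is flat. Isomorphisms are isometries intertwining the endomorphism fields. For $\eta\in\mathcal{C}_\tau(V)$, with linear coordinates $x^i$ on $V$ and $\partial_i=\partial/\partial x^i$, $M(\eta)$ is the complete flat nearly para-Kähler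 manifold $(V,g_{can},\exp(2\sum_{i=1}^{2n}x^i\eta_{\partial_i})\tau_{can})$. A complete simply connected flat nearly para-Kähler manifold of dimension $2n$ is of type $(p,q)$ if it is isomorphic to $M(\eta)$ with $\eta\in\mathcal{C}_\tau(V)$ of type $(p,q)$; $p+q=n$ means that it has no flat para-Kähler de Rham factor. *)

theory Defs
  imports "HOL-Analysis.Analysis"
begin

section \<open>Linear algebra of the para-complex space\<close>

text \<open>
  A pair \<open>(u, v)\<close> stands for \<open>u + e v\<close> with \<open>e\<^sup>2 = 1\<close>; thus \<open>e\<^sub>i = (axis i 1, 0)\<close> and
  \<open>f\<^sub>i = e e\<^sub>i = (0, axis i 1)\<close>, and the (Euclidean) library basis of this type is
  \<open>(e\<^sub>1, \<dots>, e\<^sub>n, f\<^sub>1, \<dots>, f\<^sub>n)\<close>.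
\<close>

type_synonym 'n pc = "(real, 'n) vec \<times> (real, 'n) vec"

definition gcan :: "'n::finite pc \<Rightarrow> 'n pc \<Rightarrow> real" where
  "gcan x y = fst x \<bullet> fst y - snd x \<bullet> snd y"

definition tcan :: "'n::finite pc \<Rightarrow> 'n pc" where
  "tcan x = (snd x, fst x)"

text \<open>
  Elements of \<open>\<Lambda>\<^sup>3V\<close> are represented, through \<open>V \<cong> V\<^sup>*\<close> given by \<^const>\<open>gcan\<close>, as 3-forms
  \<open>\<eta>(X,Y,Z)\<close>: the decomposable element \<open>u \<and> v \<and> w\<close> is the form whose value at \<open>(X,Y,Z)\<close> is the
  \<open>3 \<times> 3\<close> determinant of the scalar products of \<open>u, v, w\<close> with \<open>X, Y, Z\<close>.
\<close>

type_synonym 'n form3 = "'n pc \<Rightarrow> 'n pc \<Rightarrow> 'n pc \<Rightarrow> real"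

definition wedge3 :: "'n::finite pc \<Rightarrow> 'n pc \<Rightarrow> 'n pc \<Rightarrow> 'n form3" where
  "wedge3 u v w = (\<lambda>X Y Z.
      gcan u X * (gcan v Y * gcan w Z - gcan v Z * gcan w Y)
    - gcan u Y * (gcan v X * gcan w Z - gcan v Z * gcan w X)
    + gcan u Z * (gcan v X * gcan w Y - gcan v Y * gcan w X))"

definition trivector :: "('n::finite pc \<times> 'n pc \<times> 'n pc) list \<Rightarrow> 'n form3" where
  "trivector ts = (\<lambda>X Y Z. \<Sum>(u, v, w)\<leftarrow>ts. wedge3 u v w X Y Z)"

definition Lambda3 :: "'n::finite pc set \<Rightarrow> 'n form3 set" where
  "Lambda3 W = trivector ` {ts. set ts \<subseteq> W \<times> W \<times> W}"

text \<open>
  The linear map \<open>\<Lambda>\<^sup>3A\<close> on \<open>\<Lambda>\<^sup>3W\<close> induced by a linear map \<open>A\<close> on \<open>W\<close>, i.e. the one with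
  \<open>u \<and> v \<and> w \<mapsto> Au \<and> Av \<and> Aw\<close>.
\<close>

definition Lambda3_map :: "'n::finite pc set \<Rightarrow> ('n pc \<Rightarrow> 'n pc) \<Rightarrow> 'n form3 \<Rightarrow> 'n form3" where
  "Lambda3_map W A \<eta> = (THE \<theta>. \<exists>ts. set ts \<subseteq> W \<times> W \<times> W \<and> \<eta> = trivector ts \<and>
      \<theta> = trivector (map (\<lambda>(u, v, w). (A u, A v, A w)) ts))"

definition endo :: "'n::finite form3 \<Rightarrow> 'n pc \<Rightarrow> 'n pc \<Rightarrow> 'n pc" where
  "endo \<eta> X Y = (THE W. \<forall>Z. gcan W Z = \<eta> X Y Z)"

definition supp :: "'n::finite form3 \<Rightarrow> 'n pc set" where
  "supp \<eta> = span {endo \<eta> X Y | X Y. True}"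

definition Ct :: "'n::finite form3 set" where
  "Ct = {\<eta> \<in> Lambda3 UNIV.
      (\<forall>X Y Z. endo \<eta> X (endo \<eta> Y Z) = 0) \<and>
      (\<forall>X Z. endo \<eta> X (tcan Z) + tcan (endo \<eta> X Z) = 0)}"

definition Ct_reg :: "'n::finite form3 set" where
  "Ct_reg = {\<eta> \<in> Ct. dim (supp \<eta>) = CARD('n)}"

definition eig_plus :: "'n::finite pc set \<Rightarrow> 'n pc set" where
  "eig_plus W = {x \<in> W. tcan x = x}"

definition eig_minus :: "'n::finite pc set \<Rightarrow> 'n pc set" where
  "eig_minus W = {x \<in> W. tcan x = - x}"

definition tau_invariant :: "'n::finite pc set \<Rightarrow> bool" where
  "tau_invariant W \<longleftrightarrow> subspace W \<and> tcan ` W \<subseteq> W"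

definition has_type :: "'n::finite pc set \<Rightarrow> nat \<Rightarrow> nat \<Rightarrow> bool" where
  "has_type W p q \<longleftrightarrow> tau_invariant W \<and> dim (eig_plus W) = p \<and> dim (eig_minus W) = q"

definition Ct_type :: "nat \<Rightarrow> nat \<Rightarrow> 'n::finite form3 set" where
  "Ct_type p q = {\<eta> \<in> Ct. has_type (supp \<eta>) p q}"

definition isotropic :: "'n::finite pc set \<Rightarrow> bool" where
  "isotropic W \<longleftrightarrow> (\<forall>x\<in>W. \<forall>y\<in>W. gcan x y = 0)"

definition maximally_isotropic :: "'n::finite pc set \<Rightarrow> bool" where
  "maximally_isotropic L \<longleftrightarrow> subspace L \<and> isotropic L \<and>
     (\<forall>W. subspace W \<and> isotropic W \<and> L \<subseteq> W \<longrightarrow> W = L)"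

definition Lambda_minus :: "'n::finite pc set \<Rightarrow> 'n form3 set" where
  "Lambda_minus L = {\<lambda>X Y Z. a X Y Z + b X Y Z | a b.
     a \<in> Lambda3 (eig_plus L) \<and> b \<in> Lambda3 (eig_minus L)}"

definition Lambda_minus_reg :: "'n::finite pc set \<Rightarrow> 'n form3 set" where
  "Lambda_minus_reg L = Lambda_minus L \<inter> Ct_reg"

definition AutV :: "('n::finite pc \<Rightarrow> 'n pc) set" where
  "AutV = {A. linear A \<and> bij A \<and> (\<forall>x y. gcan (A x) (A y) = gcan x y) \<and>
     (\<forall>x. A (tcan x) = tcan (A x))}"

definition stabilizer :: "'n::finite pc set \<Rightarrow> ('n pc \<Rightarrow> 'n pc) set" where
  "stabilizer L = {A \<in> AutV. A ` L = L}"

text \<open>Linear automorphisms of a subspace; \<^const>\<open>extensional\<close> only fixes a dummy value off \<open>W\<close>.\<close>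

definition GL :: "'n::finite pc set \<Rightarrow> ('n pc \<Rightarrow> 'n pc) set" where
  "GL W = {A \<in> extensional W. bij_betw A W W \<and>
     (\<forall>x\<in>W. \<forall>y\<in>W. A (x + y) = A x + A y) \<and> (\<forall>c. \<forall>x\<in>W. A (c *\<^sub>R x) = c *\<^sub>R A x)}"

definition orbits :: "'a set \<Rightarrow> ('a \<Rightarrow> 'b \<Rightarrow> 'b) \<Rightarrow> 'b set \<Rightarrow> 'b set set" where
  "orbits H act E = (\<lambda>x. (\<lambda>h. act h x) ` H) ` E"


section \<open>Smooth maps and manifolds\<close>

text \<open>These notions are meant for open \<open>S\<close> in a finite-dimensional space.\<close>

primrec Ck_on :: "nat \<Rightarrow> ('a::real_normed_vector \<Rightarrow> 'b::real_normed_vector) \<Rightarrow> 'a set \<Rightarrow> bool" where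
  "Ck_on 0 f S \<longleftrightarrow> continuous_on S f"
| "Ck_on (Suc k) f S \<longleftrightarrow> (\<forall>x\<in>S. f differentiable (at x)) \<and>
     (\<forall>v. Ck_on k (\<lambda>x. frechet_derivative f (at x) v) S)"

definition smooth_on :: "('a::real_normed_vector \<Rightarrow> 'b::real_normed_vector) \<Rightarrow> 'a set \<Rightarrow> bool" where
  "smooth_on f S \<longleftrightarrow> (\<forall>k. Ck_on k f S)"

text \<open>
  A manifold modelled on \<open>'v\<close> consists of its points and an atlas of charts \<open>(U, \<phi>)\<close>. Tensor fields
  are given by their coordinate expressions: \<open>metric M (U, \<phi>) x\<close> and \<open>tau M (U, \<phi>) x\<close> are the
  components of \<open>g\<close> and of the endomorphism field at the point \<open>\<phi>\<^sup>-\<^sup>1 x\<close>, for \<open>x \<in> \<phi>(U)\<close>, subject to the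
  usual transformation law. Values outside \<open>U\<close>, \<open>\<phi>(U)\<close> and the atlas are irrelevant.
\<close>

type_synonym ('m, 'v) chart = "'m set \<times> ('m \<Rightarrow> 'v)"

record ('m, 'v) mfd =
  points :: "'m set"
  atlas :: "('m, 'v) chart set"
  metric :: "('m, 'v) chart \<Rightarrow> 'v \<Rightarrow> 'v \<Rightarrow> 'v \<Rightarrow> real"
  tau :: "('m, 'v) chart \<Rightarrow> 'v \<Rightarrow> 'v \<Rightarrow> 'v"

definition mfd_topology :: "('m, 'v::euclidean_space) mfd \<Rightarrow> 'm topology" where
  "mfd_topology M = topology (\<lambda>S. S \<subseteq> points M \<and> (\<forall>(U, \<phi>)\<in>atlas M. open (\<phi> ` (S \<inter> U))))"

definition local_dom :: "('m \<Rightarrow> 'k) \<Rightarrow> ('m, 'v) chart \<Rightarrow> ('k, 'v) chart \<Rightarrow> 'v set" where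
  "local_dom F c d = snd c ` (fst c \<inter> F -` fst d)"

definition local_rep :: "('m \<Rightarrow> 'k) \<Rightarrow> ('m, 'v) chart \<Rightarrow> ('k, 'v) chart \<Rightarrow> 'v \<Rightarrow> 'v" where
  "local_rep F c d = snd d \<circ> F \<circ> inv_into (fst c) (snd c)"

text \<open>Openness of the domains of all coordinate expressions amounts to continuity of \<open>F\<close>.\<close>

definition smooth_map ::
  "('m \<Rightarrow> 'k) \<Rightarrow> ('m, 'v::euclidean_space) mfd \<Rightarrow> ('k, 'v) mfd \<Rightarrow> bool" where
  "smooth_map F M N \<longleftrightarrow> F ` points M \<subseteq> points N \<and> (\<forall>c\<in>atlas M. \<forall>d\<in>atlas N.
     open (local_dom F c d) \<and> smooth_on (local_rep F c d) (local_dom F c d))"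

text \<open>For \<open>F\<close> the identity of \<open>M\<close>, the local expressions are the transition maps.\<close>

definition smooth_manifold :: "('m, 'v::euclidean_space) mfd \<Rightarrow> bool" where
  "smooth_manifold M \<longleftrightarrow>
     \<Union> (fst ` atlas M) = points M \<and>
     (\<forall>(U, \<phi>)\<in>atlas M. inj_on \<phi> U \<and> open (\<phi> ` U)) \<and>
     smooth_map (\<lambda>p. p) M M \<and>
     Hausdorff_space (mfd_topology M) \<and> second_countable (mfd_topology M)"

definition preserves_metric ::
  "('m \<Rightarrow> 'k) \<Rightarrow> ('m, 'v::euclidean_space) mfd \<Rightarrow> ('k, 'v) mfd \<Rightarrow> bool" where
  "preserves_metric F M N \<longleftrightarrow> (\<forall>c\<in>atlas M. \<forall>d\<in>atlas N. \<forall>x\<in>local_dom F c d. \<forall>u v.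
     let f = local_rep F c d; f' = frechet_derivative f (at x)
     in metric N d (f x) (f' u) (f' v) = metric M c x u v)"

definition intertwines_tau ::
  "('m \<Rightarrow> 'k) \<Rightarrow> ('m, 'v::euclidean_space) mfd \<Rightarrow> ('k, 'v) mfd \<Rightarrow> bool" where
  "intertwines_tau F M N \<longleftrightarrow> (\<forall>c\<in>atlas M. \<forall>d\<in>atlas N. \<forall>x\<in>local_dom F c d. \<forall>u.
     let f = local_rep F c d; f' = frechet_derivative f (at x)
     in f' (tau M c x u) = tau N d (f x) (f' u))"

definition pseudo_Riemannian :: "('m, 'v::euclidean_space) mfd \<Rightarrow> bool" where
  "pseudo_Riemannian M \<longleftrightarrow> smooth_manifold M \<and> preserves_metric (\<lambda>p. p) M M \<and>
     (\<forall>(U, \<phi>)\<in>atlas M. let g = metric M (U, \<phi>) in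
        (\<forall>u v. smooth_on (\<lambda>x. g x u v) (\<phi> ` U)) \<and>
        (\<forall>x\<in>\<phi> ` U. bilinear (g x) \<and> (\<forall>u v. g x u v = g x v u) \<and>
           (\<forall>u. (\<forall>v. g x u v = 0) \<longrightarrow> u = 0)))"

definition almost_para_Hermitian :: "('m, 'v::euclidean_space) mfd \<Rightarrow> bool" where
  "almost_para_Hermitian M \<longleftrightarrow> pseudo_Riemannian M \<and> intertwines_tau (\<lambda>p. p) M M \<and>
     (\<forall>(U, \<phi>)\<in>atlas M. let g = metric M (U, \<phi>); t = tau M (U, \<phi>) in
        (\<forall>u. smooth_on (\<lambda>x. t x u) (\<phi> ` U)) \<and>
        (\<forall>x\<in>\<phi> ` U. linear (t x) \<and> (\<forall>u. t x (t x u) = u) \<and>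
           dim {u. t x u = u} = dim {u. t x u = - u} \<and>
           (\<forall>u v. g x (t x u) (t x v) = - g x u v)))"

definition ddir :: "('v::real_normed_vector \<Rightarrow> 'w::real_normed_vector) \<Rightarrow> 'v \<Rightarrow> 'v \<Rightarrow> 'w" where
  "ddir f x u = frechet_derivative f (at x) u"

text \<open>
  The Levi-Civita connection in a chart is \<open>D\<^sub>X Y = \<partial>\<^sub>X Y + \<Gamma>(X,Y)\<close>, with \<open>\<Gamma>\<close> given by the Koszul
  formula for constant (hence commuting) coordinate vector fields.
\<close>

definition christoffel ::
  "('m, 'v::euclidean_space) mfd \<Rightarrow> ('m, 'v) chart \<Rightarrow> 'v \<Rightarrow> 'v \<Rightarrow> 'v \<Rightarrow> 'v" where
  "christoffel M c x u v = (THE z. \<forall>w. 2 * metric M c x z w =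
     ddir (\<lambda>y. metric M c y v w) x u + ddir (\<lambda>y. metric M c y u w) x v
     - ddir (\<lambda>y. metric M c y u v) x w)"

text \<open>\<open>(D\<^sub>X \<tau>)Y = \<partial>\<^sub>X(\<tau>)Y + \<Gamma>(X,\<tau>Y) - \<tau>\<Gamma>(X,Y)\<close>\<close>

definition nabla_tau ::
  "('m, 'v::euclidean_space) mfd \<Rightarrow> ('m, 'v) chart \<Rightarrow> 'v \<Rightarrow> 'v \<Rightarrow> 'v \<Rightarrow> 'v" where
  "nabla_tau M c x X Y = ddir (\<lambda>y. tau M c y Y) x X
     + christoffel M c x X (tau M c x Y) - tau M c x (christoffel M c x X Y)"

definition curvature ::
  "('m, 'v::euclidean_space) mfd \<Rightarrow> ('m, 'v) chart \<Rightarrow> 'v \<Rightarrow> 'v \<Rightarrow> 'v \<Rightarrow> 'v \<Rightarrow> 'v" where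
  "curvature M c x X Y Z =
     ddir (\<lambda>y. christoffel M c y Y Z) x X - ddir (\<lambda>y. christoffel M c y X Z) x Y
     + christoffel M c x X (christoffel M c x Y Z) - christoffel M c x Y (christoffel M c x X Z)"

definition nearly_para_Kaehler :: "('m, 'v::euclidean_space) mfd \<Rightarrow> bool" where
  "nearly_para_Kaehler M \<longleftrightarrow> almost_para_Hermitian M \<and>
     (\<forall>(U, \<phi>)\<in>atlas M. \<forall>x\<in>\<phi> ` U. \<forall>X Y.
        nabla_tau M (U, \<phi>) x X Y = - nabla_tau M (U, \<phi>) x Y X)"

definition flat :: "('m, 'v::euclidean_space) mfd \<Rightarrow> bool" where
  "flat M \<longleftrightarrow> (\<forall>(U, \<phi>)\<in>atlas M. \<forall>x\<in>\<phi> ` U. \<forall>X Y Z. curvature M (U, \<phi>) x X Y Z = 0)"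

definition geodesic :: "('m, 'v::euclidean_space) mfd \<Rightarrow> (real \<Rightarrow> 'm) \<Rightarrow> bool" where
  "geodesic M \<gamma> \<longleftrightarrow> continuous_map euclideanreal (mfd_topology M) \<gamma> \<and>
     (\<forall>(U, \<phi>)\<in>atlas M. \<forall>t. \<gamma> t \<in> U \<longrightarrow>
        (let c = \<phi> \<circ> \<gamma>; c' = (\<lambda>s. vector_derivative c (at s)) in
           c differentiable (at t) \<and>
           (c' has_vector_derivative - christoffel M (U, \<phi>) (c t) (c' t) (c' t)) (at t)))"

text \<open>Every initial condition is realized by a geodesic defined on the whole real line.\<close>

definition geodesically_complete :: "('m, 'v::euclidean_space) mfd \<Rightarrow> bool" where
  "geodesically_complete M \<longleftrightarrow> (\<forall>(U, \<phi>)\<in>atlas M. \<forall>a\<in>U. \<forall>v.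
     \<exists>\<gamma>. geodesic M \<gamma> \<and> \<gamma> 0 = a \<and> vector_derivative (\<phi> \<circ> \<gamma>) (at 0) = v)"

text \<open>
  The analogue for abstract topologies of the library's \<^const>\<open>simply_connected\<close>: any two loops are
  freely homotopic through loops (constant loops included, so this entails path-connectedness).
\<close>

definition simply_connected_space :: "'a topology \<Rightarrow> bool" where
  "simply_connected_space X \<longleftrightarrow>
     (\<forall>a b. pathin X a \<and> a 1 = a 0 \<and> pathin X b \<and> b 1 = b 0 \<longrightarrow>
        homotopic_with (\<lambda>r. r 1 = r 0) (top_of_set {0..1}) X a b)"

definition isomorphism ::
  "('m \<Rightarrow> 'k) \<Rightarrow> ('m, 'v::euclidean_space) mfd \<Rightarrow> ('k, 'v) mfd \<Rightarrow> bool" where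
  "isomorphism F M N \<longleftrightarrow> bij_betw F (points M) (points N) \<and>
     smooth_map F M N \<and> smooth_map (inv_into (points M) F) N M \<and>
     preserves_metric F M N \<and> intertwines_tau F M N"

definition isomorphic ::
  "('m, 'v::euclidean_space) mfd \<Rightarrow> ('k, 'v) mfd \<Rightarrow> bool" where
  "isomorphic M N \<longleftrightarrow> (\<exists>F. isomorphism F M N)"


section \<open>Flat nearly para-Kaehler manifolds of type (p,q)\<close>

definition endo_exp :: "('v::euclidean_space \<Rightarrow> 'v) \<Rightarrow> 'v \<Rightarrow> 'v" where
  "endo_exp B y = (\<Sum>k. (B ^^ k) y /\<^sub>R fact k)"

definition M_of :: "'n::finite form3 \<Rightarrow> ('n pc, 'n pc) mfd" where
  "M_of \<eta> = \<lparr>points = UNIV, atlas = {(UNIV, \<lambda>x. x)},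
     metric = (\<lambda>_ x u v. gcan u v),
     tau = (\<lambda>_ x u. endo_exp (\<lambda>y. 2 *\<^sub>R (\<Sum>b\<in>Basis. (x \<bullet> b) *\<^sub>R endo \<eta> b y)) (tcan u))\<rparr>"

definition flat_npK_type :: "nat \<Rightarrow> nat \<Rightarrow> ('m, 'n::finite pc) mfd \<Rightarrow> bool" where
  "flat_npK_type p q M \<longleftrightarrow> nearly_para_Kaehler M \<and> flat M \<and>
     geodesically_complete M \<and> simply_connected_space (mfd_topology M) \<and>
     (\<exists>\<eta>\<in>Ct_type p q. isomorphic M (M_of \<eta>))"

definition iso_rel :: "nat \<Rightarrow> nat \<Rightarrow> ('m, 'n::finite pc) mfd rel" where
  "iso_rel p q = {(M, N). flat_npK_type p q M \<and> flat_npK_type p q N \<and> isomorphic M N}"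

definition iso_classes :: "nat \<Rightarrow> nat \<Rightarrow> ('m, 'n::finite pc) mfd set set" where
  "iso_classes p q = Collect (flat_npK_type p q) // iso_rel p q"

text \<open>The parameters \<open>\<eta>\<close> which describe a given manifold, on an arbitrary type of points.\<close>

definition moduli :: "nat \<Rightarrow> nat \<Rightarrow> ('m, 'n::finite pc) mfd \<Rightarrow> 'n form3 set" where
  "moduli p q M = {\<eta> \<in> Ct_type p q. isomorphic M (M_of \<eta>)}"

end

theory Submission
  imports Defs
begin

text \<open>
  The manifold \<open>M(\<eta>)\<close> has constant metric and, as \<open>\<eta>\<^sub>X \<eta>\<^sub>Y = 0\<close>, affine structure field
  \<open>\<tau>\<^sub>x = (1 + 2 \<eta>\<^sub>x) \<tau>\<close>. An isomorphism \<open>M(\<eta>) \<rightarrow> M(\<theta>)\<close> is an isometry of a flat scalar product, hence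
  affine, and correcting its linear part by \<open>1 - \<theta>\<^sub>b\<close> gives an element of \<open>G\<close> carrying \<open>\<eta>\<close> to \<open>\<theta>\<close>.
  So isomorphism classes are \<open>G\<close>-orbits. As \<open>\<eta> \<in> \<C>\<^sub>\<tau>\<close> lies in \<open>\<Lambda>\<^sup>3\<Sigma>\<^sub>\<eta>\<close> and has no mixed components,
  \<open>\<eta> \<in> \<Lambda>\<^sup>-\<Sigma>\<^sub>\<eta>\<close>; since \<open>G\<close> is transitive on isotropic subspaces of type \<open>(p,q)\<close> with \<open>p + q = n\<close>,
  every orbit meets \<open>\<Lambda>\<^sup>-\<^bsub>reg\<^esub>L\<close>, and it does so in a single \<open>G\<^sub>L\<close>-orbit because
  \<open>\<Sigma>\<^sub>\<eta> = L\<close> there. Finally \<open>G\<^sub>L\<close> induces all of \<open>GL(L\<^sup>+) \<times> GL(L\<^sup>-)\<close> on \<open>L\<close>.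
\<close>

text \<open>The factor \<open>1 - \<theta>\<^sub>b\<close> is the inverse of
  \<open>1 + \<theta>\<^sub>b\<close>, which conjugates \<tau> to the structure of the target at b,
  the image of the origin; composing with it makes the linear part commute with \<tau>. It leaves
  \<theta> alone because all products \<open>\<theta>\<^sub>X \<theta>\<^sub>Y\<close> vanish.

  The eigenspaces of \<tau> on V are {(u, u)} and {(v, -v)}, each a copy of R^n, and the pairing of
  (u, u) with (v, -v) is 2 (u . v). So an isotropic invariant subspace of type (p,q), p + q = n,
  amounts to an orthogonal splitting R^n = P + Q, and questions about G become Euclidean linear
  algebra. Transitivity needs only orthogonal maps; reaching every pair in
  \<open>GL(L\<^sup>+) \<times> GL(L\<^sup>-)\<close> needs a map together with its contragredient.

  The two general linear groups act through maps given on a subspace only. Their actions become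
  comparable with that of G once the induced map is written as a pullback of forms along the
  adjoint.

  Points may have any type and charts are arbitrary, so symmetry and transitivity of isomorphism
  take real work: local expressions of a composite factor only near each point.\<close>

declare split_paired_All [simp del] split_paired_Ex [simp del]

section \<open>The scalar product\<close>

lemma gcan_add_left: "gcan (x + y) z = gcan x z + gcan y z"
  and gcan_add_right: "gcan z (x + y) = gcan z x + gcan z y"
  and gcan_scaleR_left: "gcan (c *\<^sub>R x) z = c * gcan x z"
  and gcan_scaleR_right: "gcan z (c *\<^sub>R x) = c * gcan z x"
  and gcan_minus_left: "gcan (- x) z = - gcan x z"
  and gcan_minus_right: "gcan z (- x) = - gcan z x"
  and gcan_diff_left: "gcan (x - y) z = gcan x z - gcan y z"
  and gcan_diff_right: "gcan z (x - y) = gcan z x - gcan z y"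
  and gcan_zero_left: "gcan 0 z = 0"
  and gcan_zero_right: "gcan z 0 = 0"
  by (simp_all add: gcan_def algebra_simps)

lemmas gcan_simps = gcan_add_left gcan_add_right gcan_scaleR_left gcan_scaleR_right gcan_minus_left
  gcan_minus_right gcan_diff_left gcan_diff_right gcan_zero_left gcan_zero_right

lemma gcan_commute: "gcan x y = gcan y x"
  by (simp add: gcan_def inner_commute)

lemma bilinear_gcan: "bilinear gcan"
  by (simp add: bilinear_def linear_iff gcan_simps)

lemma gcan_eq_inner: "gcan x y = x \<bullet> (fst y, - snd y)"
  by (cases x; cases y) (simp add: gcan_def)

text \<open>Nondegeneracy: flipping the sign of the second half of the test vector turns
  \<open>gcan\<close> into the Euclidean product, which is definite.\<close>

lemma gcan_eqI:
  assumes "\<And>z. gcan x z = gcan y z"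
  shows "x = y"
proof -
  have "(x - y) \<bullet> (x - y) = gcan (x - y) (fst (x - y), - snd (x - y))"
    by (subst gcan_eq_inner) (simp del: fst_diff snd_diff)
  also have "\<dots> = 0" by (simp add: gcan_diff_left assms)
  finally show ?thesis by simp
qed

lemma linear_tcan: "linear tcan"
  by (auto simp: linear_iff tcan_def)

lemma tcan_tcan [simp]: "tcan (tcan x) = x"
  by (simp add: tcan_def)

lemma tcan_add: "tcan (x + y) = tcan x + tcan y"
  and tcan_diff: "tcan (x - y) = tcan x - tcan y"
  and tcan_scaleR: "tcan (c *\<^sub>R x) = c *\<^sub>R tcan x"
  and tcan_minus: "tcan (- x) = - tcan x"
  and tcan_zero: "tcan 0 = 0"
  by (auto simp: tcan_def zero_prod_def)

lemmas tcan_simps = tcan_add tcan_diff tcan_scaleR tcan_minus tcan_zero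

lemma gcan_tcan_left: "gcan (tcan x) y = - gcan x (tcan y)"
  by (simp add: gcan_def tcan_def)

text \<open>Conjugation of the Euclidean adjoint by the sign flip \<open>?J\<close>, which relates
  \<open>gcan\<close> to the Euclidean product.\<close>

lemma gcan_adjoint_exists:
  assumes "linear (A :: 'n::finite pc \<Rightarrow> 'n pc)"
  shows "\<exists>B. linear B \<and> (\<forall>x y. gcan (A x) y = gcan x (B y))"
proof (intro exI conjI allI)
  let ?J = "\<lambda>x :: 'n pc. (fst x, - snd x)"
  have J: "linear ?J" by (simp add: linear_iff)
  show "linear (\<lambda>x. ?J (adjoint A (?J x)))"
    using linear_compose[OF linear_compose[OF J adjoint_linear[OF assms]] J] by (simp add: comp_def)
  show "gcan (A x) y = gcan x (?J (adjoint A (?J y)))" for x y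
    by (simp add: gcan_eq_inner adjoint_works[OF assms])
qed

section \<open>Trivectors\<close>

text \<open>Linearity is demanded in the first slot only; the two transpositions carry it to the
  others.\<close>

definition alternating3 :: "'n::finite form3 \<Rightarrow> bool" where
  "alternating3 \<eta> \<longleftrightarrow> (\<forall>Y Z. linear (\<lambda>X. \<eta> X Y Z)) \<and>
     (\<forall>X Y Z. \<eta> Y X Z = - \<eta> X Y Z) \<and> (\<forall>X Y Z. \<eta> X Z Y = - \<eta> X Y Z)"

lemma trivector_Nil [simp]: "trivector [] X Y Z = 0"
  by (simp add: trivector_def)

lemma trivector_Cons [simp]:
  "trivector ((u, v, w) # ts) X Y Z = wedge3 u v w X Y Z + trivector ts X Y Z"
  by (simp add: trivector_def)

lemma trivector_append: "trivector (ts @ us) X Y Z = trivector ts X Y Z + trivector us X Y Z"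
  by (simp add: trivector_def)

lemma alternating3_trivector: "alternating3 (trivector ts)"
proof (induction ts)
  case (Cons t ts)
  obtain u v w where t: "t = (u, v, w)" by (cases t)
  have l: "linear (\<lambda>X. trivector ts X Y Z)" and swap: "trivector ts Y X Z = - trivector ts X Y Z"
    "trivector ts X Z Y = - trivector ts X Y Z" for X Y Z
    using Cons unfolding alternating3_def by blast+
  have "linear (\<lambda>X. wedge3 u v w X Y Z)" for Y Z
    by (rule linearI) (simp_all add: wedge3_def gcan_simps algebra_simps)
  then have "linear (\<lambda>X. trivector (t # ts) X Y Z)" for Y Z
    unfolding t trivector_Cons using l by (intro linear_compose_add) auto
  moreover have "trivector (t # ts) Y X Z = - trivector (t # ts) X Y Z"
    "trivector (t # ts) X Z Y = - trivector (t # ts) X Y Z" for X Y Z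
    using swap[of X Y Z] by (simp_all add: t wedge3_def algebra_simps)
  ultimately show ?case unfolding alternating3_def by blast
qed (simp add: alternating3_def linear_iff)

lemma Lambda3_alternating3: "\<eta> \<in> Lambda3 W \<Longrightarrow> alternating3 \<eta>"
  unfolding Lambda3_def using alternating3_trivector by auto

lemma Lambda3_mono: "W \<subseteq> W' \<Longrightarrow> Lambda3 W \<subseteq> Lambda3 W'"
  unfolding Lambda3_def by blast

lemma Lambda3_UNIV: "\<eta> \<in> Lambda3 W \<Longrightarrow> \<eta> \<in> Lambda3 UNIV"
  using Lambda3_mono by blast

lemma Lambda3_add:
  assumes "\<eta> \<in> Lambda3 W" "\<theta> \<in> Lambda3 W"
  shows "(\<lambda>X Y Z. \<eta> X Y Z + \<theta> X Y Z) \<in> Lambda3 W"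
proof -
  obtain ts us where "set ts \<subseteq> W \<times> W \<times> W" "set us \<subseteq> W \<times> W \<times> W" "\<eta> = trivector ts" "\<theta> = trivector us"
    using assms unfolding Lambda3_def by blast
  then show ?thesis unfolding Lambda3_def
    by (intro image_eqI[of _ _ "ts @ us"]) (auto simp: trivector_append fun_eq_iff)
qed

section \<open>Induced maps on trivectors as pullbacks\<close>

definition pullback3 :: "('n::finite pc \<Rightarrow> 'n pc) \<Rightarrow> 'n form3 \<Rightarrow> 'n form3" where
  "pullback3 B \<eta> = (\<lambda>X Y Z. \<eta> (B X) (B Y) (B Z))"

lemma trivector_map_eq_pullback3:
  assumes "set ts \<subseteq> W \<times> W \<times> W" "\<And>u X. u \<in> W \<Longrightarrow> gcan (A u) X = gcan u (B X)"
  shows "trivector (map (\<lambda>(u, v, w). (A u, A v, A w)) ts) = pullback3 B (trivector ts)"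
  using assms(1) by (induction ts) (auto simp: fun_eq_iff pullback3_def wedge3_def assms(2))

text \<open>\<open>Lambda3_map\<close> is a definite description ranging over all ways to write
  \<eta> as a sum of decomposables. It is well defined because decomposables are evaluated through
  scalar products with their factors: applying A to the factors is applying the adjoint B to the
  arguments, and this no longer mentions the representation. A enters through its values on W alone,
  which suits elements of \<open>GL W\<close>.\<close>

lemma Lambda3_map_eq_pullback3:
  assumes "\<eta> \<in> Lambda3 W" "\<And>u X. u \<in> W \<Longrightarrow> gcan (A u) X = gcan u (B X)"
  shows "Lambda3_map W A \<eta> = pullback3 B \<eta>"
proof -
  obtain ts where ts: "set ts \<subseteq> W \<times> W \<times> W" "\<eta> = trivector ts" using assms(1) unfolding Lambda3_def by blast
  show ?thesis unfolding Lambda3_map_def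
  proof (rule the_equality)
    show "\<exists>ts. set ts \<subseteq> W \<times> W \<times> W \<and> \<eta> = trivector ts \<and>
      pullback3 B \<eta> = trivector (map (\<lambda>(u, v, w). (A u, A v, A w)) ts)"
      using ts trivector_map_eq_pullback3[OF ts(1), of A B] assms(2) by metis
  qed (use trivector_map_eq_pullback3[of _ W A B] assms(2) in metis)
qed

lemma pullback3_in_Lambda3:
  assumes "\<eta> \<in> Lambda3 W" "\<And>u X. u \<in> W \<Longrightarrow> gcan (A u) X = gcan u (B X)" "A ` W \<subseteq> W'"
  shows "pullback3 B \<eta> \<in> Lambda3 W'"
proof -
  obtain ts where ts: "set ts \<subseteq> W \<times> W \<times> W" "\<eta> = trivector ts" using assms(1) unfolding Lambda3_def by blast
  have "set (map (\<lambda>(u, v, w). (A u, A v, A w)) ts) \<subseteq> W' \<times> W' \<times> W'"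
    using ts(1) assms(3) by fastforce
  then show ?thesis
    using trivector_map_eq_pullback3[OF ts(1), of A B] assms(2) ts(2) unfolding Lambda3_def
    by (metis (mono_tags, lifting) image_eqI mem_Collect_eq)
qed

lemma alternating3_linear:
  assumes "alternating3 \<eta>"
  shows "linear (\<lambda>X. \<eta> X Y Z)" "linear (\<lambda>Y. \<eta> X Y Z)" "linear (\<lambda>Z. \<eta> X Y Z)"
proof -
  show 1: "linear (\<lambda>X. \<eta> X Y Z)" for Y Z using assms unfolding alternating3_def by blast
  have "(\<lambda>Y. \<eta> X Y Z) = (\<lambda>Y. - \<eta> Y X Z)" for X Z using assms unfolding alternating3_def by (metis (no_types))
  then show 2: "linear (\<lambda>Y. \<eta> X Y Z)" for X Z using linear_compose_neg[OF 1] by simp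
  have "(\<lambda>Z. \<eta> X Y Z) = (\<lambda>Z. - \<eta> X Z Y)" using assms unfolding alternating3_def by (metis (no_types))
  then show "linear (\<lambda>Z. \<eta> X Y Z)" using linear_compose_neg[OF 2] by simp
qed

lemma alternating3_expand:
  assumes "alternating3 \<eta>"
  shows "\<eta> (X + X') Y Z = \<eta> X Y Z + \<eta> X' Y Z" "\<eta> (X - X') Y Z = \<eta> X Y Z - \<eta> X' Y Z" "\<eta> (c *\<^sub>R X) Y Z = c * \<eta> X Y Z"
    "\<eta> X (Y + Y') Z = \<eta> X Y Z + \<eta> X Y' Z" "\<eta> X (Y - Y') Z = \<eta> X Y Z - \<eta> X Y' Z" "\<eta> X (c *\<^sub>R Y) Z = c * \<eta> X Y Z"
    "\<eta> X Y (Z + Z') = \<eta> X Y Z + \<eta> X Y Z'" "\<eta> X Y (Z - Z') = \<eta> X Y Z - \<eta> X Y Z'" "\<eta> X Y (c *\<^sub>R Z) = c * \<eta> X Y Z"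
  using alternating3_linear[OF assms, THEN linear_add] alternating3_linear[OF assms, THEN linear_diff]
    alternating3_linear[OF assms, THEN linear_cmul] by simp_all

lemma alternating3_swap:
  assumes "alternating3 \<eta>"
  shows "\<eta> Y X Z = - \<eta> X Y Z" "\<eta> X Z Y = - \<eta> X Y Z" "\<eta> Z X Y = \<eta> X Y Z"
  using assms unfolding alternating3_def by (metis, metis, metis minus_minus)

section \<open>The endomorphisms of a trivector\<close>

lemma gcan_endo:
  assumes "\<eta> \<in> Lambda3 W"
  shows "gcan (endo \<eta> X Y) Z = \<eta> X Y Z"
proof -
  have l: "linear (\<eta> X Y)" using alternating3_linear(3)[OF Lambda3_alternating3[OF assms]] .
  \<comment> \<open>Euclidean representative of the functional \<open>\<eta> X Y\<close>; flipping
    the sign of its second half makes it a representative with respect to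
    \<open>gcan\<close>.\<close>
  define w where "w = (\<Sum>b\<in>Basis. \<eta> X Y b *\<^sub>R b)"
  have "w \<bullet> Z = \<eta> X Y Z" for Z
  proof -
    have "\<eta> X Y Z = (\<Sum>b\<in>Basis. (Z \<bullet> b) * \<eta> X Y b)"
      by (subst euclidean_representation[of Z, symmetric]) (simp add: linear_sum[OF l] linear_cmul[OF l])
    then show ?thesis by (simp add: w_def inner_sum_left inner_commute[of Z] mult.commute)
  qed
  then have w: "gcan (fst w, - snd w) Z = \<eta> X Y Z" for Z
    by (simp add: gcan_def inner_prod_def)
  have "endo \<eta> X Y = (fst w, - snd w)" unfolding endo_def
    by (rule the_equality) (use w gcan_eqI in \<open>metis+\<close>)
  then show ?thesis using w by simp
qed

lemma endo_eqI:
  assumes "\<And>Z. gcan W Z = \<eta> X Y Z"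
  shows "endo \<eta> X Y = W"
  unfolding endo_def by (rule the_equality) (use assms gcan_eqI in \<open>metis+\<close>)

lemma linear_endo_left:
  assumes "\<eta> \<in> Lambda3 W"
  shows "linear (\<lambda>X. endo \<eta> X Y)"
  by (intro linearI gcan_eqI)
    (simp_all add: gcan_simps gcan_endo[OF assms]
      linear_add[OF alternating3_linear(1)[OF Lambda3_alternating3[OF assms]]]
      linear_cmul[OF alternating3_linear(1)[OF Lambda3_alternating3[OF assms]]])

lemma endo_swap: "\<eta> \<in> Lambda3 W \<Longrightarrow> endo \<eta> Y X = - endo \<eta> X Y"
  using alternating3_swap(1)[OF Lambda3_alternating3, of \<eta> W Y X]
  by (intro gcan_eqI) (simp add: gcan_minus_left gcan_endo)

lemma linear_endo:
  assumes "\<eta> \<in> Lambda3 W"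
  shows "linear (endo \<eta> X)"
  by (intro linearI gcan_eqI)
    (simp_all add: gcan_simps gcan_endo[OF assms]
      linear_add[OF alternating3_linear(2)[OF Lambda3_alternating3[OF assms]]]
      linear_cmul[OF alternating3_linear(2)[OF Lambda3_alternating3[OF assms]]])

lemma gcan_endo_skew: "\<eta> \<in> Lambda3 W \<Longrightarrow> gcan (endo \<eta> X Y) Z = - gcan Y (endo \<eta> X Z)"
  using alternating3_swap(2)[OF Lambda3_alternating3, of \<eta> W X Y Z]
  by (simp add: gcan_endo gcan_commute[of Y])

lemma endo_in_subspace:
  assumes "subspace W" "\<eta> \<in> Lambda3 W"
  shows "endo \<eta> X Y \<in> W"
proof -
  obtain ts where ts: "set ts \<subseteq> W \<times> W \<times> W" "\<eta> = trivector ts" using assms(2) unfolding Lambda3_def by blast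
  have "\<exists>x\<in>W. \<forall>Z. gcan x Z = trivector ts X Y Z"
    using ts(1)
  proof (induction ts)
    case Nil
    then show ?case using subspace_0[OF assms(1)] gcan_zero_left by (intro bexI[of _ 0]) auto
  next
    case (Cons t ts)
    obtain u v w where t: "t = (u, v, w)" by (cases t)
    obtain x where x: "x \<in> W" "\<And>Z. gcan x Z = trivector ts X Y Z" using Cons by auto
    \<comment> \<open>The contraction of the decomposable with X and Y: its determinant, collected
      by the factor that is paired with Z.\<close>
    let ?y = "(gcan u X * gcan v Y - gcan u Y * gcan v X) *\<^sub>R w - (gcan u X * gcan w Y - gcan u Y * gcan w X) *\<^sub>R v
      + (gcan v X * gcan w Y - gcan v Y * gcan w X) *\<^sub>R u"
    have "?y + x \<in> W" using x(1) Cons.prems t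
      by (intro subspace_add subspace_diff subspace_scale assms(1)) auto
    moreover have "gcan (?y + x) Z = trivector (t # ts) X Y Z" for Z
      by (simp add: t x(2) gcan_simps wedge3_def algebra_simps)
    ultimately show ?case by blast
  qed
  then show ?thesis using endo_eqI ts(2) by metis
qed

lemma supp_subset: "subspace W \<Longrightarrow> \<eta> \<in> Lambda3 W \<Longrightarrow> supp \<eta> \<subseteq> W"
  unfolding supp_def by (rule span_minimal) (auto intro: endo_in_subspace)

lemma endo_in_supp: "endo \<eta> X Y \<in> supp \<eta>"
  unfolding supp_def by (rule span_base) blast

lemma subspace_supp: "subspace (supp \<eta>)"
  unfolding supp_def by simp

lemma CtD:
  assumes "\<eta> \<in> Ct"
  shows "\<eta> \<in> Lambda3 UNIV" "endo \<eta> X (endo \<eta> Y Z) = 0" "endo \<eta> (endo \<eta> X Y) Z = 0"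
    "endo \<eta> X (tcan Y) = - tcan (endo \<eta> X Y)"
proof -
  show L: "\<eta> \<in> Lambda3 UNIV" using assms unfolding Ct_def by blast
  show 1: "endo \<eta> X (endo \<eta> Y Z) = 0" for X Y Z using assms unfolding Ct_def by blast
  show "endo \<eta> (endo \<eta> X Y) Z = 0" using 1[of Z X Y] endo_swap[OF L] by (metis neg_equal_0_iff_equal)
  have "endo \<eta> X (tcan Y) + tcan (endo \<eta> X Y) = 0" using assms unfolding Ct_def by blast
  then show "endo \<eta> X (tcan Y) = - tcan (endo \<eta> X Y)" by (rule eq_neg_iff_add_eq_0[THEN iffD2])
qed

lemma tau_invariant_supp:
  assumes "\<eta> \<in> Ct"
  shows "tau_invariant (supp \<eta>)"
proof -
  have "tcan ` supp \<eta> = span (tcan ` {endo \<eta> X Y | X Y. True})"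
    unfolding supp_def by (rule linear_span_image[OF linear_tcan, symmetric])
  also have "\<dots> \<subseteq> supp \<eta>"
  proof (rule span_minimal[OF _ subspace_supp], rule subsetI)
    fix z assume "z \<in> tcan ` {endo \<eta> X Y | X Y. True}"
    then obtain X Y where z: "z = tcan (endo \<eta> X Y)" by blast
    have "tcan (endo \<eta> X Y) = endo \<eta> X (- tcan Y)"
      using CtD(4)[OF assms, of X Y] linear_neg[OF linear_endo[OF CtD(1)[OF assms]]] by simp
    then show "z \<in> supp \<eta>" using endo_in_supp z by metis
  qed
  finally show ?thesis unfolding tau_invariant_def using subspace_supp by blast
qed

text \<open>Skewness moves \<open>endo \<eta> X\<close> to the other side of the product, where it
  meets another endomorphism of \<eta> and gives zero.\<close>

lemma isotropic_supp:
  assumes "\<eta> \<in> Ct"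
  shows "isotropic (supp \<eta>)"
  unfolding isotropic_def
proof (intro ballI)
  let ?E = "{endo \<eta> X Y | X Y. True}"
  have E: "gcan x y = 0" if "x \<in> ?E" "y \<in> ?E" for x y
  proof -
    obtain X Y Z T where xy: "x = endo \<eta> X Y" "y = endo \<eta> Z T" using \<open>x \<in> ?E\<close> \<open>y \<in> ?E\<close> by blast
    have "gcan x y = - gcan Y (endo \<eta> X (endo \<eta> Z T))"
      unfolding xy by (rule gcan_endo_skew[OF CtD(1)[OF assms]])
    then show ?thesis by (simp add: CtD(2)[OF assms] gcan_zero_right)
  qed
  have sub: "subspace {x. gcan x y = 0}" "subspace {x. gcan y x = 0}" for y :: "'a pc"
    by (auto simp: subspace_def gcan_simps)
  fix x y assume x: "x \<in> supp \<eta>" and y: "y \<in> supp \<eta>"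
  have "gcan x' y = 0" if "x' \<in> ?E" for x'
  proof -
    have "supp \<eta> \<subseteq> {y. gcan x' y = 0}" unfolding supp_def
      by (rule span_minimal[OF _ sub(2)]) (use E[OF that] in blast)
    then show ?thesis using y by blast
  qed
  then have "supp \<eta> \<subseteq> {x. gcan x y = 0}" unfolding supp_def
    by (intro span_minimal[OF _ sub(1)]) blast
  then show "gcan x y = 0" using x by blast
qed

section \<open>The automorphism group\<close>

lemma linear_inverse:
  assumes "linear f" "\<And>x. g (f x) = x" "\<And>x. f (g x) = x"
  shows "linear g"
proof (rule linearI)
  show "g (x + y) = g x + g y" for x y
    using assms(2)[of "g x + g y"] by (simp add: linear_add[OF assms(1)] assms(3))
  show "g (c *\<^sub>R x) = c *\<^sub>R g x" for c x
    using assms(2)[of "c *\<^sub>R g x"] by (simp add: linear_cmul[OF assms(1)] assms(3))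
qed

lemma AutVD:
  assumes "A \<in> AutV"
  shows "linear A" "bij A" "gcan (A x) (A y) = gcan x y" "A (tcan x) = tcan (A x)"
    "A (inv A x) = x" "inv A (A x) = x"
proof -
  show "linear A" "bij A" "gcan (A x) (A y) = gcan x y" "A (tcan x) = tcan (A x)"
    using assms unfolding AutV_def by blast+
  then show "A (inv A x) = x" "inv A (A x) = x"
    by (simp_all add: bij_is_surj surj_f_inv_f bij_is_inj)
qed

lemma AutV_inv:
  assumes "A \<in> AutV"
  shows "inv A \<in> AutV"
proof -
  note A = AutVD[OF assms]
  have "linear (inv A)"
    using linear_inverse[OF A(1)] A(5,6) by blast
  moreover have "inv A (tcan x) = tcan (inv A x)" for x
    using A(6)[of "tcan (inv A x)"] by (simp add: A(4,5))
  moreover have "gcan (inv A x) (inv A y) = gcan x y" for x y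
    using A(3)[of "inv A x" "inv A y"] by (simp add: A(5))
  ultimately show ?thesis unfolding AutV_def using bij_imp_bij_inv[OF A(2)] by blast
qed

lemma AutV_comp: "A \<in> AutV \<Longrightarrow> B \<in> AutV \<Longrightarrow> A \<circ> B \<in> AutV"
  unfolding AutV_def by (simp add: linear_compose bij_comp)

lemma AutV_id: "id \<in> AutV"
  using linear_id by (simp add: AutV_def)

lemma AutV_adjoint: "A \<in> AutV \<Longrightarrow> gcan (A u) X = gcan u (inv A X)"
  by (metis AutVD(3,5))

lemma Lambda3_map_AutV:
  "A \<in> AutV \<Longrightarrow> \<eta> \<in> Lambda3 W \<Longrightarrow> Lambda3_map UNIV A \<eta> = pullback3 (inv A) \<eta>"
  using Lambda3_map_eq_pullback3[OF Lambda3_UNIV AutV_adjoint] by blast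

lemma Lambda3_map_in_Lambda3:
  "A \<in> AutV \<Longrightarrow> \<eta> \<in> Lambda3 UNIV \<Longrightarrow> Lambda3_map UNIV A \<eta> \<in> Lambda3 UNIV"
  by (subst Lambda3_map_AutV, assumption, assumption, rule pullback3_in_Lambda3[where A = A], assumption,
      rule AutV_adjoint, assumption, rule subset_UNIV)

lemma Lambda3_map_comp:
  assumes "A \<in> AutV" "B \<in> AutV" "\<eta> \<in> Lambda3 UNIV"
  shows "Lambda3_map UNIV A (Lambda3_map UNIV B \<eta>) = Lambda3_map UNIV (A \<circ> B) \<eta>"
  using Lambda3_map_AutV[OF assms(1) Lambda3_map_in_Lambda3[OF assms(2,3)]]
    Lambda3_map_AutV[OF assms(2,3)] Lambda3_map_AutV[OF AutV_comp[OF assms(1,2)] assms(3)]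
  by (simp add: pullback3_def o_inv_distrib[OF AutVD(2) AutVD(2), OF assms(1,2)])

lemma Lambda3_map_id: "\<eta> \<in> Lambda3 UNIV \<Longrightarrow> Lambda3_map UNIV id \<eta> = \<eta>"
  using Lambda3_map_AutV[OF AutV_id] by (simp add: pullback3_def)

lemma Lambda3_map_inv:
  assumes "A \<in> AutV" "\<eta> \<in> Lambda3 UNIV"
  shows "Lambda3_map UNIV (inv A) (Lambda3_map UNIV A \<eta>) = \<eta>"
proof -
  have "inv A \<circ> A = id" using AutVD(6)[OF assms(1)] by auto
  then show ?thesis using Lambda3_map_comp[OF AutV_inv[OF assms(1)] assms] Lambda3_map_id[OF assms(2)] by simp
qed

lemma endo_Lambda3_map:
  assumes "A \<in> AutV" "\<eta> \<in> Lambda3 UNIV"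
  shows "endo (Lambda3_map UNIV A \<eta>) X Y = A (endo \<eta> (inv A X) (inv A Y))"
  by (rule endo_eqI)
    (simp add: Lambda3_map_AutV[OF assms] pullback3_def AutV_adjoint[OF assms(1)] gcan_endo[OF assms(2)])

text \<open>A form is recovered from its endomorphisms by \<open>gcan\<close>, so equality of forms
  can be tested on them. This is how the corrected linear part of an isomorphism is seen to carry
  \<eta> to \<theta>.\<close>

lemma Lambda3_map_eq_iff:
  assumes "A \<in> AutV" "\<eta> \<in> Lambda3 UNIV" "\<theta> \<in> Lambda3 UNIV"
  shows "\<theta> = Lambda3_map UNIV A \<eta> \<longleftrightarrow> (\<forall>X Y. endo \<theta> (A X) (A Y) = A (endo \<eta> X Y))"
proof
  assume R: "\<forall>X Y. endo \<theta> (A X) (A Y) = A (endo \<eta> X Y)"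
  have "\<theta> X Y Z = Lambda3_map UNIV A \<eta> X Y Z" for X Y Z
    using R AutVD(5)[OF assms(1)] endo_Lambda3_map[OF assms(1,2)]
      gcan_endo[OF assms(3)] gcan_endo[OF Lambda3_map_in_Lambda3[OF assms(1,2)]] by metis
  then show "\<theta> = Lambda3_map UNIV A \<eta>" by blast
qed (simp add: endo_Lambda3_map assms AutVD(6)[OF assms(1)])

lemma supp_Lambda3_map:
  assumes "A \<in> AutV" "\<eta> \<in> Lambda3 UNIV"
  shows "supp (Lambda3_map UNIV A \<eta>) = A ` supp \<eta>"
proof -
  have "{endo (Lambda3_map UNIV A \<eta>) X Y | X Y. True} = A ` {endo \<eta> X Y | X Y. True}"
  proof (intro equalityI subsetI)
    fix x assume "x \<in> A ` {endo \<eta> X Y | X Y. True}"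
    then obtain X Y where "x = A (endo \<eta> X Y)" by blast
    then have "x = endo (Lambda3_map UNIV A \<eta>) (A X) (A Y)"
      using endo_Lambda3_map[OF assms] AutVD(6)[OF assms(1)] by simp
    then show "x \<in> {endo (Lambda3_map UNIV A \<eta>) X Y | X Y. True}" by blast
  qed (use endo_Lambda3_map[OF assms] in blast)
  then show ?thesis unfolding supp_def using linear_span_image[OF AutVD(1)[OF assms(1)]] by simp
qed

lemma Lambda3_map_in_Ct:
  assumes "A \<in> AutV" "\<eta> \<in> Ct"
  shows "Lambda3_map UNIV A \<eta> \<in> Ct"
proof -
  note L = CtD(1)[OF assms(2)] and A = AutVD[OF assms(1)] AutVD(4)[OF AutV_inv[OF assms(1)]]
  note e = endo_Lambda3_map[OF assms(1) L]
  have "endo (Lambda3_map UNIV A \<eta>) X (endo (Lambda3_map UNIV A \<eta>) Y Z) = 0" for X Y Z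
    by (simp add: e A(6) CtD(2)[OF assms(2)] linear_0[OF A(1)])
  moreover have "endo (Lambda3_map UNIV A \<eta>) X (tcan Z) + tcan (endo (Lambda3_map UNIV A \<eta>) X Z) = 0" for X Z
    unfolding e A(7) CtD(4)[OF assms(2)] A(4)[symmetric] linear_neg[OF A(1)] by simp
  ultimately show ?thesis unfolding Ct_def using Lambda3_map_in_Lambda3[OF assms(1) L] by blast
qed

lemma eig_image:
  assumes "A \<in> AutV"
  shows "eig_plus (A ` W) = A ` eig_plus W" "eig_minus (A ` W) = A ` eig_minus W"
proof -
  have "tcan (A x) = A x \<longleftrightarrow> tcan x = x" "tcan (A x) = - A x \<longleftrightarrow> tcan x = - x" for x
    using inj_eq[OF bij_is_inj[OF AutVD(2)[OF assms]]] AutVD(4)[OF assms]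
    by (simp_all add: linear_neg[OF AutVD(1)[OF assms], symmetric] flip: AutVD(4)[OF assms])
  then show "eig_plus (A ` W) = A ` eig_plus W" "eig_minus (A ` W) = A ` eig_minus W"
    unfolding eig_plus_def eig_minus_def by blast+
qed

lemma subspace_eig:
  assumes "subspace W"
  shows "subspace (eig_plus W)" "subspace (eig_minus W)"
  using assms unfolding eig_plus_def eig_minus_def subspace_def by (auto simp: tcan_simps)

lemma has_type_image:
  assumes "A \<in> AutV" "has_type W p q"
  shows "has_type (A ` W) p q"
proof -
  have i: "inj A" "linear A" using AutVD[OF assms(1)] bij_is_inj by auto
  have "dim (A ` S) = dim S" for S using dim_image_eq[OF i(2)] i(1) inj_on_subset by blast
  moreover have "tau_invariant (A ` W)"
    using assms(2) linear_subspace_image[OF i(2)]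
    unfolding has_type_def tau_invariant_def image_subset_iff
    by (metis (no_types, lifting) AutVD(4)[OF assms(1)] imageE imageI)
  ultimately show ?thesis using assms(2) unfolding has_type_def by (simp add: eig_image[OF assms(1)])
qed

lemma Lambda3_map_in_Ct_type:
  assumes "A \<in> AutV" "\<eta> \<in> Ct_type p q"
  shows "Lambda3_map UNIV A \<eta> \<in> Ct_type p q"
proof -
  have "\<eta> \<in> Ct" "has_type (supp \<eta>) p q" using assms(2) unfolding Ct_type_def by auto
  then show ?thesis unfolding Ct_type_def
    using Lambda3_map_in_Ct[OF assms(1)] supp_Lambda3_map[OF assms(1) CtD(1)] has_type_image[OF assms(1)] by auto
qed

section \<open>Isotropic subspaces invariant under the para-complex structure\<close>

lemma eig_decomp:
  assumes "tau_invariant W" "x \<in> W"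
  shows "(1/2) *\<^sub>R (x + tcan x) \<in> eig_plus W" "(1/2) *\<^sub>R (x - tcan x) \<in> eig_minus W"
    "x = (1/2) *\<^sub>R (x + tcan x) + (1/2) *\<^sub>R (x - tcan x)"
proof -
  have s: "subspace W" "tcan x \<in> W" using assms unfolding tau_invariant_def by auto
  show "(1/2) *\<^sub>R (x + tcan x) \<in> eig_plus W"
    using subspace_scale[OF s(1) subspace_add[OF s(1) assms(2) s(2)]]
    unfolding eig_plus_def by (simp add: tcan_simps add.commute)
  show "(1/2) *\<^sub>R (x - tcan x) \<in> eig_minus W"
    using subspace_scale[OF s(1) subspace_diff[OF s(1) assms(2) s(2)]]
    unfolding eig_minus_def by (simp add: tcan_simps algebra_simps)
  show "x = (1/2) *\<^sub>R (x + tcan x) + (1/2) *\<^sub>R (x - tcan x)"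
    by (simp add: scaleR_add_right[symmetric] flip: scaleR_2)
qed

lemma tau_invariant_eq_sum:
  assumes "tau_invariant W"
  shows "W = {x + y | x y. x \<in> eig_plus W \<and> y \<in> eig_minus W}"
proof (intro equalityI subsetI)
  fix x assume "x \<in> W"
  then show "x \<in> {x + y | x y. x \<in> eig_plus W \<and> y \<in> eig_minus W}" using eig_decomp[OF assms] by blast
next
  fix z assume "z \<in> {x + y | x y. x \<in> eig_plus W \<and> y \<in> eig_minus W}"
  then show "z \<in> W" using assms subspace_add unfolding tau_invariant_def eig_plus_def eig_minus_def by blast
qed

lemma dim_of_type:
  assumes "has_type W p q"
  shows "dim W = p + q"
proof -
  have t: "tau_invariant W" "dim (eig_plus W) = p" "dim (eig_minus W) = q"
    using assms unfolding has_type_def by auto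
  have "x = 0" if "tcan x = x" "tcan x = - x" for x :: "'a pc"
  proof -
    have "x + x = x + tcan x" using that(1) by simp
    also have "\<dots> = 0" using that(2) by simp
    finally show ?thesis by (simp flip: scaleR_2)
  qed
  then have "eig_plus W \<inter> eig_minus W = {0}"
    using t(1) unfolding eig_plus_def eig_minus_def tau_invariant_def by (auto simp: subspace_0 tcan_zero)
  moreover have "subspace W" using t(1) unfolding tau_invariant_def by auto
  ultimately show ?thesis
    using dim_sums_Int[OF subspace_eig, of W W] t tau_invariant_eq_sum[OF t(1)] by simp
qed

section \<open>Extending and gluing linear maps\<close>

lemma linear_extend_subspace:
  fixes f :: "'a::euclidean_space \<Rightarrow> 'b::euclidean_space"
  assumes "subspace S" "\<And>x y. x \<in> S \<Longrightarrow> y \<in> S \<Longrightarrow> f (x + y) = f x + f y"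
    "\<And>c x. x \<in> S \<Longrightarrow> f (c *\<^sub>R x) = c *\<^sub>R f x"
  shows "\<exists>g. linear g \<and> (\<forall>x\<in>S. g x = f x)"
proof -
  obtain B where B: "B \<subseteq> S" "independent B" "S \<subseteq> span B" by (metis basis_exists)
  obtain g where g: "linear g" "\<And>x. x \<in> B \<Longrightarrow> g x = f x"
    using linear_independent_extend[OF B(2)] by metis
  have "f 0 = 0" using assms(3)[OF subspace_0[OF assms(1)], of 0] by simp
  then have "subspace {x \<in> S. g x = f x}"
    using assms g(1) unfolding subspace_def by (auto simp: linear_add linear_cmul linear_0)
  then have "span B \<subseteq> {x \<in> S. g x = f x}"
    by (rule span_minimal[rotated]) (use B g in auto)
  then show ?thesis using B(3) g(1) by blast
qed

text \<open>Orthonormal bases of P and Q together form an orthogonal set without 0, hence an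
  independent one, so values may be prescribed on both at once.\<close>

lemma linear_glue:
  fixes f h :: "'a::euclidean_space \<Rightarrow> 'b::euclidean_space"
  assumes "linear f" "linear h" "subspace P" "subspace Q" "\<And>x y. x \<in> P \<Longrightarrow> y \<in> Q \<Longrightarrow> x \<bullet> y = 0"
  shows "\<exists>g. linear g \<and> (\<forall>x\<in>P. g x = f x) \<and> (\<forall>y\<in>Q. g y = h y)"
proof -
  obtain B where B: "B \<subseteq> P" "pairwise orthogonal B" "\<And>x. x \<in> B \<Longrightarrow> norm x = 1" "span B = P"
    using orthonormal_basis_subspace[OF assms(3)] by metis
  obtain C where C: "C \<subseteq> Q" "pairwise orthogonal C" "\<And>x. x \<in> C \<Longrightarrow> norm x = 1" "span C = Q"
    using orthonormal_basis_subspace[OF assms(4)] by metis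
  have BC: "x \<bullet> y = 0" if "x \<in> B" "y \<in> C" for x y using assms(5) B(1) C(1) that by blast
  have "independent (B \<union> C)"
  proof (rule pairwise_orthogonal_independent)
    show "pairwise orthogonal (B \<union> C)"
      using B(2) C(2) BC unfolding pairwise_def orthogonal_def by (metis UnE inner_commute)
    show "0 \<notin> B \<union> C" using B(3) C(3) by force
  qed
  then obtain g where g: "linear g" "\<And>x. x \<in> B \<union> C \<Longrightarrow> g x = (if x \<in> B then f x else h x)"
    using linear_independent_extend[of "B \<union> C" "\<lambda>x. if x \<in> B then f x else h x"] by metis
  have "x \<notin> B" if "x \<in> C" for x using BC[OF _ that] C(3)[OF that] by force
  then have "g x = h x" if "x \<in> Q" for x
    using linear_eq_on[OF g(1) assms(2), of x C] that C(4) g(2) by auto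
  moreover have "g x = f x" if "x \<in> P" for x
    using linear_eq_on[OF g(1) assms(1), of x B] that B(4) g(2) by auto
  ultimately show ?thesis using g(1) by blast
qed

lemma linear_projection_exists:
  fixes S :: "'a::euclidean_space set"
  assumes "subspace S"
  shows "\<exists>A. linear A \<and> range A \<subseteq> S \<and> (\<forall>x\<in>S. A x = x)"
proof -
  let ?O = "{y. \<forall>x\<in>S. orthogonal x y}"
  have "subspace ?O" by (auto simp: subspace_def orthogonal_clauses)
  then have "\<exists>A. linear A \<and> (\<forall>x\<in>S. A x = id x) \<and> (\<forall>y\<in>?O. A y = 0)"
    by (intro linear_glue[OF linear_id linear_zero assms]) (simp_all add: orthogonal_def)
  then obtain A where A: "linear A" "\<And>x. x \<in> S \<Longrightarrow> A x = x" "\<And>y. y \<in> ?O \<Longrightarrow> A y = 0"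
    by (metis id_apply)
  have "A x \<in> S" for x
  proof -
    obtain y z where yz: "y \<in> span S" "\<And>w. w \<in> span S \<Longrightarrow> orthogonal z w" "x = y + z"
      using orthogonal_subspace_decomp_exists[of S x] by metis
    have "y \<in> S" using yz(1) assms span_eq_iff by blast
    moreover have "z \<in> ?O" using yz(2) span_base orthogonal_commute by blast
    ultimately show ?thesis using A yz(3) by (simp add: linear_add)
  qed
  then show ?thesis using A by blast
qed

text \<open>A projection onto the support fixes every \<open>\<eta>\<^sub>X Y\<close>, so its
  adjoint may be inserted in each argument without changing \<eta>; this places \<eta> in
  \<open>\<Lambda>\<^sup>3\<close> of the support. Anticommutation lets \<tau> move freely from one
  argument to another, so \<eta> vanishes when two arguments have opposite eigenvalues, and only the
  two pure parts remain.\<close>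

lemma Ct_in_Lambda_minus:
  assumes "\<eta> \<in> Ct"
  shows "\<eta> \<in> Lambda_minus (supp \<eta>)"
proof -
  note L = CtD(1)[OF assms]
  note a = Lambda3_alternating3[OF L]
  obtain A where A: "linear A" "range A \<subseteq> supp \<eta>" "\<And>x. x \<in> supp \<eta> \<Longrightarrow> A x = x"
    using linear_projection_exists[OF subspace_supp] by blast
  obtain B where B: "\<And>x y. gcan (A x) y = gcan x (B y)" using gcan_adjoint_exists[OF A(1)] by blast
  have 1: "\<eta> X Y (B Z) = \<eta> X Y Z" for X Y Z
    by (metis gcan_endo[OF L] B A(3) endo_in_supp)
  then have "\<eta> X (B Y) Z = \<eta> X Y Z" "\<eta> (B X) Y Z = \<eta> X Y Z" for X Y Z
    using alternating3_swap[OF a] by metis+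
  then have "pullback3 B \<eta> = \<eta>" using 1 by (simp add: pullback3_def)
  then have S: "\<eta> \<in> Lambda3 (supp \<eta>)" using pullback3_in_Lambda3[OF L, of A B] A(2) B by auto
  note t = tau_invariant_supp[OF assms]
  \<comment> \<open>Since \<tau> is skew for \<open>gcan\<close>, the adjoint of the projection
    \<open>?p\<close> to the +1 eigenspace is \<open>?m\<close>; hence the crossed signs in the two
    pullbacks below.\<close>
  let ?p = "\<lambda>x :: 'a pc. (1/2) *\<^sub>R (x + tcan x)" and ?m = "\<lambda>x :: 'a pc. (1/2) *\<^sub>R (x - tcan x)"
  have p: "pullback3 ?m \<eta> \<in> Lambda3 (eig_plus (supp \<eta>))"
    by (rule pullback3_in_Lambda3[OF S, of ?p])
      (auto simp: gcan_simps gcan_tcan_left intro!: eig_decomp[OF t])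
  have m: "pullback3 ?p \<eta> \<in> Lambda3 (eig_minus (supp \<eta>))"
    by (rule pullback3_in_Lambda3[OF S, of ?m])
      (auto simp: gcan_simps gcan_tcan_left intro!: eig_decomp[OF t])
  have 2: "\<eta> X (tcan Y) Z = \<eta> X Y (tcan Z)" for X Y Z
    by (simp add: gcan_endo[OF L, symmetric] CtD(4)[OF assms] gcan_simps gcan_tcan_left)
  then have 3: "\<eta> (tcan X) Y Z = \<eta> X Y (tcan Z)" for X Y Z using alternating3_swap[OF a] by metis
  have "\<eta> X Y Z = pullback3 ?m \<eta> X Y Z + pullback3 ?p \<eta> X Y Z" for X Y Z
    unfolding pullback3_def
    by (simp add: alternating3_expand[OF a] 2 3 field_simps)
  then show ?thesis unfolding Lambda_minus_def using p m by blast
qed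

section \<open>Eigenspaces of \<tau> as subspaces of R^n\<close>

definition half_plus :: "'n::finite pc set \<Rightarrow> (real, 'n) vec set" where
  "half_plus W = {u. (u, u) \<in> W}"

definition half_minus :: "'n::finite pc set \<Rightarrow> (real, 'n) vec set" where
  "half_minus W = {v. (v, - v) \<in> W}"

lemma eig_eq_half:
  "eig_plus W = (\<lambda>u. (u, u)) ` half_plus W" "eig_minus W = (\<lambda>v. (v, - v)) ` half_minus W"
proof -
  have "tcan x = x \<longleftrightarrow> x = (fst x, fst x)" "tcan x = - x \<longleftrightarrow> x = (fst x, - fst x)" for x :: "'a pc"
    by (cases x; auto simp: tcan_def)+
  then show "eig_plus W = (\<lambda>u. (u, u)) ` half_plus W" "eig_minus W = (\<lambda>v. (v, - v)) ` half_minus W"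
    unfolding eig_plus_def eig_minus_def half_plus_def half_minus_def by (auto simp: image_iff)
qed

lemma subspace_half:
  assumes "subspace W"
  shows "subspace (half_plus W)" "subspace (half_minus W)"
proof -
  have "linear (\<lambda>u :: (real, 'a) vec. (u, u))" "linear (\<lambda>u :: (real, 'a) vec. (u, - u))"
    by (auto simp: linear_iff)
  moreover have "half_plus W = (\<lambda>u. (u, u)) -` W" "half_minus W = (\<lambda>u. (u, - u)) -` W"
    unfolding half_plus_def half_minus_def by blast+
  ultimately show "subspace (half_plus W)" "subspace (half_minus W)"
    using assms by (simp_all add: linear_subspace_vimage)
qed

lemma dim_half:
  "dim (half_plus W) = dim (eig_plus W)" "dim (half_minus W) = dim (eig_minus W)"
proof -
  have "linear (\<lambda>u :: (real, 'a) vec. (u, u))" "linear (\<lambda>u :: (real, 'a) vec. (u, - u))"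
    by (auto simp: linear_iff)
  then show "dim (half_plus W) = dim (eig_plus W)" "dim (half_minus W) = dim (eig_minus W)"
    unfolding eig_eq_half by (auto simp: dim_image_eq inj_on_def)
qed

lemma mem_iff_half:
  assumes "tau_invariant W"
  shows "x \<in> W \<longleftrightarrow> fst x + snd x \<in> half_plus W \<and> fst x - snd x \<in> half_minus W"
proof -
  have s: "subspace W" and t: "tcan x \<in> W" if "x \<in> W" for x using assms that unfolding tau_invariant_def by auto
  show ?thesis
  proof
    assume x: "x \<in> W"
    have "x + tcan x = (fst x + snd x, fst x + snd x)" "x - tcan x = (fst x - snd x, - (fst x - snd x))"
      by (auto simp: tcan_def prod_eq_iff)
    then show "fst x + snd x \<in> half_plus W \<and> fst x - snd x \<in> half_minus W"
      using subspace_add[OF s[OF x] x t[OF x]] subspace_diff[OF s[OF x] x t[OF x]] unfolding half_plus_def half_minus_def by auto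
  next
    assume a: "fst x + snd x \<in> half_plus W \<and> fst x - snd x \<in> half_minus W"
    have sW: "subspace W" using assms unfolding tau_invariant_def by auto
    have "x = (1/2) *\<^sub>R ((fst x + snd x, fst x + snd x) + (fst x - snd x, - (fst x - snd x)))"
      by (auto simp: prod_eq_iff simp flip: scaleR_2)
    moreover have "(fst x + snd x, fst x + snd x) \<in> W" "(fst x - snd x, - (fst x - snd x)) \<in> W"
      using a unfolding half_plus_def half_minus_def by blast+
    ultimately show "x \<in> W" using subspace_scale[OF sW subspace_add[OF sW]] by metis
  qed
qed

lemma half_orthogonal:
  assumes "isotropic W" "u \<in> half_plus W" "v \<in> half_minus W"
  shows "u \<bullet> v = 0"
proof -
  have "gcan (u, u) (v, - v) = 0" using assms unfolding isotropic_def half_plus_def half_minus_def by auto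
  then show ?thesis by (simp add: gcan_def)
qed

text \<open>The halves are orthogonal and therefore meet only in 0; their dimensions add up to n, so
  together they span R^n.\<close>

lemma half_decomp:
  assumes "isotropic (W :: 'n::finite pc set)" "has_type W p q" "p + q = CARD('n)"
  shows "\<exists>u\<in>half_plus W. \<exists>v\<in>half_minus W. x = u + v"
proof -
  let ?P = "half_plus W" and ?Q = "half_minus W"
  have d: "dim ?P = p" "dim ?Q = q" "subspace W" using assms(2) dim_half unfolding has_type_def tau_invariant_def by auto
  note s = subspace_half[OF d(3)]
  have "x = 0" if "x \<in> ?P" "x \<in> ?Q" for x using half_orthogonal[OF assms(1) that] by simp
  then have "?P \<inter> ?Q = {0}" using s subspace_0 by blast
  then have "dim {u + v | u v. u \<in> ?P \<and> v \<in> ?Q} = CARD('n)"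
    using dim_sums_Int[OF s] d assms(3) by simp
  then have "{u + v | u v. u \<in> ?P \<and> v \<in> ?Q} = UNIV"
    using subspace_dim_equal[OF subspace_sums[OF s] subspace_UNIV] by simp
  then show ?thesis by blast
qed

text \<open>Every automorphism acts by some \<open>a\<close> on the \<open>+1\<close> eigenspace \<open>{(u, u)}\<close> and contragrediently
  on the \<open>-1\<close> eigenspace \<open>{(v, -v)}\<close>; this is \<open>Aut(V) \<cong> GL(n)\<close>.\<close>

definition pair_map ::
  "((real, 'n) vec \<Rightarrow> (real, 'n) vec) \<Rightarrow> ((real, 'n) vec \<Rightarrow> (real, 'n) vec) \<Rightarrow> 'n::finite pc \<Rightarrow> 'n pc" where
  "pair_map a b = (\<lambda>x. (1/2) *\<^sub>R (a (fst x + snd x) + b (fst x - snd x), a (fst x + snd x) - b (fst x - snd x)))"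

text \<open>In the coordinates \<open>fst x + snd x\<close> and \<open>fst x - snd x\<close>,
  \<open>gcan\<close> is half the sum of the two cross pairings, so it is preserved when b is the
  inverse transpose of a. The map \<tau> fixes the first coordinate and negates the second, whence
  the commutation.\<close>

lemma pair_map_AutV:
  fixes a b :: "(real, 'n::finite) vec \<Rightarrow> (real, 'n) vec"
  assumes "linear a" "linear b" "\<And>u v. a u \<bullet> b v = u \<bullet> v"
  shows "pair_map a b \<in> AutV" "pair_map a b (u, u) = (a u, a u)" "pair_map a b (v, - v) = (b v, - b v)"
proof -
  let ?C = "pair_map a b"
  note C_def = pair_map_def
  have "linear (\<lambda>x. a (fst x + snd x))" "linear (\<lambda>x. b (fst x - snd x))"
    using linear_compose[of "\<lambda>x. fst x + snd x", OF _ assms(1)] linear_compose[of "\<lambda>x. fst x - snd x", OF _ assms(2)]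
    by (simp_all add: comp_def linear_iff algebra_simps)
  moreover have "linear (\<lambda>x. (1/2) *\<^sub>R (f x + g x, f x - g x))" if "linear f" "linear g"
    for f g :: "'n pc \<Rightarrow> (real, 'n) vec"
    using that by (intro linearI) (simp_all add: linear_add linear_cmul algebra_simps)
  ultimately have l: "linear ?C" unfolding C_def
    by blast
  have g: "gcan (?C x) (?C y) = gcan x y" for x y
  proof -
    have "gcan (?C x) (?C y) = (a (fst x + snd x) \<bullet> b (fst y - snd y) + a (fst y + snd y) \<bullet> b (fst x - snd x)) / 2"
      by (simp add: gcan_def C_def inner_simps inner_commute) (simp add: field_simps)
    also have "\<dots> = gcan x y" unfolding assms(3)
      by (simp add: gcan_def inner_simps inner_commute)
    finally show ?thesis .
  qed
  have t: "?C (tcan x) = tcan (?C x)" for x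
    using linear_neg[OF assms(2), of "fst x - snd x"] by (simp add: C_def tcan_def algebra_simps)
  have "inj ?C" unfolding linear_injective_0[OF l]
    by (metis g gcan_eqI gcan_zero_left)
  then have "bij ?C" using linear_injective_imp_surjective[OF l] by (simp add: bij_def)
  then show "?C \<in> AutV" unfolding AutV_def using l g t by blast
  show "?C (u, u) = (a u, a u)" "?C (v, - v) = (b v, - b v)"
    using linear_0[OF assms(1)] linear_0[OF assms(2)] linear_cmul[OF assms(1), of 2] linear_cmul[OF assms(2), of 2]
    by (simp_all add: C_def flip: scaleR_2)
qed

text \<open>Both subspaces give orthogonal splittings of R^n with the same dimensions, so an
  orthogonal g carries one to the other. An orthogonal map is its own contragredient, which makes
  \<open>pair_map g g\<close> an automorphism.\<close>

lemma AutV_transitive: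
  fixes W W' :: "'n::finite pc set"
  assumes "isotropic W" "has_type W p q" "isotropic W'" "has_type W' p q" "p + q = CARD('n)"
  shows "\<exists>A\<in>AutV. A ` W = W'"
proof -
  have t: "tau_invariant W" "tau_invariant W'" and sW: "subspace W" "subspace W'"
    using assms unfolding has_type_def tau_invariant_def by auto
  note s = subspace_half[OF sW(1)] and s' = subspace_half[OF sW(2)]
  have d: "dim (half_plus W) = dim (half_plus W')" "dim (half_minus W) = dim (half_minus W')"
    using assms(2,4) unfolding has_type_def by (simp_all add: dim_half)
  obtain f where f: "linear f" "f ` half_plus W = half_plus W'" "\<And>x. x \<in> half_plus W \<Longrightarrow> norm (f x) = norm x"
    using isometry_subspaces[OF s(1) s'(1) d(1)] by metis
  obtain h where h: "linear h" "h ` half_minus W = half_minus W'" "\<And>x. x \<in> half_minus W \<Longrightarrow> norm (h x) = norm x"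
    using isometry_subspaces[OF s(2) s'(2) d(2)] by metis
  obtain g where g: "linear g" "\<And>x. x \<in> half_plus W \<Longrightarrow> g x = f x" "\<And>x. x \<in> half_minus W \<Longrightarrow> g x = h x"
    using linear_glue[OF f(1) h(1) s half_orthogonal[OF assms(1)]] by metis
  have "norm (g x) = norm x" for x
  proof -
    obtain u v where u: "u \<in> half_plus W" "v \<in> half_minus W" "x = u + v" using half_decomp[OF assms(1,2,5)] by blast
    have "f u \<bullet> h v = 0" "u \<bullet> v = 0" using half_orthogonal assms(1,3) u f(2) h(2) by blast+
    then have "norm (f u + h v) ^ 2 = norm (u + v) ^ 2"
      using f(3)[OF u(1)] h(3)[OF u(2)] by (simp add: norm_add_Pythagorean orthogonal_def)
    then show ?thesis using u g by (simp add: linear_add)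
  qed
  then have o: "orthogonal_transformation g" unfolding orthogonal_transformation using g(1) by blast
  then have gg: "g u \<bullet> g v = u \<bullet> v" for u v by (simp add: orthogonal_transformation_def)
  define C where "C = pair_map g g"
  note C = pair_map_AutV[OF g(1) g(1) gg, folded C_def]
  have Cx: "C x \<in> W' \<longleftrightarrow> g (fst x + snd x) \<in> half_plus W' \<and> g (fst x - snd x) \<in> half_minus W'" for x
    unfolding mem_iff_half[OF t(2)] C_def pair_map_def by (simp add: scaleR_add_right[symmetric] scaleR_diff_right[symmetric] flip: scaleR_2)
  have "C ` W = W'"
  proof (intro equalityI subsetI)
    fix y assume "y \<in> C ` W"
    then obtain x where x: "y = C x" "fst x + snd x \<in> half_plus W" "fst x - snd x \<in> half_minus W"
      using mem_iff_half[OF t(1)] by blast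
    then show "y \<in> W'" using Cx[of x] f(2) h(2) g(2,3) by auto
  next
    fix y assume y: "y \<in> W'"
    obtain x where x: "y = C x" using AutVD(5)[OF C(1)] by metis
    have gi: "inj g" using o orthogonal_transformation_inj by blast
    obtain u v where "u \<in> half_plus W" "g (fst x + snd x) = g u" "v \<in> half_minus W" "g (fst x - snd x) = g v"
      using y Cx[of x] f(2) h(2) g(2,3) unfolding x by (metis imageE)
    then have "x \<in> W" using gi unfolding mem_iff_half[OF t(1)] inj_def by auto
    then show "y \<in> C ` W" using x by blast
  qed
  then show ?thesis using C(1) by blast
qed

section \<open>Realizing pairs of linear automorphisms of the eigenspaces in the stabilizer\<close>

lemma adjoint_id_on:
  fixes k :: "'a::euclidean_space \<Rightarrow> 'a"
  assumes "linear k" "u \<in> P" "\<And>x. x \<in> P \<Longrightarrow> k x = x" "\<And>y. y \<in> Q \<Longrightarrow> k y \<in> Q"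
    "\<And>x y. x \<in> P \<Longrightarrow> y \<in> Q \<Longrightarrow> x \<bullet> y = 0" "\<And>x. \<exists>y\<in>P. \<exists>z\<in>Q. x = y + z"
  shows "adjoint k u = u"
proof -
  have "adjoint k u \<bullet> x = u \<bullet> x" for x
  proof -
    obtain y z where yz: "y \<in> P" "z \<in> Q" "x = y + z" using assms(6) by blast
    have "adjoint k u \<bullet> x = u \<bullet> k x" by (metis adjoint_works[OF assms(1)] inner_commute)
    also have "\<dots> = u \<bullet> x" using yz assms by (simp add: linear_add inner_add_right)
    finally show ?thesis .
  qed
  then show ?thesis by (metis vector_eq_rdot)
qed

text \<open>The map \<open>adjoint k\<close> is the contragredient of g. As P and Q are orthogonal,
  g is block diagonal, so the contragredient is again the identity on Q. Hence an extension made for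
  one eigenspace does not disturb the other.\<close>

lemma extend_by_id:
  fixes f :: "'a::euclidean_space \<Rightarrow> 'a"
  assumes "linear f" "subspace P" "subspace Q" "f ` P = P" "inj_on f P"
    and o: "\<And>x y. x \<in> P \<Longrightarrow> y \<in> Q \<Longrightarrow> x \<bullet> y = 0" and dec: "\<And>x. \<exists>y\<in>P. \<exists>z\<in>Q. x = y + z"
  obtains g k where "linear g" "linear k" "\<And>x. k (g x) = x" "\<And>x. g (k x) = x"
    "\<And>x. x \<in> P \<Longrightarrow> g x = f x" "\<And>y. y \<in> Q \<Longrightarrow> g y = y"  "\<And>y. y \<in> Q \<Longrightarrow> adjoint k y = y"
proof -
  obtain g where g: "linear g" "\<And>x. x \<in> P \<Longrightarrow> g x = f x" "\<And>x. x \<in> Q \<Longrightarrow> g x = x"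
    using linear_glue[OF assms(1) linear_id assms(2,3) o] by auto
  have "inj g" unfolding linear_injective_0[OF g(1)]
  proof (intro allI impI)
    fix x assume x: "g x = 0"
    obtain y z where yz: "y \<in> P" "z \<in> Q" "x = y + z" using dec by blast
    have fz: "f y + z = 0" using x yz g by (simp add: linear_add)
    have "f y \<in> P" using yz assms(4) by blast
    then have "f y \<bullet> z = 0" using o yz by blast
    moreover have "f y = - z" using fz by (simp add: eq_neg_iff_add_eq_0)
    ultimately have z: "z = 0" by simp
    then have "f y = f 0" using fz linear_0[OF assms(1)] by simp
    then have "y = 0" using assms(5) yz(1) subspace_0[OF assms(2)] by (meson inj_onD)
    then show "x = 0" using yz z by simp
  qed
  then have "bij g" using linear_injective_imp_surjective[OF g(1)] by (simp add: bij_def)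
  then have k: "inv g (g x) = x" "g (inv g x) = x" for x
    by (simp_all add: bij_is_inj bij_is_surj surj_f_inv_f)
  have lk: "linear (inv g)" using linear_inverse[OF g(1)] k by blast
  have kP: "inv g x \<in> P" if x: "x \<in> P" for x
  proof -
    obtain y where "y \<in> P" "x = f y" using assms(4) x by blast
    then show ?thesis using g(2) k(1) by metis
  qed
  have "adjoint (inv g) y = y" if "y \<in> Q" for y
  proof (rule adjoint_id_on[OF lk that, of P])
    show "inv g x = x" if "x \<in> Q" for x using g(3) k(1) that by metis
    show "inv g x \<in> P" if "x \<in> P" for x using kP that .
    show "x \<bullet> y = 0" if "x \<in> Q" "y \<in> P" for x y using o that inner_commute by metis
    show "\<exists>y\<in>Q. \<exists>z\<in>P. x = y + z" for x using dec[of x] add.commute by blast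
  qed
  then show ?thesis using that[of g "inv g"] g k lk by blast
qed

text \<open>Elements of \<open>GL S\<close> are additive and homogeneous on S alone. Transport along
  the embedding e, in the application u \<mapsto> (u, u) or (u, -u), and linear extension from P
  give a linear map on the whole space.\<close>

lemma GL_extend:
  fixes e :: "'a::euclidean_space \<Rightarrow> 'n::finite pc"
  assumes "\<A> \<in> GL S" "subspace S" "linear e" "inj e" "S = e ` P" "subspace P"
  obtains f where "linear f" "f ` P = P" "inj_on f P" "\<And>u. u \<in> P \<Longrightarrow> \<A> (e u) = e (f u)"
proof -
  define f0 where "f0 u = inv e (\<A> (e u))" for u
  have A: "bij_betw \<A> S S" "\<And>x y. x \<in> S \<Longrightarrow> y \<in> S \<Longrightarrow> \<A> (x + y) = \<A> x + \<A> y"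
    "\<And>c x. x \<in> S \<Longrightarrow> \<A> (c *\<^sub>R x) = c *\<^sub>R \<A> x"
    using assms(1) unfolding GL_def by auto
  have f0: "f0 u \<in> P \<and> e (f0 u) = \<A> (e u)" if "u \<in> P" for u
  proof -
    have "\<A> (e u) \<in> e ` P" using that assms(5) A(1) bij_betwE by blast
    then show ?thesis unfolding f0_def using assms(4) by auto
  qed
  have "\<exists>f. linear f \<and> (\<forall>u\<in>P. f u = f0 u)"
  proof (rule linear_extend_subspace[OF assms(6)])
    fix u v c assume u: "u \<in> P"
    have "e (f0 (c *\<^sub>R u)) = e (c *\<^sub>R f0 u)"
      using u f0 subspace_scale[OF assms(6)] assms(5) by (simp add: linear_cmul[OF assms(3)] A(3))
    then show "f0 (c *\<^sub>R u) = c *\<^sub>R f0 u" using assms(4) by (simp add: inj_eq)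
    assume v: "v \<in> P"
    have "e (f0 (u + v)) = e (f0 u + f0 v)"
      using u v f0 subspace_add[OF assms(6)] assms(5) by (simp add: linear_add[OF assms(3)] A(2))
    then show "f0 (u + v) = f0 u + f0 v" using assms(4) by (simp add: inj_eq)
  qed
  then obtain f where f: "linear f" "\<And>u. u \<in> P \<Longrightarrow> f u = f0 u" by blast
  have "inj_on f P"
  proof (rule inj_onI)
    fix u v assume uv: "u \<in> P" "v \<in> P" "f u = f v"
    then have "\<A> (e u) = \<A> (e v)" using f f0 by metis
    then have "e u = e v" using A(1) uv assms(5) by (metis bij_betw_inv_into_left imageI)
    then show "u = v" using assms(4) by (simp add: inj_eq)
  qed
  moreover have "f ` P = P"
  proof (intro equalityI subsetI)
    fix v assume v: "v \<in> P"
    then have "e v \<in> \<A> ` S" using A(1) assms(5) unfolding bij_betw_def by blast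
    then obtain u where u: "u \<in> P" "e v = \<A> (e u)" using assms(5) by blast
    then have "e v = e (f u)" using f f0 by metis
    then show "v \<in> f ` P" using assms(4) u by (auto simp: inj_eq)
  qed (use f f0 in auto)
  ultimately show ?thesis using that[of f] f f0 by metis
qed

lemma stabilizerD:
  assumes "A \<in> stabilizer L"
  shows "A \<in> AutV" "A ` L = L" "A ` eig_plus L = eig_plus L" "A ` eig_minus L = eig_minus L"
proof -
  show A: "A \<in> AutV" "A ` L = L" using assms unfolding stabilizer_def by blast+
  show "A ` eig_plus L = eig_plus L" "A ` eig_minus L = eig_minus L"
    using eig_image[OF A(1), of L] unfolding A(2) by blast+
qed

lemma stabilizer_restrict_GL:
  assumes "A \<in> stabilizer L" "subspace L"
  shows "restrict A (eig_plus L) \<in> GL (eig_plus L)" "restrict A (eig_minus L) \<in> GL (eig_minus L)"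
proof -
  have l: "linear A" "inj A" using AutVD[OF stabilizerD(1)[OF assms(1)]] bij_is_inj by auto
  have "restrict A S \<in> GL S" if S: "subspace S" "A ` S = S" for S
    unfolding GL_def
    using S subspace_add[OF S(1)] subspace_scale[OF S(1)] l inj_on_subset
    by (auto simp: bij_betw_def linear_add linear_cmul inj_on_def inj_def)
  then show "restrict A (eig_plus L) \<in> GL (eig_plus L)" "restrict A (eig_minus L) \<in> GL (eig_minus L)"
    using stabilizerD(3,4)[OF assms(1)] subspace_eig[OF assms(2)] by auto
qed

text \<open>The extension acts on \<open>\<real>\<^sup>n = P \<oplus> Q\<close> as \<open>\<A> \<oplus> (\<B>\<^sup>T)\<^sup>-\<^sup>1\<close>, so that the contragredient map is
  \<open>(\<A>\<^sup>T)\<^sup>-\<^sup>1 \<oplus> \<B>\<close>.\<close>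

lemma GL_pair_extends_to_stabilizer:
  fixes L :: "'n::finite pc set"
  assumes "isotropic L" "has_type L p q" "p + q = CARD('n)"
    and "\<A> \<in> GL (eig_plus L)" "\<B> \<in> GL (eig_minus L)"
  obtains C where "C \<in> stabilizer L" "\<And>x. x \<in> eig_plus L \<Longrightarrow> C x = \<A> x" "\<And>x. x \<in> eig_minus L \<Longrightarrow> C x = \<B> x"
proof -
  let ?P = "half_plus L" and ?Q = "half_minus L"
  have t: "tau_invariant L" and sL: "subspace L" using assms(2) unfolding has_type_def tau_invariant_def by auto
  note s = subspace_half[OF sL] and sE = subspace_eig[OF sL]
  have o: "\<And>x y. x \<in> ?P \<Longrightarrow> y \<in> ?Q \<Longrightarrow> x \<bullet> y = 0" using half_orthogonal[OF assms(1)] .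
  have dec: "\<And>x. \<exists>y\<in>?P. \<exists>z\<in>?Q. x = y + z" using half_decomp[OF assms(1-3)] .
  have o': "\<And>y x. y \<in> ?Q \<Longrightarrow> x \<in> ?P \<Longrightarrow> y \<bullet> x = 0" using o inner_commute by metis
  have dec': "\<And>x. \<exists>y\<in>?Q. \<exists>z\<in>?P. x = y + z" using dec add.commute by metis
  have e: "linear (\<lambda>u :: (real, 'n) vec. (u, u))" "linear (\<lambda>u :: (real, 'n) vec. (u, - u))"
    "inj (\<lambda>u :: (real, 'n) vec. (u, u))" "inj (\<lambda>u :: (real, 'n) vec. (u, - u))"
    by (auto simp: linear_iff inj_def)
  obtain f where f: "linear f" "f ` ?P = ?P" "inj_on f ?P" "\<And>u. u \<in> ?P \<Longrightarrow> \<A> (u, u) = (f u, f u)"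
    using GL_extend[OF assms(4) sE(1) e(1,3) eig_eq_half(1) s(1)] by blast
  obtain h where h: "linear h" "h ` ?Q = ?Q" "inj_on h ?Q" "\<And>v. v \<in> ?Q \<Longrightarrow> \<B> (v, - v) = (h v, - h v)"
    using GL_extend[OF assms(5) sE(2) e(2,4) eig_eq_half(2) s(2)] by blast
  obtain g k where g: "linear g" "linear k" "\<And>x. k (g x) = x" "\<And>x. g (k x) = x"
    "\<And>x. x \<in> ?P \<Longrightarrow> g x = f x" "\<And>y. y \<in> ?Q \<Longrightarrow> g y = y"  "\<And>y. y \<in> ?Q \<Longrightarrow> adjoint k y = y"
    using extend_by_id[OF f(1) s f(2,3) o dec] by blast
  obtain g' k' where g': "linear g'" "linear k'" "\<And>x. k' (g' x) = x" "\<And>x. g' (k' x) = x"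
    "\<And>x. x \<in> ?Q \<Longrightarrow> g' x = h x" "\<And>y. y \<in> ?P \<Longrightarrow> g' y = y"  "\<And>y. y \<in> ?P \<Longrightarrow> adjoint k' y = y"
    using extend_by_id[OF h(1) s(2,1) h(2,3) o' dec'] by blast
  \<comment> \<open>With ^T for the adjoint, a = g (k')^T and b = k^T g', so a^T b = k' (k g)^T g' =
    k' g' = 1. On P the factor (k')^T is the identity and on Q the factor k^T is, so a restricts to
    f on P and b to h on Q.\<close>
  define a where "a = g \<circ> adjoint k'"
  define b where "b = adjoint k \<circ> g'"
  have lab: "linear a" "linear b" unfolding a_def b_def
    by (auto intro: linear_compose adjoint_linear g g')
  have ab: "a u \<bullet> b v = u \<bullet> v" for u v
    unfolding a_def b_def
    by (simp add: adjoint_works[OF g(2)] g(3) inner_commute[of "adjoint k' u"])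
      (simp add: adjoint_works[OF g'(2)] g'(3) inner_commute)
  define C where "C = pair_map a b"
  note C = pair_map_AutV[OF lab ab, folded C_def]
  have CA: "C x = \<A> x" if x: "x \<in> eig_plus L" for x
  proof -
    obtain u where u: "u \<in> ?P" "x = (u, u)" using x unfolding eig_eq_half by blast
    then show ?thesis using C(2)[of u] f(4) g(5) g'(7) by (simp add: a_def)
  qed
  have CB: "C x = \<B> x" if x: "x \<in> eig_minus L" for x
  proof -
    obtain v where v: "v \<in> ?Q" "x = (v, - v)" using x unfolding eig_eq_half by blast
    have "h v \<in> ?Q" using v h(2) by blast
    then show ?thesis using v C(3)[of v] h(4) g'(5) g(7) by (simp add: b_def)
  qed
  have "C ` eig_plus L = eig_plus L" "C ` eig_minus L = eig_minus L"
    using CA CB assms(4,5) unfolding GL_def bij_betw_def by auto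
  then have im: "eig_plus (C ` L) = eig_plus L" "eig_minus (C ` L) = eig_minus L"
    by (simp_all add: eig_image[OF C(1)])
  have "tau_invariant (C ` L)" using has_type_image[OF C(1) assms(2)] unfolding has_type_def by blast
  then have "C ` L = L" using tau_invariant_eq_sum[of "C ` L"] tau_invariant_eq_sum[OF t] im by simp
  then show ?thesis using that[of C] C(1) CA CB unfolding stabilizer_def by blast
qed

section \<open>Smooth maps\<close>

lemma frechet_derivative_eqI: "(f has_derivative D) (at x) \<Longrightarrow> frechet_derivative f (at x) = D"
  using frechet_derivative_at by fastforce

lemma differentiable_cong_open:
  assumes "open S" "x \<in> S" "\<And>y. y \<in> S \<Longrightarrow> f y = g y" "f differentiable (at x)"
  shows "g differentiable (at x)" "frechet_derivative g (at x) = frechet_derivative f (at x)"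
proof -
  have f: "(f has_derivative frechet_derivative f (at x)) (at x)"
    using assms frechet_derivative_works by blast
  have g: "(g has_derivative frechet_derivative f (at x)) (at x)"
    by (rule has_derivative_transform_within_open[OF f assms(1,2)]) (use assms in auto)
  then show "g differentiable (at x)" by (rule differentiableI)
  show "frechet_derivative g (at x) = frechet_derivative f (at x)"
    using g by (rule frechet_derivative_eqI)
qed

lemma Ck_on_cong:
  assumes "open S" "\<And>x. x \<in> S \<Longrightarrow> f x = g x" "Ck_on k f S"
  shows "Ck_on k g S"
  using assms(2,3)
proof (induction k arbitrary: f g)
  case 0
  then show ?case by (metis Ck_on.simps(1) continuous_on_cong)
next
  case (Suc k)
  have d: "g differentiable (at x)" "frechet_derivative g (at x) = frechet_derivative f (at x)"
    if "x \<in> S" for x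
    using differentiable_cong_open[OF assms(1) that, of f g] Suc.prems that by auto
  have "Ck_on k (\<lambda>x. frechet_derivative g (at x) v) S" for v
    by (rule Suc.IH[of "\<lambda>x. frechet_derivative f (at x) v"]) (use Suc.prems d in auto)
  then show ?case using d by simp
qed

lemma Ck_on_subset: "Ck_on k f S \<Longrightarrow> T \<subseteq> S \<Longrightarrow> Ck_on k f T"
  by (induction k arbitrary: f) (auto intro: continuous_on_subset)

lemma Ck_on_local:
  assumes "\<And>x. x \<in> S \<Longrightarrow> \<exists>T. open T \<and> x \<in> T \<and> Ck_on k f T"
  shows "Ck_on k f S"
  using assms
proof (induction k arbitrary: f)
  case 0
  then show ?case
    by (metis Ck_on.simps(1) continuous_at_imp_continuous_on continuous_on_eq_continuous_at)
next
  case (Suc k)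
  then show ?case by (simp) metis
qed

lemma Ck_on_SucD: "Ck_on (Suc k) f S \<Longrightarrow> Ck_on k f S"
proof (induction k arbitrary: f)
  case 0
  then show ?case
    by (auto intro!: continuous_at_imp_continuous_on differentiable_imp_continuous_within)
qed auto

lemma Ck_on_has_derivative:
  "Ck_on (Suc k) f S \<Longrightarrow> x \<in> S \<Longrightarrow> (f has_derivative frechet_derivative f (at x)) (at x)"
  using frechet_derivative_works by auto

text \<open>Lets an explicit formula for the derivative on the open set stand in for
  \<open>frechet_derivative\<close>; most closure rules below are inductions through it.\<close>

lemma Ck_on_SucI:
  assumes "open S" "\<And>x. x \<in> S \<Longrightarrow> (f has_derivative D x) (at x)" "\<And>v. Ck_on k (\<lambda>x. D x v) S"
  shows "Ck_on (Suc k) f S"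
proof -
  have "Ck_on k (\<lambda>x. frechet_derivative f (at x) v) S" for v
    by (rule Ck_on_cong[OF assms(1) _ assms(3)[of v]]) (use assms(2) frechet_derivative_eqI in metis)
  then show ?thesis using assms(2) by (auto intro: differentiableI)
qed

lemma Ck_on_const: "open S \<Longrightarrow> Ck_on k (\<lambda>x. c) S"
  by (induction k arbitrary: c) (auto intro!: Ck_on_SucI[where D = "\<lambda>_ _. 0"] simp del: Ck_on.simps(2))

lemma Ck_on_bounded_linear: "open S \<Longrightarrow> bounded_linear f \<Longrightarrow> Ck_on k f S"
proof (cases k)
  case 0
  assume "bounded_linear f" then show ?thesis
    using 0 by (simp add: linear_continuous_on)
next
  case (Suc j)
  assume "open S" "bounded_linear f" then show ?thesis unfolding Suc
    by (intro Ck_on_SucI[where D = "\<lambda>_. f"] bounded_linear_imp_has_derivative Ck_on_const)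
qed

lemma Ck_on_bounded_linear_compose:
  assumes "open S" "bounded_linear h" "Ck_on k f S"
  shows "Ck_on k (\<lambda>x. h (f x)) S"
  using assms(3)
proof (induction k arbitrary: f)
  case 0
  then show ?case using assms by (simp add: bounded_linear.continuous_on)
next
  case (Suc k)
  show ?case
    by (rule Ck_on_SucI[where D = "\<lambda>x v. h (frechet_derivative f (at x) v)", OF assms(1)])
      (use Suc in \<open>auto intro!: bounded_linear.has_derivative[OF assms(2)] simp: frechet_derivative_works[symmetric]\<close>)
qed

lemma Ck_on_add:
  assumes "open S" "Ck_on k f S" "Ck_on k g S"
  shows "Ck_on k (\<lambda>x. f x + g x) S"
  using assms(2,3)
proof (induction k arbitrary: f g)
  case 0
  then show ?case by (auto intro: continuous_intros)
next
  case (Suc k)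
  show ?case
    by (rule Ck_on_SucI[where D = "\<lambda>x v. frechet_derivative f (at x) v + frechet_derivative g (at x) v", OF assms(1)])
     (use Suc in \<open>auto intro!: has_derivative_add Ck_on_has_derivative simp del: Ck_on.simps(2)\<close>, simp_all)
qed

lemma Ck_on_sum:
  assumes "open S" "\<And>i. i \<in> I \<Longrightarrow> Ck_on k (f i) S"
  shows "Ck_on k (\<lambda>x. \<Sum>i\<in>I. f i x) S"
  using assms(2)
  by (induction I rule: infinite_finite_induct) (auto intro!: Ck_on_add Ck_on_const assms(1))

lemma Ck_on_scaleR:
  assumes "open S" "Ck_on k f S" "Ck_on k g S"
  shows "Ck_on k (\<lambda>x. f x *\<^sub>R g x) S"
  using assms(2,3)
proof (induction k arbitrary: f g)
  case 0
  then show ?case by (auto intro: continuous_intros)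
next
  case (Suc k)
  show ?case
  proof (rule Ck_on_SucI[where D = "\<lambda>x v. f x *\<^sub>R frechet_derivative g (at x) v + frechet_derivative f (at x) v *\<^sub>R g x", OF assms(1)])
    show "Ck_on k (\<lambda>x. f x *\<^sub>R frechet_derivative g (at x) v + frechet_derivative f (at x) v *\<^sub>R g x) S" for v
      using Suc.prems Ck_on_SucD[OF Suc.prems(1)] Ck_on_SucD[OF Suc.prems(2)]
      by (intro Ck_on_add assms Suc.IH) auto
    show "((\<lambda>a. f a *\<^sub>R g a) has_derivative (\<lambda>v. f x *\<^sub>R frechet_derivative g (at x) v + frechet_derivative f (at x) v *\<^sub>R g x)) (at x)"
      if "x \<in> S" for x
      by (rule has_derivative_scaleR[OF Suc.prems[THEN Ck_on_has_derivative, OF that]])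
  qed
qed

lemma Ck_on_compose:
  fixes f :: "'a::real_normed_vector \<Rightarrow> 'b::euclidean_space"
  assumes "open S" "open T" "f ` S \<subseteq> T" "Ck_on k f S" "Ck_on k g T"
  shows "Ck_on k (\<lambda>x. g (f x)) S"
  using assms(4,5)
proof (induction k arbitrary: g)
  case 0
  then show ?case using assms by (auto intro: continuous_on_compose2)
next
  case (Suc k)
  \<comment> \<open>\<open>Ck_on\<close> speaks of derivatives in fixed directions, whereas the
    chain rule applies the derivative of g in a direction that depends on x. Expanding that
    direction in a basis leaves a sum of products of functions already known to be of class
    k.\<close>
  let ?D = "\<lambda>x v. \<Sum>b\<in>Basis. (frechet_derivative f (at x) v \<bullet> b) *\<^sub>R frechet_derivative g (at (f x)) b"
  show ?case
  proof (rule Ck_on_SucI[where D = ?D, OF assms(1)])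
    fix x assume x: "x \<in> S"
    have f: "(f has_derivative frechet_derivative f (at x)) (at x)"
      using Ck_on_has_derivative Suc.prems(1) x by blast
    have g: "(g has_derivative frechet_derivative g (at (f x))) (at (f x))"
      using Ck_on_has_derivative Suc.prems(2) x assms(3) by blast
    have "linear (frechet_derivative g (at (f x)))"
      using g has_derivative_linear by blast
    then have "frechet_derivative g (at (f x)) w = (\<Sum>b\<in>Basis. (w \<bullet> b) *\<^sub>R frechet_derivative g (at (f x)) b)" for w
      by (subst euclidean_representation[of w, symmetric]) (simp add: linear_sum linear_cmul)
    then show "((\<lambda>x. g (f x)) has_derivative ?D x) (at x)"
      using has_derivative_compose[OF f g] by (metis (no_types, lifting) ext)
  next
    fix v
    have "Ck_on k (\<lambda>x. frechet_derivative f (at x) v \<bullet> b) S" for b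
      using Suc.prems(1) by (intro Ck_on_bounded_linear_compose[OF assms(1) bounded_linear_inner_left]) simp
    moreover have "Ck_on k (\<lambda>x. frechet_derivative g (at (f x)) b) S" for b
      using Suc.prems(2) by (intro Suc.IH Ck_on_SucD[OF Suc.prems(1)]) simp
    ultimately show "Ck_on k (\<lambda>x. ?D x v) S"
      by (intro Ck_on_sum Ck_on_scaleR assms)
  qed
qed

lemma smooth_on_linear:
  fixes f :: "'a::euclidean_space \<Rightarrow> 'b::real_normed_vector"
  shows "linear f \<Longrightarrow> open S \<Longrightarrow> smooth_on f S"
  by (simp add: smooth_on_def Ck_on_bounded_linear linear_conv_bounded_linear)

lemma smooth_on_has_derivative:
  "smooth_on f S \<Longrightarrow> x \<in> S \<Longrightarrow> (f has_derivative frechet_derivative f (at x)) (at x)"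
  unfolding smooth_on_def by (blast intro: Ck_on_has_derivative)

lemma smooth_on_imp_continuous_on: "smooth_on f S \<Longrightarrow> continuous_on S f"
  unfolding smooth_on_def by (metis Ck_on.simps(1))

lemma smooth_on_cong:
  "open S \<Longrightarrow> (\<And>x. x \<in> S \<Longrightarrow> f x = g x) \<Longrightarrow> smooth_on f S \<Longrightarrow> smooth_on g S"
  unfolding smooth_on_def using Ck_on_cong by blast

section \<open>Isomorphism is an equivalence relation\<close>

lemma linear_right_inverse_is_left_inverse:
  fixes f g :: "'a::euclidean_space \<Rightarrow> 'a"
  assumes "linear f" "linear g" "\<And>u. f (g u) = u"
  shows "g (f u) = u"
proof -
  have "f \<circ> g = id" using assms(3) by auto
  then have "g \<circ> f = id" using linear_inverse_left[OF assms(1,2)] by simp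
  then show ?thesis by (metis comp_apply id_apply)
qed

lemma local_rep_eq:
  "inj_on (snd c) (fst c) \<Longrightarrow> p \<in> fst c \<Longrightarrow> local_rep F c d (snd c p) = snd d (F p)"
  by (simp add: local_rep_def)

lemma smooth_manifold_chart:
  assumes "smooth_manifold M" "c \<in> atlas M"
  shows "inj_on (snd c) (fst c)" "fst c \<subseteq> points M" "open (snd c ` fst c)"
  using assms unfolding smooth_manifold_def by force+

lemma smooth_manifold_cover:
  "smooth_manifold M \<Longrightarrow> p \<in> points M \<Longrightarrow> \<exists>c\<in>atlas M. p \<in> fst c"
  unfolding smooth_manifold_def by force

lemma smooth_mapD:
  assumes "smooth_map F M N"
  shows "p \<in> points M \<Longrightarrow> F p \<in> points N"
    and "c \<in> atlas M \<Longrightarrow> d \<in> atlas N \<Longrightarrow> open (local_dom F c d)"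
    and "c \<in> atlas M \<Longrightarrow> d \<in> atlas N \<Longrightarrow> smooth_on (local_rep F c d) (local_dom F c d)"
  using assms unfolding smooth_map_def by auto

text \<open>A chart of the middle manifold need not contain the whole image under F, so e is chosen
  at x, and W is the part of the domain where the composite runs through e.\<close>

lemma local_compose:
  assumes M: "smooth_manifold M" and N: "smooth_manifold N"
    and F: "smooth_map F M N" and G: "smooth_map G N K"
    and c: "c \<in> atlas M" and d: "d \<in> atlas K" and x: "x \<in> local_dom (G \<circ> F) c d"
  obtains e W where "e \<in> atlas N" "open W" "x \<in> W" "W \<subseteq> local_dom (G \<circ> F) c d"
    "W \<subseteq> local_dom F c e" "local_rep F c e ` W \<subseteq> local_dom G e d"
    "\<And>y. y \<in> W \<Longrightarrow> local_rep (G \<circ> F) c d y = local_rep G e d (local_rep F c e y)"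
proof -
  obtain p where p: "p \<in> fst c" "G (F p) \<in> fst d" "x = snd c p"
    using x unfolding local_dom_def by auto
  have "F p \<in> points N" using smooth_mapD(1)[OF F] smooth_manifold_chart[OF M c] p by auto
  then obtain e where e: "e \<in> atlas N" "F p \<in> fst e" using smooth_manifold_cover[OF N] by blast
  note ic = smooth_manifold_chart(1)[OF M c] and ie = smooth_manifold_chart(1)[OF N e(1)]
  define W where "W = local_dom F c e \<inter> local_rep F c e -` local_dom G e d"
  have W: "\<exists>q. q \<in> fst c \<and> F q \<in> fst e \<and> G (F q) \<in> fst d \<and> y = snd c q" if y: "y \<in> W" for y
  proof -
    obtain q where q: "q \<in> fst c" "F q \<in> fst e" "y = snd c q"
      using y unfolding W_def local_dom_def by auto
    then have "snd e (F q) \<in> local_dom G e d"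
      using y local_rep_eq[OF ic q(1), of F e] unfolding W_def by simp
    then show ?thesis using q ie unfolding local_dom_def inj_on_def by auto
  qed
  have "open W" unfolding W_def
    using smooth_mapD(2)[OF F c e(1)] smooth_mapD(2)[OF G e(1) d]
      smooth_on_imp_continuous_on[OF smooth_mapD(3)[OF F c e(1)]] continuous_open_preimage by blast
  moreover have "x \<in> W" unfolding W_def local_dom_def using p e local_rep_eq[OF ic p(1), of F e] by auto
  moreover have "W \<subseteq> local_dom (G \<circ> F) c d" using W unfolding local_dom_def by fastforce
  moreover have "local_rep (G \<circ> F) c d y = local_rep G e d (local_rep F c e y)" if "y \<in> W" for y
    using W[OF that] local_rep_eq[OF ic] local_rep_eq[OF ie] by (metis comp_apply)
  ultimately show ?thesis using that[OF e(1), of W] unfolding W_def by blast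
qed

lemma smooth_map_compose:
  assumes M: "smooth_manifold M" and N: "smooth_manifold N"
    and F: "smooth_map F M N" and G: "smooth_map G N K"
  shows "smooth_map (G \<circ> F) M K"
  unfolding smooth_map_def
proof (intro conjI ballI)
  show "(G \<circ> F) ` points M \<subseteq> points K" using smooth_mapD(1)[OF F] smooth_mapD(1)[OF G] by auto
  fix c d assume c: "c \<in> atlas M" and d: "d \<in> atlas K"
  note loc = local_compose[OF M N F G c d]
  show "open (local_dom (G \<circ> F) c d)"
    by (subst open_subopen) (meson loc)
  show "smooth_on (local_rep (G \<circ> F) c d) (local_dom (G \<circ> F) c d)"
    unfolding smooth_on_def
  proof (intro allI Ck_on_local)
    fix k x assume "x \<in> local_dom (G \<circ> F) c d"
    then obtain e W where e: "e \<in> atlas N" and W: "open W" "x \<in> W" "W \<subseteq> local_dom (G \<circ> F) c d"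
    "W \<subseteq> local_dom F c e" "local_rep F c e ` W \<subseteq> local_dom G e d"
    "\<And>y. y \<in> W \<Longrightarrow> local_rep (G \<circ> F) c d y = local_rep G e d (local_rep F c e y)"
      using loc by blast
    have "Ck_on k (\<lambda>y. local_rep G e d (local_rep F c e y)) W"
    proof (rule Ck_on_compose[OF W(1) smooth_mapD(2)[OF G e d] W(5)])
      show "Ck_on k (local_rep F c e) W"
        using smooth_mapD(3)[OF F c e] W(4) Ck_on_subset unfolding smooth_on_def by blast
      show "Ck_on k (local_rep G e d) (local_dom G e d)"
        using smooth_mapD(3)[OF G e d] unfolding smooth_on_def by blast
    qed
    then have "Ck_on k (local_rep (G \<circ> F) c d) W"
      by (rule Ck_on_cong[OF W(1), rotated]) (use W(6) in simp)
    then show "\<exists>T. open T \<and> x \<in> T \<and> Ck_on k (local_rep (G \<circ> F) c d) T" using W by blast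
  qed
qed

text \<open>Stated for any h that agrees with the composite on W: besides the composite itself, h is
  later the identity, which shows that the derivatives of an isomorphism and of its inverse
  cancel.\<close>

lemma frechet_derivative_local_compose:
  assumes F: "smooth_map F M N" and G: "smooth_map G N K"
    and c: "c \<in> atlas M" and d: "d \<in> atlas K" and e: "e \<in> atlas N"
    and W: "open W" "x \<in> W" "W \<subseteq> local_dom F c e" "local_rep F c e ` W \<subseteq> local_dom G e d"
    and eq: "\<And>y. y \<in> W \<Longrightarrow> h y = local_rep G e d (local_rep F c e y)"
  shows "frechet_derivative h (at x) =
    (\<lambda>u. frechet_derivative (local_rep G e d) (at (local_rep F c e x)) (frechet_derivative (local_rep F c e) (at x) u))"
proof (rule frechet_derivative_eqI)
  have f: "(local_rep F c e has_derivative frechet_derivative (local_rep F c e) (at x)) (at x)"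
    using smooth_on_has_derivative[OF smooth_mapD(3)[OF F c e]] W by blast
  have g: "(local_rep G e d has_derivative frechet_derivative (local_rep G e d) (at (local_rep F c e x))) (at (local_rep F c e x))"
    using smooth_on_has_derivative[OF smooth_mapD(3)[OF G e d]] W by blast
  show "(h has_derivative (\<lambda>u. frechet_derivative (local_rep G e d) (at (local_rep F c e x)) (frechet_derivative (local_rep F c e) (at x) u))) (at x)"
    by (rule has_derivative_transform_within_open[OF has_derivative_compose[OF f g] W(1,2)]) (simp add: eq)
qed

lemma preserves_metric_compose:
  assumes M: "smooth_manifold M" and N: "smooth_manifold N"
    and F: "smooth_map F M N" and G: "smooth_map G N K"
    and pF: "preserves_metric F M N" and pG: "preserves_metric G N K"
  shows "preserves_metric (G \<circ> F) M K"
  unfolding preserves_metric_def Let_def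
proof (intro ballI allI)
  fix c d x u v assume c: "c \<in> atlas M" and d: "d \<in> atlas K" and x: "x \<in> local_dom (G \<circ> F) c d"
  obtain e W where e: "e \<in> atlas N" and W: "open W" "x \<in> W" "W \<subseteq> local_dom (G \<circ> F) c d"
    "W \<subseteq> local_dom F c e" "local_rep F c e ` W \<subseteq> local_dom G e d"
    "\<And>y. y \<in> W \<Longrightarrow> local_rep (G \<circ> F) c d y = local_rep G e d (local_rep F c e y)"
    using local_compose[OF M N F G c d x] by blast
  have D: "frechet_derivative (local_rep (G \<circ> F) c d) (at x) u = frechet_derivative (local_rep G e d) (at (local_rep F c e x)) (frechet_derivative (local_rep F c e) (at x) u)" for u
    by (rule fun_cong[OF frechet_derivative_local_compose[OF F G c d e W(1,2,4,5,6)]])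
  show "metric K d (local_rep (G \<circ> F) c d x) (frechet_derivative (local_rep (G \<circ> F) c d) (at x) u)
        (frechet_derivative (local_rep (G \<circ> F) c d) (at x) v) = metric M c x u v"
    unfolding D W(6)[OF W(2)]
    using pF[unfolded preserves_metric_def Let_def, rule_format, OF c e subsetD[OF W(4,2)]]
      pG[unfolded preserves_metric_def Let_def, rule_format, OF e d subsetD[OF W(5) imageI[OF W(2)]]] by simp
qed

lemma intertwines_tau_compose:
  assumes M: "smooth_manifold M" and N: "smooth_manifold N"
    and F: "smooth_map F M N" and G: "smooth_map G N K"
    and pF: "intertwines_tau F M N" and pG: "intertwines_tau G N K"
  shows "intertwines_tau (G \<circ> F) M K"
  unfolding intertwines_tau_def Let_def
proof (intro ballI allI)
  fix c d x u assume c: "c \<in> atlas M" and d: "d \<in> atlas K" and x: "x \<in> local_dom (G \<circ> F) c d"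
  obtain e W where e: "e \<in> atlas N" and W: "open W" "x \<in> W" "W \<subseteq> local_dom (G \<circ> F) c d"
    "W \<subseteq> local_dom F c e" "local_rep F c e ` W \<subseteq> local_dom G e d"
    "\<And>y. y \<in> W \<Longrightarrow> local_rep (G \<circ> F) c d y = local_rep G e d (local_rep F c e y)"
    using local_compose[OF M N F G c d x] by blast
  have D: "frechet_derivative (local_rep (G \<circ> F) c d) (at x) u = frechet_derivative (local_rep G e d) (at (local_rep F c e x)) (frechet_derivative (local_rep F c e) (at x) u)" for u
    by (rule fun_cong[OF frechet_derivative_local_compose[OF F G c d e W(1,2,4,5,6)]])
  show "frechet_derivative (local_rep (G \<circ> F) c d) (at x) (tau M c x u) =
     tau K d (local_rep (G \<circ> F) c d x) (frechet_derivative (local_rep (G \<circ> F) c d) (at x) u)"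
    unfolding D W(6)[OF W(2)]
    using pF[unfolded intertwines_tau_def Let_def, rule_format, OF c e subsetD[OF W(4,2)]]
      pG[unfolded intertwines_tau_def Let_def, rule_format, OF e d subsetD[OF W(5) imageI[OF W(2)]]] by simp
qed

text \<open>Inverses formed by \<open>inv_into\<close> match the expected maps only on the set of
  points and are arbitrary elsewhere; smoothness sees only points lying in charts.\<close>

lemma smooth_map_cong:
  assumes M: "smooth_manifold M" and FG: "\<And>p. p \<in> points M \<Longrightarrow> F p = G p" and F: "smooth_map F M N"
  shows "smooth_map G M N"
proof -
  have dom: "local_dom G c d = local_dom F c d" if "c \<in> atlas M" for c :: "('a, 'b) chart" and d :: "('c, 'b) chart"
    using smooth_manifold_chart(2)[OF M that] FG unfolding local_dom_def by (auto simp: subset_iff)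
  have rep: "local_rep F c d x = local_rep G c d x" if c: "c \<in> atlas M" and x: "x \<in> local_dom F c d" for c x and d :: "('c, 'b) chart"
  proof -
    obtain p where p: "p \<in> fst c" "x = snd c p" using x unfolding local_dom_def by auto
    then have "F p = G p" using smooth_manifold_chart(2)[OF M c] FG by blast
    then show ?thesis
      using local_rep_eq[OF smooth_manifold_chart(1)[OF M c] p(1)] p by metis
  qed
  show ?thesis unfolding smooth_map_def
  proof (intro conjI ballI)
    show "G ` points M \<subseteq> points N" using FG smooth_mapD(1)[OF F] by auto
    fix c d assume "c \<in> atlas M" "d \<in> atlas N"
    then show "open (local_dom G c d)" "smooth_on (local_rep G c d) (local_dom G c d)"
      using smooth_mapD[OF F] rep smooth_on_cong by (metis dom)+
  qed
qed

lemma isomorphic_trans: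
  assumes M: "smooth_manifold M" and N: "smooth_manifold N" and K: "smooth_manifold K"
    and "isomorphic M N" "isomorphic N K"
  shows "isomorphic M K"
proof -
  obtain F G where F: "isomorphism F M N" and G: "isomorphism G N K"
    using assms unfolding isomorphic_def by blast
  let ?Fi = "inv_into (points M) F" and ?Gi = "inv_into (points N) G" and ?Hi = "inv_into (points M) (G \<circ> F)"
  have b: "bij_betw F (points M) (points N)" "bij_betw G (points N) (points K)"
    using F G unfolding isomorphism_def by auto
  have bGF: "bij_betw (G \<circ> F) (points M) (points K)" using b by (rule bij_betw_trans)
  have "(?Fi \<circ> ?Gi) p = ?Hi p" if "p \<in> points K" for p
  proof -
    have "(?Fi \<circ> ?Gi) p \<in> points M" "(G \<circ> F) ((?Fi \<circ> ?Gi) p) = p"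
      using b that by (auto simp: bij_betw_inv_into_right bij_betw_apply[OF bij_betw_inv_into])
    then show ?thesis using bGF by (metis bij_betw_inv_into_left)
  qed
  moreover have "smooth_map (?Fi \<circ> ?Gi) K M"
    using F G unfolding isomorphism_def by (intro smooth_map_compose[OF K N]) auto
  ultimately have "smooth_map ?Hi K M" using smooth_map_cong[OF K] by blast
  then have "isomorphism (G \<circ> F) M K"
    using F G bGF unfolding isomorphism_def
    using smooth_map_compose[OF M N] preserves_metric_compose[OF M N] intertwines_tau_compose[OF M N] by blast
  then show ?thesis unfolding isomorphic_def by blast
qed

text \<open>The metric and \<tau> conditions for F are evaluated on vectors in the image of the
  derivative of the inverse G. They turn into the conditions for G because the two derivatives are
  inverse to each other: one order comes from the chain rule, the other from finite
  dimension.\<close>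

lemma isomorphic_sym:
  assumes M: "smooth_manifold M" and N: "smooth_manifold N" and "isomorphic M N"
  shows "isomorphic N M"
proof -
  obtain F where F: "isomorphism F M N" using assms unfolding isomorphic_def by blast
  define G where "G = inv_into (points M) F"
  have b: "bij_betw F (points M) (points N)" and sF: "smooth_map F M N" and sG: "smooth_map G N M"
    and pF: "preserves_metric F M N" and tF: "intertwines_tau F M N"
    using F unfolding isomorphism_def G_def by auto
  have FG: "F (G q) = q" if "q \<in> points N" for q
    using that b unfolding G_def by (simp add: bij_betw_inv_into_right)
  have bG: "bij_betw G (points N) (points M)" unfolding G_def using b by (rule bij_betw_inv_into)
  have "smooth_map (inv_into (points N) G) M N"
  proof (rule smooth_map_cong[OF M _ sF])
    fix p assume "p \<in> points M"
    then show "F p = inv_into (points N) G p"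
      unfolding G_def using b by (simp add: inv_into_inv_into_eq)
  qed
  moreover
  have loc: "local_rep G c d y \<in> local_dom F d c \<and> local_rep F d c (local_rep G c d y) = y \<and>
    (\<forall>u. frechet_derivative (local_rep F d c) (at (local_rep G c d y)) (frechet_derivative (local_rep G c d) (at y) u) = u) \<and>
    (\<forall>u. frechet_derivative (local_rep G c d) (at y) (frechet_derivative (local_rep F d c) (at (local_rep G c d y)) u) = u)"
    if c: "c \<in> atlas N" and d: "d \<in> atlas M" and y: "y \<in> local_dom G c d" for c d y
  proof -
    note ic = smooth_manifold_chart[OF N c] and id = smooth_manifold_chart[OF M d]
    have 1: "local_rep G c d z \<in> local_dom F d c \<and> local_rep F d c (local_rep G c d z) = z"
      if z: "z \<in> local_dom G c d" for z
    proof -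
      obtain q where q: "q \<in> fst c" "G q \<in> fst d" "z = snd c q"
        using z unfolding local_dom_def by auto
      then have "local_rep G c d z = snd d (G q)" "F (G q) = q"
        using local_rep_eq[OF ic(1) q(1), of G d] FG[of q] ic(2) by auto
      then show ?thesis using local_rep_eq[OF id(1) q(2), of F c] q unfolding local_dom_def by auto
    qed
    have "frechet_derivative (\<lambda>z. z) (at y) = (\<lambda>u. frechet_derivative (local_rep F d c) (at (local_rep G c d y)) (frechet_derivative (local_rep G c d) (at y) u))"
    proof (rule frechet_derivative_local_compose[OF sG sF c c d smooth_mapD(2)[OF sG c d] y])
      show "local_rep G c d ` local_dom G c d \<subseteq> local_dom F d c" using 1 by blast
      show "z = local_rep F d c (local_rep G c d z)" if "z \<in> local_dom G c d" for z
        using 1[OF that] by simp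
    qed simp
    then have 2: "frechet_derivative (local_rep F d c) (at (local_rep G c d y)) (frechet_derivative (local_rep G c d) (at y) u) = u" for u
      by (metis frechet_derivative_eqI has_derivative_ident)
    have "linear (frechet_derivative (local_rep F d c) (at (local_rep G c d y)))"
      "linear (frechet_derivative (local_rep G c d) (at y))"
      using smooth_on_has_derivative[OF smooth_mapD(3)[OF sF d c], THEN has_derivative_linear]
        smooth_on_has_derivative[OF smooth_mapD(3)[OF sG c d] y, THEN has_derivative_linear] 1[OF y] by auto
    then have "frechet_derivative (local_rep G c d) (at y) (frechet_derivative (local_rep F d c) (at (local_rep G c d y)) u) = u" for u
      using linear_right_inverse_is_left_inverse 2 by blast
    then show ?thesis using 1[OF y] 2 by blast
  qed
  have "preserves_metric G N M" unfolding preserves_metric_def Let_def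
  proof (intro ballI allI)
    fix c d y u v assume a: "c \<in> atlas N" "d \<in> atlas M" "y \<in> local_dom G c d"
    note l = loc[OF a]
    let ?u = "\<lambda>u. frechet_derivative (local_rep G c d) (at y) u"
    have "metric N c (local_rep F d c (local_rep G c d y))
       (frechet_derivative (local_rep F d c) (at (local_rep G c d y)) (?u u))
       (frechet_derivative (local_rep F d c) (at (local_rep G c d y)) (?u v)) = metric M d (local_rep G c d y) (?u u) (?u v)"
      using pF a l unfolding preserves_metric_def Let_def by blast
    then show "metric M d (local_rep G c d y) (?u u) (?u v) = metric N c y u v" using l by simp
  qed
  moreover have "intertwines_tau G N M" unfolding intertwines_tau_def Let_def
  proof (intro ballI allI)
    fix c d y u assume a: "c \<in> atlas N" "d \<in> atlas M" "y \<in> local_dom G c d"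
    note l = loc[OF a]
    let ?u = "\<lambda>u. frechet_derivative (local_rep G c d) (at y) u"
    have "frechet_derivative (local_rep F d c) (at (local_rep G c d y)) (tau M d (local_rep G c d y) (?u u)) =
       tau N c (local_rep F d c (local_rep G c d y)) (frechet_derivative (local_rep F d c) (at (local_rep G c d y)) (?u u))"
      using tF a l unfolding intertwines_tau_def Let_def by blast
    then show "?u (tau N c y u) = tau M d (local_rep G c d y) (?u u)" using l by metis
  qed
  ultimately have "isomorphism G N M" using bG sF sG unfolding isomorphism_def by blast
  then show ?thesis unfolding isomorphic_def by blast
qed

section \<open>Isometries are affine\<close>

lemma has_real_derivative_along_line:
  fixes f :: "'a::real_normed_vector \<Rightarrow> real"
  assumes "(f has_derivative D) (at (x + s *\<^sub>R w))"
  shows "((\<lambda>s. f (x + s *\<^sub>R w)) has_real_derivative D w) (at s)"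
proof -
  have "((\<lambda>s. x + s *\<^sub>R w) has_derivative (\<lambda>t. t *\<^sub>R w)) (at s)"
    by (auto intro!: derivative_eq_intros)
  then have "((\<lambda>s. f (x + s *\<^sub>R w)) has_derivative (\<lambda>t. D (t *\<^sub>R w))) (at s)"
    by (rule has_derivative_compose[where f = "\<lambda>s. x + s *\<^sub>R w" and g = f, OF _ assms])
  then show ?thesis
    unfolding has_field_derivative_def
    by (simp add: linear_cmul[OF has_derivative_linear[OF assms]] mult.commute[of _ "D w"])
qed

text \<open>The mean value theorem is applied twice, in direction w to a difference in direction u,
  then in direction u. The left side is symmetric in u and w, the mixed derivative on the right not
  visibly so.\<close>

lemma second_difference_mvt:
  fixes f :: "'a::real_normed_vector \<Rightarrow> real"
  assumes C2: "Ck_on (Suc (Suc 0)) f UNIV" and "h > 0"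
  shows "\<exists>s t. 0 < s \<and> s < h \<and> 0 < t \<and> t < h \<and>
    f (x + h *\<^sub>R w + h *\<^sub>R u) - f (x + h *\<^sub>R w) - f (x + h *\<^sub>R u) + f x =
    h * h * frechet_derivative (\<lambda>y. frechet_derivative f (at y) w) (at (x + s *\<^sub>R w + t *\<^sub>R u)) u"
proof -
  let ?D = "\<lambda>y. frechet_derivative f (at y) w"
  let ?E = "\<lambda>y. frechet_derivative ?D (at y) u"
  have D: "(f has_derivative frechet_derivative f (at y)) (at y)" for y
    using Ck_on_has_derivative[OF C2] by blast
  have E: "(?D has_derivative frechet_derivative ?D (at y)) (at y)" for y
    using C2 by (intro Ck_on_has_derivative[of 0 _ UNIV]) (auto simp del: Ck_on.simps(1))
  have "((\<lambda>s. f ((x + h *\<^sub>R u) + s *\<^sub>R w) - f (x + s *\<^sub>R w)) has_real_derivative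
      ?D ((x + h *\<^sub>R u) + s *\<^sub>R w) - ?D (x + s *\<^sub>R w)) (at s)" for s
    by (intro DERIV_diff has_real_derivative_along_line D)
  then obtain s where s: "0 < s" "s < h"
    "(f ((x + h *\<^sub>R u) + h *\<^sub>R w) - f (x + h *\<^sub>R w)) - (f ((x + h *\<^sub>R u) + 0 *\<^sub>R w) - f (x + 0 *\<^sub>R w)) =
     (h - 0) * (?D ((x + h *\<^sub>R u) + s *\<^sub>R w) - ?D (x + s *\<^sub>R w))"
    using MVT2[OF \<open>h > 0\<close>, of "\<lambda>s. f ((x + h *\<^sub>R u) + s *\<^sub>R w) - f (x + s *\<^sub>R w)"
      "\<lambda>s. ?D ((x + h *\<^sub>R u) + s *\<^sub>R w) - ?D (x + s *\<^sub>R w)"] by blast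
  have "((\<lambda>t. ?D ((x + s *\<^sub>R w) + t *\<^sub>R u)) has_real_derivative ?E ((x + s *\<^sub>R w) + t *\<^sub>R u)) (at t)" for t
    by (rule has_real_derivative_along_line[OF E])
  then obtain t where t: "0 < t" "t < h"
    "?D ((x + s *\<^sub>R w) + h *\<^sub>R u) - ?D ((x + s *\<^sub>R w) + 0 *\<^sub>R u) = (h - 0) * ?E ((x + s *\<^sub>R w) + t *\<^sub>R u)"
    using MVT2[OF \<open>h > 0\<close>, of "\<lambda>t. ?D ((x + s *\<^sub>R w) + t *\<^sub>R u)"
      "\<lambda>t. ?E ((x + s *\<^sub>R w) + t *\<^sub>R u)"] by blast
  have "f (x + h *\<^sub>R w + h *\<^sub>R u) - f (x + h *\<^sub>R w) - f (x + h *\<^sub>R u) + f x = h * (h * ?E (x + s *\<^sub>R w + t *\<^sub>R u))"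
    using s(3) t(3) by (simp add: add_ac)
  then show ?thesis using s(1,2) t(1,2) by (intro exI[of _ s] exI[of _ t]) (simp add: mult.assoc)
qed

text \<open>Schwarz's theorem. Both mixed derivatives, each at a point tending to x, equal the same
  second difference divided by h^2; continuity of the second derivatives gives equality at x in the
  limit.\<close>

lemma second_derivative_symmetric_real:
  fixes f :: "'a::real_normed_vector \<Rightarrow> real"
  assumes C2: "Ck_on (Suc (Suc 0)) f UNIV"
  shows "frechet_derivative (\<lambda>y. frechet_derivative f (at y) w) (at x) u =
    frechet_derivative (\<lambda>y. frechet_derivative f (at y) u) (at x) w"
proof -
  let ?E = "\<lambda>w u y. frechet_derivative (\<lambda>y. frechet_derivative f (at y) w) (at y) u"
  have cont: "continuous_on UNIV (?E w u)" for w u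
    using C2 by simp
  define h where "h n = inverse (real (Suc n))" for n
  have hpos: "h n > 0" for n by (simp add: h_def)
  have h0: "h \<longlonglongrightarrow> 0" unfolding h_def by (rule LIMSEQ_inverse_real_of_nat)
  have lim: "(\<lambda>n. x + s n *\<^sub>R a + t n *\<^sub>R b) \<longlonglongrightarrow> x" if "\<And>n. 0 < s n \<and> s n < h n \<and> 0 < t n \<and> t n < h n"
    for s t :: "nat \<Rightarrow> real" and a b :: 'a
  proof -
    have "s \<longlonglongrightarrow> 0" "t \<longlonglongrightarrow> 0"
      using that by (auto intro!: tendsto_sandwich[OF _ _ tendsto_const h0] always_eventually less_imp_le)
    then have "(\<lambda>n. x + s n *\<^sub>R a + t n *\<^sub>R b) \<longlonglongrightarrow> x + 0 *\<^sub>R a + 0 *\<^sub>R b"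
      by (intro tendsto_intros)
    then show ?thesis by simp
  qed
  have limE: "(\<lambda>n. ?E w u (y n)) \<longlonglongrightarrow> ?E w u x" if "y \<longlonglongrightarrow> x" for y w u
  proof (rule isCont_tendsto_compose[OF _ that])
    show "isCont (?E w u) x" using cont[of w u] continuous_on_eq_continuous_at[OF open_UNIV] by blast
  qed
  have "\<exists>s t. 0 < s \<and> s < h n \<and> 0 < t \<and> t < h n \<and>
    f (x + h n *\<^sub>R w + h n *\<^sub>R u) - f (x + h n *\<^sub>R w) - f (x + h n *\<^sub>R u) + f x = h n * h n * ?E w u (x + s *\<^sub>R w + t *\<^sub>R u)" for n w u
    using second_difference_mvt[OF C2 hpos] by blast
  then obtain s t where st: "\<And>n w u. 0 < s n w u \<and> s n w u < h n \<and> 0 < t n w u \<and> t n w u < h n \<and>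
    f (x + h n *\<^sub>R w + h n *\<^sub>R u) - f (x + h n *\<^sub>R w) - f (x + h n *\<^sub>R u) + f x =
      h n * h n * ?E w u (x + s n w u *\<^sub>R w + t n w u *\<^sub>R u)" by metis
  have "?E w u (x + s n w u *\<^sub>R w + t n w u *\<^sub>R u) = ?E u w (x + s n u w *\<^sub>R u + t n u w *\<^sub>R w)" for n
  proof -
    have "h n * h n * ?E w u (x + s n w u *\<^sub>R w + t n w u *\<^sub>R u) = h n * h n * ?E u w (x + s n u w *\<^sub>R u + t n u w *\<^sub>R w)"
    proof -
      have "f (x + h n *\<^sub>R w + h n *\<^sub>R u) = f (x + h n *\<^sub>R u + h n *\<^sub>R w)" by (simp add: add_ac)
      moreover note st[of n w u, THEN conjunct2, THEN conjunct2, THEN conjunct2, THEN conjunct2]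
        st[of n u w, THEN conjunct2, THEN conjunct2, THEN conjunct2, THEN conjunct2]
      ultimately show ?thesis by linarith
    qed
    then show ?thesis using hpos[of n] by simp
  qed
  then have "(\<lambda>n. ?E w u (x + s n w u *\<^sub>R w + t n w u *\<^sub>R u)) =
      (\<lambda>n. ?E u w (x + s n u w *\<^sub>R u + t n u w *\<^sub>R w))" by blast
  moreover have lE: "(\<lambda>n. ?E w u (x + s n w u *\<^sub>R w + t n w u *\<^sub>R u)) \<longlonglongrightarrow> ?E w u x" for w u
    by (rule limE[OF lim]) (use st in blast)
  ultimately have "(\<lambda>n. ?E w u (x + s n w u *\<^sub>R w + t n w u *\<^sub>R u)) \<longlonglongrightarrow> ?E u w x"
    using lE[of u w] by simp
  then show ?thesis by (rule LIMSEQ_unique[OF lE])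
qed

lemma second_derivative_symmetric:
  fixes f :: "'a::real_normed_vector \<Rightarrow> 'b::euclidean_space"
  assumes C2: "Ck_on (Suc (Suc 0)) f UNIV"
  shows "frechet_derivative (\<lambda>y. frechet_derivative f (at y) w) (at x) u =
    frechet_derivative (\<lambda>y. frechet_derivative f (at y) u) (at x) w"
proof (rule euclidean_eqI)
  fix b :: 'b assume "b \<in> Basis"
  have bl: "bounded_linear (\<lambda>z :: 'b. z \<bullet> b)" by (rule bounded_linear_inner_left)
  have D: "frechet_derivative (\<lambda>y. f y \<bullet> b) (at y) w = frechet_derivative f (at y) w \<bullet> b" for y w
    using frechet_derivative_eqI[OF bounded_linear.has_derivative[OF bl Ck_on_has_derivative[OF C2 UNIV_I]]]
    by (rule fun_cong)
  have "Ck_on (Suc 0) (\<lambda>y. frechet_derivative f (at y) w) UNIV" for w using C2 Ck_on.simps(2) by blast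
  then have E: "frechet_derivative (\<lambda>y. frechet_derivative f (at y) w \<bullet> b) (at x) u =
      frechet_derivative (\<lambda>y. frechet_derivative f (at y) w) (at x) u \<bullet> b" for w u
    using frechet_derivative_eqI[OF bounded_linear.has_derivative[OF bl Ck_on_has_derivative[of 0 _ UNIV]]]
    by (metis UNIV_I)
  have "Ck_on (Suc (Suc 0)) (\<lambda>y. f y \<bullet> b) UNIV"
    by (rule Ck_on_bounded_linear_compose[OF open_UNIV bl C2])
  from second_derivative_symmetric_real[OF this, of w x u]
  show "frechet_derivative (\<lambda>y. frechet_derivative f (at y) w) (at x) u \<bullet> b =
    frechet_derivative (\<lambda>y. frechet_derivative f (at y) u) (at x) w \<bullet> b"
    unfolding D E .
qed

lemma gcan_isometry_bij:
  assumes "linear (D :: 'n::finite pc \<Rightarrow> 'n pc)" "\<And>u v. gcan (D u) (D v) = gcan u v"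
  shows "bij D"
proof -
  have "inj D" unfolding linear_injective_0[OF assms(1)] by (metis assms(2) gcan_eqI gcan_zero_left)
  then show ?thesis using linear_injective_imp_surjective[OF assms(1)] by (simp add: bij_def)
qed

text \<open>Differentiating the isometry condition makes the scalar product of the second derivative
  in directions a, b with the first derivative in direction c skew in b and c, while symmetry of
  second derivatives makes it symmetric in a and b. Such an expression is zero, as in the uniqueness
  proof for the Levi-Civita connection, so the derivative is constant.\<close>

lemma gcan_isometry_affine:
  fixes F :: "'n::finite pc \<Rightarrow> 'n pc"
  assumes sm: "smooth_on F UNIV"
    and iso: "\<And>x u v. gcan (frechet_derivative F (at x) u) (frechet_derivative F (at x) v) = gcan u v"
  obtains A where "linear A" "bij A" "\<And>u v. gcan (A u) (A v) = gcan u v"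
    "\<And>x. frechet_derivative F (at x) = A" "\<And>x. F x = A x + F 0"
proof -
  define D where "D x u = frechet_derivative F (at x) u" for x u
  define E where "E x w u = frechet_derivative (\<lambda>y. D y u) (at x) w" for x w u
  have C: "Ck_on k F UNIV" for k using sm unfolding smooth_on_def by blast
  have F: "(F has_derivative D x) (at x)" for x
    unfolding D_def using smooth_on_has_derivative[OF sm] by simp
  have linD: "linear (D x)" for x using F has_derivative_linear by blast
  have DE: "((\<lambda>y. D y u) has_derivative (\<lambda>w. E x w u)) (at x)" for x u
    unfolding D_def E_def using C[of "Suc (Suc 0)"] by (intro Ck_on_has_derivative[of 0 _ UNIV]) (auto simp del: Ck_on.simps(1))
  have sym: "E x w u = E x u w" for x w u
    unfolding E_def D_def by (rule second_derivative_symmetric[OF C])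
  have gD: "gcan (D x u) (D x v) = gcan u v" for x u v unfolding D_def by (rule iso)
  have bb: "bounded_bilinear gcan" by (simp add: bilinear_conv_bounded_bilinear[symmetric] bilinear_gcan)
  have skew: "gcan (D x u) (E x w v) + gcan (E x w u) (D x v) = 0" for x w u v
  proof -
    have "((\<lambda>y. gcan (D y u) (D y v)) has_derivative (\<lambda>w. gcan (D x u) (E x w v) + gcan (E x w u) (D x v))) (at x)"
      by (rule bounded_bilinear.FDERIV[OF bb DE DE])
    moreover have "((\<lambda>y. gcan (D y u) (D y v)) has_derivative (\<lambda>w. 0)) (at x)" by (simp add: gD)
    ultimately show ?thesis by (rule fun_cong[OF has_derivative_unique])
  qed
  have bijD: "bij (D x)" for x using gcan_isometry_bij[OF linD[of x] gD[of x]] .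
  have "E x w u = 0" for x w u
  proof (rule gcan_eqI)
    fix z
    obtain v where z: "z = D x v" using surjD[OF bij_is_surj[OF bijD[of x]]] by blast
    define T where "T a b c = gcan (E x a b) (D x c)" for a b c
    have 1: "T a b c = - T a c b" for a b c
      using skew[of x b a c] unfolding T_def by (simp add: gcan_commute)
    have 2: "T a b c = T b a c" for a b c unfolding T_def by (simp add: sym)
    \<comment> \<open>The two symmetries alternate; after six swaps, three of them with a sign, the
      arguments are back in place and the sign is reversed.\<close>
    have "T w u v = - T w v u" by (rule 1)
    also have "\<dots> = - T v w u" by (simp only: 2)
    also have "\<dots> = T v u w" using 1[of v w u] by simp
    also have "\<dots> = T u v w" by (simp only: 2)
    also have "\<dots> = - T u w v" by (rule 1)
    also have "\<dots> = - T w u v" by (simp only: 2)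
    finally show "gcan (E x w u) z = gcan 0 z" unfolding T_def z by (simp add: gcan_zero_left)
  qed
  then have "((\<lambda>y. D y u) has_derivative (\<lambda>w. 0)) (at x within UNIV)" for x u
    using DE[of u x] by simp
  then have "\<exists>c. \<forall>x\<in>UNIV. D x u = c" for u
    by (intro has_derivative_zero_constant) auto
  then have const: "D x = D 0" for x by (metis UNIV_I ext)
  have "((\<lambda>y. F y - D 0 y) has_derivative (\<lambda>w. 0)) (at x within UNIV)" for x
  proof -
    have "((\<lambda>y. F y - D 0 y) has_derivative (\<lambda>w. D x w - D 0 w)) (at x)"
      using F linD by (intro has_derivative_diff linear_imp_has_derivative)
    then show ?thesis by (simp add: const[of x])
  qed
  then have "\<exists>c. \<forall>x\<in>UNIV. F x - D 0 x = c" by (intro has_derivative_zero_constant) auto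
  then have "F x - D 0 x = F 0 - D 0 0" for x by (metis UNIV_I)
  then have "F x = D 0 x + F 0" for x
    by (metis diff_0_right diff_add_cancel diff_eq_eq add.commute linear_0[OF linD[of 0]])
  moreover have "frechet_derivative F (at x) = D 0" for x using const[of x] unfolding D_def by blast
  ultimately show ?thesis using that[of "D 0"] linD bijD gD by blast
qed

section \<open>The manifolds \<open>M(\<eta>)\<close>\<close>

lemma endo_exp_square_zero:
  assumes "\<And>y. B (B y) = 0" "B 0 = 0"
  shows "endo_exp B y = y + B y"
proof -
  have "(B ^^ Suc (Suc k)) y = 0" for k by (induction k) (simp_all add: assms)
  then have "(B ^^ k) y /\<^sub>R fact k = 0" if "k \<notin> {0, 1}" for k
    using that by (cases k rule: nat.exhaust; cases "k - 1") auto
  then have "endo_exp B y = (\<Sum>k\<in>{0, 1}. (B ^^ k) y /\<^sub>R fact k)"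
    unfolding endo_exp_def by (intro suminf_finite) auto
  then show ?thesis by simp
qed

text \<open>The structure field of \<open>M_of \<eta>\<close> in closed form for \<eta> in
  \<open>Ct\<close>: since \<open>\<eta>\<^sub>x\<close> squares to zero, the exponential series of
  \<open>2 \<eta>\<^sub>x\<close> stops after its linear term.\<close>

definition tau_field :: "'n::finite form3 \<Rightarrow> 'n pc \<Rightarrow> 'n pc \<Rightarrow> 'n pc" where
  "tau_field \<eta> x u = tcan u + 2 *\<^sub>R endo \<eta> x (tcan u)"

lemma M_of_simps [simp]:
  "points (M_of \<eta>) = UNIV" "atlas (M_of \<eta>) = {(UNIV, \<lambda>x. x)}" "metric (M_of \<eta>) c x = gcan"
  by (simp_all add: M_of_def fun_eq_iff)

lemma tau_M_of:
  assumes "\<eta> \<in> Ct"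
  shows "tau (M_of \<eta>) c x = tau_field \<eta> x"
proof -
  note L = CtD(1)[OF assms]
  have "(\<Sum>b\<in>Basis. (x \<bullet> b) *\<^sub>R endo \<eta> b y) = endo \<eta> x y" for y
    using linear_sum[OF linear_endo_left[OF L], of "\<lambda>b. (x \<bullet> b) *\<^sub>R b" Basis y]
    by (simp add: linear_cmul[OF linear_endo_left[OF L]] euclidean_representation)
  then show ?thesis
    unfolding M_of_def tau_field_def
    by (simp add: endo_exp_square_zero linear_cmul[OF linear_endo[OF L]] linear_0[OF linear_endo[OF L]] CtD(2)[OF assms])
qed

lemma inv_into_UNIV_ident [simp]: "inv_into UNIV (\<lambda>x. x) = (\<lambda>x. x)"
  by (simp add: inv_equality)

lemma local_ident [simp]:
  "local_dom F (UNIV, \<lambda>x. x) (UNIV, \<lambda>x. x) = UNIV"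
  "local_rep F (UNIV, \<lambda>x. x) (UNIV, \<lambda>x. x) = F"
  by (simp_all add: local_dom_def local_rep_def comp_def)

lemma mfd_topology_M_of: "mfd_topology (M_of \<eta>) = euclidean"
  unfolding mfd_topology_def by simp

lemma second_countable_euclidean:
  "second_countable (euclidean :: 'a::second_countable_topology topology)"
proof -
  obtain \<B> :: "'a set set" where "countable \<B>" "topological_basis \<B>"
    using ex_countable_basis by blast
  then show ?thesis unfolding second_countable_def
    by (intro exI[of _ \<B>]) (auto simp: topological_basis_open elim!: topological_basisE)
qed

lemma smooth_manifold_M_of: "smooth_manifold (M_of \<eta>)"
proof -
  have "smooth_on (\<lambda>p :: 'a pc. p) UNIV" by (rule smooth_on_linear) (simp_all add: linear_iff)
  then show ?thesis
    unfolding smooth_manifold_def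
    by (simp add: smooth_map_def mfd_topology_M_of second_countable_euclidean)
qed

lemma gcan_nondegenerate: "(\<And>z. gcan x z = 0) \<Longrightarrow> x = 0"
  using gcan_eqI[of x 0] by (simp add: gcan_zero_left)

lemma christoffel_M_of: "christoffel (M_of \<eta>) c x u v = 0"
proof -
  have "ddir (\<lambda>y. a) x u = 0" for a :: real and x u :: "'a pc"
    unfolding ddir_def by (simp add: frechet_derivative_const)
  then show ?thesis unfolding christoffel_def
    by (intro the_equality) (auto simp: gcan_zero_left intro: gcan_nondegenerate)
qed

lemma pseudo_Riemannian_M_of: "pseudo_Riemannian (M_of \<eta>)"
  unfolding pseudo_Riemannian_def
proof (intro conjI)
  show "preserves_metric (\<lambda>p. p) (M_of \<eta>) (M_of \<eta>)"
    by (simp add: preserves_metric_def frechet_derivative_eqI[OF has_derivative_ident])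
  show "\<forall>(U, \<phi>)\<in>atlas (M_of \<eta>). let g = metric (M_of \<eta>) (U, \<phi>) in
        (\<forall>u v. smooth_on (\<lambda>x. g x u v) (\<phi> ` U)) \<and>
        (\<forall>x\<in>\<phi> ` U. bilinear (g x) \<and> (\<forall>u v. g x u v = g x v u) \<and> (\<forall>u. (\<forall>v. g x u v = 0) \<longrightarrow> u = 0))"
    by (auto simp: smooth_on_def Ck_on_const bilinear_gcan gcan_commute intro: gcan_nondegenerate)
qed (rule smooth_manifold_M_of)

lemma dim_eigenspaces_tcan: "dim {u :: 'n::finite pc. tcan u = u} = dim {u :: 'n pc. tcan u = - u}"
proof -
  have "dim (eig_plus (UNIV :: 'n pc set)) = dim (eig_minus (UNIV :: 'n pc set))"
    unfolding dim_half[symmetric] by (simp add: half_plus_def half_minus_def)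
  then show ?thesis by (simp add: eig_plus_def eig_minus_def)
qed

text \<open>\<open>\<tau>\<^sub>x = (1 + \<eta>\<^sub>x) \<tau> (1 + \<eta>\<^sub>x)\<^sup>-\<^sup>1\<close>, as \<open>\<eta>\<^sub>x\<close> anticommutes with \<open>\<tau>\<close> and squares to zero.\<close>

lemma tau_field_conjugate:
  assumes "\<eta> \<in> Ct"
  defines "P \<equiv> \<lambda>x u. u + endo \<eta> x u"
  shows "linear (P x)" "inj (P x)" "surj (P x)" "tau_field \<eta> x (P x u) = P x (tcan u)"
    "gcan (P x u) (P x v) = gcan u v"
proof -
  note L = CtD(1)[OF assms(1)] and C = CtD[OF assms(1)]
  note le = linear_endo[OF L]
  show l: "linear (P x)" unfolding P_def
    by (intro linearI) (simp_all add: linear_add[OF le] linear_cmul[OF le] algebra_simps)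
  have inv: "P x (u - endo \<eta> x u) = u" "P x u - endo \<eta> x (P x u) = u" for u
    by (simp_all add: P_def linear_diff[OF le] linear_add[OF le] C(2))
  show "inj (P x)" by (rule inj_on_inverseI[where g = "\<lambda>u. u - endo \<eta> x u"]) (rule inv(2))
  show "surj (P x)" by (rule surjI[where f = "\<lambda>u. u - endo \<eta> x u"]) (rule inv(1))
  show "tau_field \<eta> x (P x u) = P x (tcan u)"
    unfolding tau_field_def P_def
    by (simp add: tcan_add linear_add[OF le] C(2) C(4) linear_neg[OF le] scaleR_2)
       (simp add: C(4)[symmetric] C(2) tcan_zero linear_neg[OF le, symmetric])
  show "gcan (P x u) (P x v) = gcan u v"
    unfolding P_def using gcan_endo_skew[OF L, of x u v] gcan_endo_skew[OF L, of x u "endo \<eta> x v"]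
    by (simp add: gcan_simps C(2))
qed

lemma Collect_eq_image:
  assumes "surj f" "\<And>u. Q (f u) \<longleftrightarrow> R u"
  shows "{u. Q u} = f ` {u. R u}"
proof (intro equalityI subsetI)
  fix y assume "y \<in> {u. Q u}"
  moreover obtain x where "y = f x" using assms(1) by (metis surjD)
  ultimately show "y \<in> f ` {u. R u}" using assms(2) by blast
qed (use assms(2) in blast)

text \<open>The isometry \<open>1 + \<eta>\<^sub>x\<close> carries \<tau> to the structure at x, so
  involutivity, compatibility with the metric and equality of the eigenspace dimensions are
  inherited from \<tau>.\<close>

lemma almost_para_Hermitian_M_of:
  assumes "\<eta> \<in> Ct"
  shows "almost_para_Hermitian (M_of \<eta>)"
proof -
  note L = CtD(1)[OF assms] and C = CtD[OF assms] and P = tau_field_conjugate[OF assms]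
  note le = linear_endo[OF L]
  have sm: "smooth_on (\<lambda>x. tau_field \<eta> x u) UNIV" for u
    unfolding smooth_on_def tau_field_def
  proof (intro allI Ck_on_add Ck_on_const open_UNIV Ck_on_bounded_linear)
    show "bounded_linear (\<lambda>x. 2 *\<^sub>R endo \<eta> x (tcan u))"
      using linear_endo_left[OF L] by (simp add: linear_conv_bounded_linear bounded_linear_scaleR_right bounded_linear_compose[OF bounded_linear_scaleR_right])
  qed
  have lt: "linear (tau_field \<eta> x)" for x
    unfolding tau_field_def
    by (intro linearI) (simp_all add: tcan_simps linear_add[OF le] linear_cmul[OF le] algebra_simps)
  have tP: "\<exists>v. u = v + endo \<eta> x v" for u x using P(3)[of x] by (metis surjD)
  have tt: "tau_field \<eta> x (tau_field \<eta> x u) = u" for x u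
    using tP[of u x] P(4)[of x] by (metis tcan_tcan)
  have gt: "gcan (tau_field \<eta> x u) (tau_field \<eta> x v) = - gcan u v" for x u v
  proof -
    obtain u' v' where "u = u' + endo \<eta> x u'" "v = v' + endo \<eta> x v'" using tP by metis
    then show ?thesis using P(4,5)[where x = x] by (simp add: gcan_tcan_left)
  qed
  have dim: "dim {u. tau_field \<eta> x u = u} = dim {u. tau_field \<eta> x u = - u}" for x
  proof -
    let ?P = "\<lambda>u. u + endo \<eta> x u"
    have e: "?P u = ?P v \<longleftrightarrow> u = v" for u v using P(2)[of x] unfolding inj_def by blast
    have "{u. tau_field \<eta> x u = u} = ?P ` {u. tcan u = u}" "{u. tau_field \<eta> x u = - u} = ?P ` {u. tcan u = - u}"
    proof -
      have 1: "tau_field \<eta> x (?P u) = ?P u \<longleftrightarrow> tcan u = u" for u using P(4)[of x u] e by simp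
      have 2: "tau_field \<eta> x (?P u) = - ?P u \<longleftrightarrow> tcan u = - u" for u
        using P(4)[of x u] e[of "tcan u" "- u"] by (simp add: linear_neg[OF le])
      show "{u. tau_field \<eta> x u = u} = ?P ` {u. tcan u = u}"
        by (rule Collect_eq_image[OF P(3)[of x]]) (rule 1)
      show "{u. tau_field \<eta> x u = - u} = ?P ` {u. tcan u = - u}"
        by (rule Collect_eq_image[OF P(3)[of x]]) (rule 2)
    qed
    then show ?thesis using dim_image_eq[OF P(1)[of x]] inj_on_subset[OF P(2)[of x] subset_UNIV] dim_eigenspaces_tcan by simp
  qed
  show ?thesis
    unfolding almost_para_Hermitian_def
    using pseudo_Riemannian_M_of
    by (simp add: intertwines_tau_def frechet_derivative_eqI[OF has_derivative_ident] tau_M_of[OF assms] sm lt tt gt dim)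
qed

text \<open>The Christoffel symbols vanish, so the covariant derivative of the structure in
  direction X is \<open>2 \<eta>\<^sub>X \<tau>\<close>. Applied to Y it equals
  \<open>-2 \<tau> \<eta>\<^sub>X Y\<close>, which is alternating in X and Y.\<close>

lemma nearly_para_Kaehler_M_of:
  assumes "\<eta> \<in> Ct"
  shows "nearly_para_Kaehler (M_of \<eta>)"
proof -
  note L = CtD(1)[OF assms] and C = CtD[OF assms]
  have "ddir (\<lambda>y. tau_field \<eta> y Y) x X = 2 *\<^sub>R endo \<eta> X (tcan Y)" for x X Y
  proof -
    have "((\<lambda>y. 2 *\<^sub>R endo \<eta> y (tcan Y)) has_derivative (\<lambda>X. 2 *\<^sub>R endo \<eta> X (tcan Y))) (at x)"
      by (intro has_derivative_scaleR_right linear_imp_has_derivative linear_endo_left[OF L])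
    then have "((\<lambda>y. tau_field \<eta> y Y) has_derivative (\<lambda>X. 2 *\<^sub>R endo \<eta> X (tcan Y))) (at x)"
      unfolding tau_field_def using has_derivative_add[OF has_derivative_const] by fastforce
    then show ?thesis unfolding ddir_def using frechet_derivative_eqI by metis
  qed
  moreover have "tau_field \<eta> x 0 = 0" for x by (simp add: tau_field_def tcan_zero linear_0[OF linear_endo[OF L]])
  ultimately have "nabla_tau (M_of \<eta>) c x X Y = 2 *\<^sub>R endo \<eta> X (tcan Y)" for c x X Y
    by (simp add: nabla_tau_def christoffel_M_of tau_M_of[OF assms])
  moreover have "2 *\<^sub>R endo \<eta> X (tcan Y) = - (2 *\<^sub>R endo \<eta> Y (tcan X))" for X Y
    by (simp add: C(4) endo_swap[OF L, of X Y] tcan_minus)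
  ultimately have "nabla_tau (M_of \<eta>) c x X Y = - nabla_tau (M_of \<eta>) c x Y X" for c x X Y by metis
  then show ?thesis
    unfolding nearly_para_Kaehler_def using almost_para_Hermitian_M_of[OF assms] by blast
qed

lemma flat_M_of: "flat (M_of \<eta>)"
  unfolding flat_def curvature_def ddir_def by (simp add: christoffel_M_of frechet_derivative_const)

lemma geodesically_complete_M_of: "geodesically_complete (M_of \<eta>)"
  unfolding geodesically_complete_def
proof clarsimp
  fix a v :: "'a pc"
  have d: "((\<lambda>t. a + t *\<^sub>R v) has_vector_derivative v) (at t)" for t
    by (auto intro!: derivative_eq_intros)
  then have vd: "vector_derivative (\<lambda>t. a + t *\<^sub>R v) (at t) = v" for t
    by (rule vector_derivative_at)
  have "geodesic (M_of \<eta>) (\<lambda>t. a + t *\<^sub>R v)"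
    unfolding geodesic_def
    using d by (auto simp: mfd_topology_M_of comp_def vd christoffel_M_of Let_def
        intro!: continuous_intros differentiableI_vector)
  then show "\<exists>\<gamma>. geodesic (M_of \<eta>) \<gamma> \<and> \<gamma> 0 = a \<and> vector_derivative ((\<lambda>x. x) \<circ> \<gamma>) (at 0) = v"
    by (intro exI[of _ "\<lambda>t. a + t *\<^sub>R v"]) (simp add: comp_def vd)
qed

lemma simply_connected_space_euclidean:
  "simply_connected_space (euclidean :: 'a::real_normed_vector topology)"
  unfolding simply_connected_space_def
proof (intro allI impI)
  fix a b :: "real \<Rightarrow> 'a"
  assume ab: "pathin euclidean a \<and> a 1 = a 0 \<and> pathin euclidean b \<and> b 1 = b 0"
  have c: "continuous_on {0..1} a" "continuous_on {0..1} b"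
    using ab unfolding pathin_def by auto
  let ?h = "\<lambda>y. (1 - fst y) *\<^sub>R a (snd y) + fst y *\<^sub>R b (snd y)"
  have "continuous_on ({0..1} \<times> {0..1}) ?h"
    by (intro continuous_intros continuous_on_compose2[OF c(1)] continuous_on_compose2[OF c(2)]) auto
  then have "continuous_map (prod_topology (top_of_set {0..1::real}) (top_of_set {0..1::real})) euclidean ?h"
    by simp
  then show "homotopic_with (\<lambda>r. r 1 = r 0) (top_of_set {0..1}) euclidean a b"
    unfolding homotopic_with_def using ab by (intro exI[of _ ?h]) auto
qed

section \<open>Isomorphisms between the models\<close>

lemma isomorphism_M_of_iff:
  assumes "\<eta> \<in> Ct" "\<theta> \<in> Ct"
  shows "isomorphism F (M_of \<eta>) (M_of \<theta>) \<longleftrightarrow> bij F \<and> smooth_on F UNIV \<and> smooth_on (inv F) UNIV \<and>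
    (\<forall>x u v. gcan (frechet_derivative F (at x) u) (frechet_derivative F (at x) v) = gcan u v) \<and>
    (\<forall>x u. frechet_derivative F (at x) (tau_field \<eta> x u) = tau_field \<theta> (F x) (frechet_derivative F (at x) u))"
  unfolding isomorphism_def smooth_map_def preserves_metric_def intertwines_tau_def
  by (simp add: tau_M_of[OF assms(1)] tau_M_of[OF assms(2)] Let_def)

lemma isomorphic_M_of_Lambda3_map:
  assumes "\<eta> \<in> Ct" "A \<in> AutV"
  shows "isomorphic (M_of \<eta>) (M_of (Lambda3_map UNIV A \<eta>))"
proof -
  note A = AutVD[OF assms(2)] and L = CtD(1)[OF assms(1)]
  have "frechet_derivative A (at x) = A" for x
    by (rule frechet_derivative_eqI[OF linear_imp_has_derivative[OF A(1)]])
  then have "isomorphism A (M_of \<eta>) (M_of (Lambda3_map UNIV A \<eta>))"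
    unfolding isomorphism_M_of_iff[OF assms(1) Lambda3_map_in_Ct[OF assms(2,1)]]
    using A(2,3) smooth_on_linear[OF A(1)] smooth_on_linear[OF AutVD(1)[OF AutV_inv[OF assms(2)]]]
    by (simp add: tau_field_def endo_Lambda3_map[OF assms(2) L] A(6) linear_add[OF A(1)] linear_cmul[OF A(1)] AutVD(4)[OF assms(2), symmetric])
  then show ?thesis unfolding isomorphic_def by blast
qed

text \<open>An isomorphism is affine, \<open>x \<mapsto> A x + b\<close>. Its linear part need not commute with \<open>\<tau>\<close> (unless
  \<open>\<theta>\<^sub>b = 0\<close>), but \<open>(1 - \<theta>\<^sub>b) A\<close> does and still carries \<open>\<eta>\<close> to \<open>\<theta>\<close>.\<close>

lemma isomorphic_M_of_imp_Lambda3_map: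
  assumes "\<eta> \<in> Ct" "\<theta> \<in> Ct" "isomorphic (M_of \<eta>) (M_of \<theta>)"
  shows "\<exists>A\<in>AutV. \<theta> = Lambda3_map UNIV A \<eta>"
proof -
  obtain F where "isomorphism F (M_of \<eta>) (M_of \<theta>)" using assms(3) unfolding isomorphic_def by blast
  from this[unfolded isomorphism_M_of_iff[OF assms(1,2)]] have F: "smooth_on F UNIV"
    "\<And>x u v. gcan (frechet_derivative F (at x) u) (frechet_derivative F (at x) v) = gcan u v"
    "\<And>x u. frechet_derivative F (at x) (tau_field \<eta> x u) = tau_field \<theta> (F x) (frechet_derivative F (at x) u)"
    by blast+
  obtain A where A: "linear A" "bij A" "\<And>u v. gcan (A u) (A v) = gcan u v"
    "\<And>x. frechet_derivative F (at x) = A" "\<And>x. F x = A x + F 0"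
    using gcan_isometry_affine[OF F(1,2)] by blast
  define b where "b = F 0"
  note L = CtD(1)[OF assms(1)] and L' = CtD(1)[OF assms(2)] and C = CtD[OF assms(1)] and C' = CtD[OF assms(2)]
  note le = linear_endo[OF L] and le' = linear_endo[OF L'] and ll' = linear_endo_left[OF L']
  have t: "A (tau_field \<eta> x u) = tau_field \<theta> (A x + b) (A u)" for x u
    using F(3)[of x u] A(5)[of x] unfolding A(4) b_def by simp
  \<comment> \<open>Evaluation at the origin measures how far A is from commuting with \<tau>; the
    defect is a value of \<open>\<theta>\<^sub>b\<close>.\<close>
  have t0: "A (tcan u) = tcan (A u) + 2 *\<^sub>R endo \<theta> b (tcan (A u))" for u
    using t[of 0 u] by (simp add: tau_field_def linear_0[OF A(1)] linear_0[OF linear_endo_left[OF L]])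
  have te: "A (endo \<eta> x (tcan u)) = endo \<theta> (A x) (tcan (A u))" for x u
  proof -
    have "A (tcan u) + 2 *\<^sub>R A (endo \<eta> x (tcan u)) = tcan (A u) + 2 *\<^sub>R (endo \<theta> (A x) (tcan (A u)) + endo \<theta> b (tcan (A u)))"
      using t[of x u] by (simp add: tau_field_def linear_add[OF A(1)] linear_cmul[OF A(1)] linear_add[OF ll'])
    then show ?thesis unfolding t0 by (simp add: scaleR_add_right)
  qed
  \<comment> \<open>Replacing u by \<tau> u removes \<tau> from \<open>te\<close>; the defect of
    \<open>t0\<close> then disappears because endomorphisms of \<theta> compose to zero.\<close>
  have Ae: "A (endo \<eta> x u) = endo \<theta> (A x) (A u)" for x u
  proof -
    have "A (endo \<eta> x (tcan (tcan u))) = endo \<theta> (A x) (tcan (A (tcan u)))" by (rule te)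
    also have "\<dots> = - tcan (endo \<theta> (A x) (A (tcan u)))" by (rule C'(4))
    also have "\<dots> = - tcan (endo \<theta> (A x) (tcan (A u)))"
      unfolding t0 by (simp add: linear_add[OF le'] linear_cmul[OF le'] C'(2))
    also have "\<dots> = endo \<theta> (A x) (A u)" by (simp add: C'(4) tcan_minus)
    finally show ?thesis by simp
  qed
  define B where "B u = A u - endo \<theta> b (A u)" for u
  have lB: "linear B" unfolding B_def
    by (intro linearI) (simp_all add: linear_add[OF A(1)] linear_cmul[OF A(1)] linear_add[OF le'] linear_cmul[OF le'] algebra_simps)
  have gB: "gcan (B u) (B v) = gcan u v" for u v
    using gcan_endo_skew[OF L', of b "A u" "A v"] gcan_endo_skew[OF L', of b "A u" "endo \<theta> b (A v)"]
    unfolding B_def by (simp add: gcan_simps C'(2) A(3))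
  \<comment> \<open>The defect in \<open>t0\<close> is twice \<open>\<theta>\<^sub>b\<close> applied
    to \<tau> A u. The correction cancels one half; by anticommutation the other half is the image
    under \<tau> of the correction to A u.\<close>
  have tB: "B (tcan u) = tcan (B u)" for u
    unfolding B_def t0 by (simp add: tcan_simps linear_add[OF le'] linear_cmul[OF le'] linear_diff[OF le'] linear_neg[OF le'] C'(2) C'(4) scaleR_2)
  have BA: "B \<in> AutV" unfolding AutV_def using lB gB tB gcan_isometry_bij[OF lB gB] by blast
  \<comment> \<open>A value of \<theta> inserted into either argument of \<theta> gives zero, so the
    correction is invisible on both sides.\<close>
  have "endo \<theta> (B x) (B u) = B (endo \<eta> x u)" for x u
    unfolding B_def Ae by (simp add: linear_diff[OF le'] linear_diff[OF ll'] C'(2,3))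
  then show ?thesis using Lambda3_map_eq_iff[OF BA L L'] BA by blast
qed

section \<open>Orbits\<close>

definition orbit3 :: "('n::finite pc \<Rightarrow> 'n pc) set \<Rightarrow> 'n form3 \<Rightarrow> 'n form3 set" where
  "orbit3 H \<eta> = (\<lambda>A. Lambda3_map UNIV A \<eta>) ` H"

lemma orbits_eq: "orbits H (Lambda3_map UNIV) E = orbit3 H ` E"
  unfolding orbits_def orbit3_def ..

text \<open>Common to G and the stabilizer of L, so that facts about orbits are proved once for
  both.\<close>

definition subgroup_AutV :: "('n::finite pc \<Rightarrow> 'n pc) set \<Rightarrow> bool" where
  "subgroup_AutV H \<longleftrightarrow> H \<subseteq> AutV \<and> id \<in> H \<and> (\<forall>A\<in>H. \<forall>B\<in>H. A \<circ> B \<in> H) \<and> (\<forall>A\<in>H. inv A \<in> H)"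

lemma subgroup_AutV_AutV: "subgroup_AutV AutV"
  unfolding subgroup_AutV_def using AutV_id AutV_comp AutV_inv by blast

lemma subgroup_AutV_stabilizer: "subgroup_AutV (stabilizer L)"
proof -
  have "inv A ` L = L" if "A \<in> AutV" "A ` L = L" for A
  proof -
    have "inv A ` (A ` L) = L" using AutVD(6)[OF that(1)] by (simp add: image_image)
    then show ?thesis using that(2) by simp
  qed
  then have "\<forall>A\<in>stabilizer L. inv A \<in> stabilizer L" unfolding stabilizer_def using AutV_inv by blast
  moreover have "\<forall>A\<in>stabilizer L. \<forall>B\<in>stabilizer L. A \<circ> B \<in> stabilizer L"
  proof (intro ballI)
    fix A B assume AB: "A \<in> stabilizer L" "B \<in> stabilizer L"
    have "(A \<circ> B) ` L = A ` B ` L" by (rule image_comp[symmetric])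
    then show "A \<circ> B \<in> stabilizer L" using AB AutV_comp[of A B] unfolding stabilizer_def by simp
  qed
  moreover have "id \<in> stabilizer L" unfolding stabilizer_def using AutV_id by simp
  moreover have "stabilizer L \<subseteq> AutV" unfolding stabilizer_def by blast
  ultimately show ?thesis unfolding subgroup_AutV_def by blast
qed

lemma orbit3_self: "subgroup_AutV H \<Longrightarrow> \<eta> \<in> Lambda3 UNIV \<Longrightarrow> \<eta> \<in> orbit3 H \<eta>"
  unfolding subgroup_AutV_def orbit3_def using Lambda3_map_id by (metis imageI)

lemma orbit3_eq:
  assumes H: "subgroup_AutV H" and L: "\<eta> \<in> Lambda3 UNIV" and \<theta>: "\<theta> \<in> orbit3 H \<eta>"
  shows "orbit3 H \<theta> = orbit3 H \<eta>"
proof -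
  have sub: "orbit3 H \<theta> \<subseteq> orbit3 H \<eta>" if L: "\<eta> \<in> Lambda3 UNIV" and \<theta>: "\<theta> \<in> orbit3 H \<eta>" for \<eta> \<theta>
  proof -
    obtain A where A: "A \<in> H" "\<theta> = Lambda3_map UNIV A \<eta>" using \<theta> unfolding orbit3_def by blast
    have "Lambda3_map UNIV B \<theta> = Lambda3_map UNIV (B \<circ> A) \<eta> \<and> B \<circ> A \<in> H" if B: "B \<in> H" for B
    proof -
      have "A \<in> AutV" "B \<in> AutV" "B \<circ> A \<in> H" using H A(1) B unfolding subgroup_AutV_def by blast+
      then show ?thesis using Lambda3_map_comp[OF _ _ L] A(2) by simp
    qed
    then show ?thesis unfolding orbit3_def by blast
  qed
  obtain A where A: "A \<in> H" "\<theta> = Lambda3_map UNIV A \<eta>" using \<theta> unfolding orbit3_def by blast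
  have AA: "A \<in> AutV" "inv A \<in> H" using H A unfolding subgroup_AutV_def by blast+
  have "\<theta> \<in> Lambda3 UNIV" using Lambda3_map_in_Lambda3[OF AA(1) L] A(2) by simp
  moreover have "\<eta> \<in> orbit3 H \<theta>"
    using Lambda3_map_inv[OF AA(1) L] A(2) AA(2) unfolding orbit3_def by (metis imageI)
  ultimately show ?thesis using sub[OF L \<theta>] sub by blast
qed

lemma Ct_typeD: "\<eta> \<in> Ct_type p q \<Longrightarrow> \<eta> \<in> Ct" "\<eta> \<in> Ct_type p q \<Longrightarrow> \<eta> \<in> Lambda3 UNIV"
  unfolding Ct_type_def using CtD(1) by auto

lemma orbit3_Ct_type: "\<eta> \<in> Ct_type p q \<Longrightarrow> orbit3 AutV \<eta> \<subseteq> Ct_type p q"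
  unfolding orbit3_def using Lambda3_map_in_Ct_type by blast

lemma isomorphic_M_of_iff:
  assumes "\<eta> \<in> Ct" "\<theta> \<in> Ct"
  shows "isomorphic (M_of \<eta>) (M_of \<theta>) \<longleftrightarrow> \<theta> \<in> orbit3 AutV \<eta>"
  using isomorphic_M_of_imp_Lambda3_map[OF assms] isomorphic_M_of_Lambda3_map[OF assms(1)]
  unfolding orbit3_def by blast

section \<open>Isomorphism classes\<close>

lemma flat_npK_type_M_of:
  assumes "\<eta> \<in> Ct_type p q"
  shows "flat_npK_type p q (M_of \<eta>)"
  unfolding flat_npK_type_def
  using assms Ct_typeD[OF assms] nearly_para_Kaehler_M_of flat_M_of geodesically_complete_M_of
    simply_connected_space_euclidean isomorphic_M_of_iff orbit3_self[OF subgroup_AutV_AutV]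
  by (metis mfd_topology_M_of)

lemma flat_npK_type_smooth_manifold: "flat_npK_type p q M \<Longrightarrow> smooth_manifold M"
  unfolding flat_npK_type_def nearly_para_Kaehler_def almost_para_Hermitian_def pseudo_Riemannian_def
  by blast

text \<open>Three independent point types, because a manifold on any type is compared with the
  models, whose points are those of V.\<close>

lemma isomorphic_flat_npK:
  fixes M :: "('m1, 'n::finite pc) mfd" and N :: "('m2, 'n pc) mfd" and K :: "('m3, 'n pc) mfd"
  assumes "flat_npK_type p q M" "flat_npK_type p q N"
  shows "isomorphic M N \<Longrightarrow> isomorphic N M"
    and "flat_npK_type p q K \<Longrightarrow> isomorphic M N \<Longrightarrow> isomorphic N K \<Longrightarrow> isomorphic M K"
  using isomorphic_sym[of M N] isomorphic_trans[of M N K] flat_npK_type_smooth_manifold[OF assms(1)]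
    flat_npK_type_smooth_manifold[OF assms(2)] flat_npK_type_smooth_manifold[of p q K] by simp_all

text \<open>Composition with a fixed isomorphism to M(\<eta>) reduces the question to which models
  M(\<eta>) is isomorphic to, and there orbits decide.\<close>

lemma moduli_eq_orbit3:
  fixes M :: "('m, 'n::finite pc) mfd"
  assumes M: "flat_npK_type p q M" and \<eta>: "\<eta> \<in> Ct_type p q" and iso: "isomorphic M (M_of \<eta>)"
  shows "moduli p q M = orbit3 AutV \<eta>"
proof -
  have "isomorphic M (M_of \<theta>) \<longleftrightarrow> \<theta> \<in> orbit3 AutV \<eta>" if \<theta>: "\<theta> \<in> Ct_type p q" for \<theta>
  proof -
    note f = flat_npK_type_M_of[OF \<eta>] flat_npK_type_M_of[OF \<theta>]
    have "isomorphic M (M_of \<theta>) \<longleftrightarrow> isomorphic (M_of \<eta>) (M_of \<theta>)"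
      using isomorphic_flat_npK(2)[OF M f(1) f(2) iso]
        isomorphic_flat_npK(2)[OF f(1) M f(2) isomorphic_flat_npK(1)[OF M f(1) iso]] by blast
    then show ?thesis using isomorphic_M_of_iff Ct_typeD(1) \<eta> \<theta> by blast
  qed
  then show ?thesis unfolding moduli_def using orbit3_Ct_type[OF \<eta>] by blast
qed

lemma flat_npK_typeE:
  assumes "flat_npK_type p q M"
  obtains \<eta> where "\<eta> \<in> Ct_type p q" "isomorphic M (M_of \<eta>)"
  using assms unfolding flat_npK_type_def by blast

text \<open>A parameter shared by M and N gives a model through which the two are connected.\<close>

lemma isomorphic_iff_moduli_eq:
  fixes M :: "('m1, 'n::finite pc) mfd" and N :: "('m2, 'n pc) mfd"
  assumes M: "flat_npK_type p q M" and N: "flat_npK_type p q N"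
  shows "isomorphic M N \<longleftrightarrow> moduli p q M = moduli p q N"
proof -
  obtain \<eta> where \<eta>: "\<eta> \<in> Ct_type p q" "isomorphic N (M_of \<eta>)" using flat_npK_typeE[OF N] .
  note f = flat_npK_type_M_of[OF \<eta>(1)]
  have mN: "moduli p q N = orbit3 AutV \<eta>" by (rule moduli_eq_orbit3[OF N \<eta>])
  show ?thesis
  proof
    assume "isomorphic M N"
    then have "isomorphic M (M_of \<eta>)" using isomorphic_flat_npK(2)[OF M N f _ \<eta>(2)] by blast
    then show "moduli p q M = moduli p q N" using moduli_eq_orbit3[OF M \<eta>(1)] mN by simp
  next
    assume "moduli p q M = moduli p q N"
    then have "\<eta> \<in> moduli p q M"
      using mN orbit3_self[OF subgroup_AutV_AutV Ct_typeD(2)[OF \<eta>(1)]] by simp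
    then have "isomorphic M (M_of \<eta>)" unfolding moduli_def by blast
    then show "isomorphic M N"
      using isomorphic_flat_npK(2)[OF M f N _ isomorphic_flat_npK(1)[OF N f \<eta>(2)]] by blast
  qed
qed

lemma iso_rel_class_eq:
  assumes "flat_npK_type p q M" "flat_npK_type p q N" "isomorphic M N"
  shows "iso_rel p q `` {M} = iso_rel p q `` {N}"
proof -
  have "isomorphic M K \<longleftrightarrow> isomorphic N K" if "flat_npK_type p q K" for K
    using isomorphic_flat_npK[of p q] assms that by blast
  then show ?thesis unfolding iso_rel_def using assms(1,2) by blast
qed

lemma bij_betw_orbits_iso_classes:
  "bij_betw (\<lambda>P. \<Union>\<eta>\<in>P. iso_rel p q `` {M_of \<eta>})
     (orbits AutV (Lambda3_map UNIV) (Ct_type p q :: 'n::finite form3 set))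
     (iso_classes p q :: ('n pc, 'n pc) mfd set set)"
proof -
  let ?C = "Ct_type p q :: 'n form3 set"
  let ?\<Phi> = "\<lambda>P :: 'n form3 set. \<Union>\<eta>\<in>P. iso_rel p q `` {M_of \<eta>}"
  \<comment> \<open>All members of an orbit give isomorphic models, so the union runs over one and
    the same class.\<close>
  have \<Phi>: "?\<Phi> (orbit3 AutV \<eta>) = iso_rel p q `` {M_of \<eta>}" if \<eta>: "\<eta> \<in> ?C" for \<eta>
  proof -
    have "iso_rel p q `` {M_of \<theta>} = iso_rel p q `` {M_of \<eta>}" if \<theta>: "\<theta> \<in> orbit3 AutV \<eta>" for \<theta>
    proof -
      have "\<theta> \<in> ?C" using orbit3_Ct_type[OF \<eta>] \<theta> by blast
      then show ?thesis
        using iso_rel_class_eq[OF flat_npK_type_M_of[OF \<eta>] flat_npK_type_M_of] \<theta> \<eta> isomorphic_M_of_iff Ct_typeD(1) by metis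
    qed
    moreover have "\<eta> \<in> orbit3 AutV \<eta>" using orbit3_self[OF subgroup_AutV_AutV Ct_typeD(2)[OF \<eta>]] .
    ultimately show ?thesis by blast
  qed
  have "inj_on ?\<Phi> (orbit3 AutV ` ?C)"
  proof (rule inj_onI)
    fix P Q assume "P \<in> orbit3 AutV ` ?C" "Q \<in> orbit3 AutV ` ?C" and eq: "?\<Phi> P = ?\<Phi> Q"
    then obtain \<eta> \<theta> where P: "\<eta> \<in> ?C" "P = orbit3 AutV \<eta>" and Q: "\<theta> \<in> ?C" "Q = orbit3 AutV \<theta>" by blast
    have "(M_of \<theta>, M_of \<theta>) \<in> iso_rel p q"
      unfolding iso_rel_def using flat_npK_type_M_of[OF Q(1)] isomorphic_M_of_iff[OF Ct_typeD(1) Ct_typeD(1), OF Q(1) Q(1)]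
        orbit3_self[OF subgroup_AutV_AutV Ct_typeD(2)[OF Q(1)]] by blast
    then have "(M_of \<eta>, M_of \<theta>) \<in> iso_rel p q" using eq unfolding P(2) Q(2) \<Phi>[OF P(1)] \<Phi>[OF Q(1)] by blast
    then have "\<theta> \<in> orbit3 AutV \<eta>"
      unfolding iso_rel_def using isomorphic_M_of_iff[OF Ct_typeD(1) Ct_typeD(1), OF P(1) Q(1)] by blast
    then show "P = Q" using orbit3_eq[OF subgroup_AutV_AutV Ct_typeD(2)[OF P(1)]] P Q by simp
  qed
  moreover have "?\<Phi> ` orbit3 AutV ` ?C = iso_classes p q"
  proof -
    have "?\<Phi> ` orbit3 AutV ` ?C = (\<lambda>\<eta>. iso_rel p q `` {M_of \<eta>}) ` ?C"
      using \<Phi> by (simp add: image_image)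
    also have "\<dots> = (\<lambda>M :: ('n pc, 'n pc) mfd. iso_rel p q `` {M}) ` Collect (flat_npK_type p q)"
    proof (intro equalityI subsetI)
      fix S assume "S \<in> (\<lambda>M :: ('n pc, 'n pc) mfd. iso_rel p q `` {M}) ` Collect (flat_npK_type p q)"
      then obtain M where M: "flat_npK_type p q M" "S = iso_rel p q `` {M}" by blast
      obtain \<eta> where \<eta>: "\<eta> \<in> ?C" "isomorphic M (M_of \<eta>)" using flat_npK_typeE[OF M(1)] .
      then show "S \<in> (\<lambda>\<eta>. iso_rel p q `` {M_of \<eta>}) ` ?C"
        using iso_rel_class_eq[OF M(1) flat_npK_type_M_of[OF \<eta>(1)] \<eta>(2)] M(2) by blast
    qed (use flat_npK_type_M_of in blast)
    also have "\<dots> = iso_classes p q" unfolding iso_classes_def quotient_def by blast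
    finally show ?thesis .
  qed
  ultimately show ?thesis unfolding orbits_eq bij_betw_def by blast
qed

section \<open>Reduction to a fixed maximally isotropic subspace\<close>

lemma Lambda_minus_subset:
  assumes "\<eta> \<in> Lambda_minus L"
  shows "\<eta> \<in> Lambda3 L"
proof -
  obtain a b where "a \<in> Lambda3 (eig_plus L)" "b \<in> Lambda3 (eig_minus L)" and \<eta>: "\<eta> = (\<lambda>X Y Z. a X Y Z + b X Y Z)"
    using assms unfolding Lambda_minus_def by blast
  moreover have "eig_plus L \<subseteq> L" "eig_minus L \<subseteq> L" unfolding eig_plus_def eig_minus_def by auto
  ultimately have "a \<in> Lambda3 L" "b \<in> Lambda3 L" using Lambda3_mono by blast+
  then show ?thesis unfolding \<eta> by (rule Lambda3_add)
qed

text \<open>The support of a form in \<open>\<Lambda>\<^sup>-L\<close> lies inside L; regularity on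
  one side and p + q = n on the other give both spaces dimension n.\<close>

lemma Lambda_minus_regD:
  fixes L :: "'n::finite pc set"
  assumes "has_type L p q" "p + q = CARD('n)" "\<eta> \<in> Lambda_minus_reg L"
  shows "supp \<eta> = L" "\<eta> \<in> Ct_type p q"
proof -
  have \<eta>: "\<eta> \<in> Ct" "dim (supp \<eta>) = CARD('n)" "\<eta> \<in> Lambda3 L"
    using assms(3) Lambda_minus_subset unfolding Lambda_minus_reg_def Ct_reg_def by auto
  have sL: "subspace L" using assms(1) unfolding has_type_def tau_invariant_def by blast
  show s: "supp \<eta> = L"
    using subspace_dim_equal[OF subspace_supp sL supp_subset[OF sL \<eta>(3)]] dim_of_type[OF assms(1)] assms(2) \<eta>(2) by simp
  show "\<eta> \<in> Ct_type p q" unfolding Ct_type_def using s \<eta>(1) assms(1) by simp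
qed

lemma Lambda_minus_regI:
  fixes \<eta> :: "'n::finite form3"
  assumes "\<eta> \<in> Ct_type p q" "p + q = CARD('n)"
  shows "\<eta> \<in> Lambda_minus_reg (supp \<eta>)"
proof -
  have "\<eta> \<in> Ct" "has_type (supp \<eta>) p q" using assms(1) unfolding Ct_type_def by auto
  then show ?thesis unfolding Lambda_minus_reg_def Ct_reg_def
    using Ct_in_Lambda_minus dim_of_type[of "supp \<eta>" p q] assms(2) by auto
qed

lemma bij_betw_orbits_stabilizer:
  fixes L :: "'n::finite pc set"
  assumes n: "p + q = CARD('n)" and iso: "isotropic L" and L: "has_type L p q"
  shows "bij_betw (\<lambda>P. \<Union>\<eta>\<in>P. (\<lambda>A. Lambda3_map UNIV A \<eta>) ` AutV)
         (orbits (stabilizer L) (Lambda3_map UNIV) (Lambda_minus_reg L))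
         (orbits AutV (Lambda3_map UNIV) (Ct_type p q))"
proof -
  let ?C = "Ct_type p q :: 'n form3 set"
  let ?\<Psi> = "\<lambda>P :: 'n form3 set. \<Union>\<eta>\<in>P. orbit3 AutV \<eta>"
  note reg = Lambda_minus_regD[OF L n]
  have \<Psi>: "?\<Psi> (orbit3 (stabilizer L) \<eta>) = orbit3 AutV \<eta>" if \<eta>: "\<eta> \<in> Lambda_minus_reg L" for \<eta>
  proof -
    note l = Ct_typeD(2)[OF reg(2)[OF \<eta>]]
    have "orbit3 (stabilizer L) \<eta> \<subseteq> orbit3 AutV \<eta>"
      unfolding orbit3_def stabilizer_def by blast
    then have "orbit3 AutV \<theta> = orbit3 AutV \<eta>" if "\<theta> \<in> orbit3 (stabilizer L) \<eta>" for \<theta>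
      using orbit3_eq[OF subgroup_AutV_AutV l] that by blast
    then show ?thesis using orbit3_self[OF subgroup_AutV_stabilizer l] by blast
  qed
  have "inj_on ?\<Psi> (orbit3 (stabilizer L) ` Lambda_minus_reg L)"
  proof (rule inj_onI)
    fix P Q assume "P \<in> orbit3 (stabilizer L) ` Lambda_minus_reg L" "Q \<in> orbit3 (stabilizer L) ` Lambda_minus_reg L"
      and eq: "?\<Psi> P = ?\<Psi> Q"
    then obtain \<eta> \<theta> where P: "\<eta> \<in> Lambda_minus_reg L" "P = orbit3 (stabilizer L) \<eta>"
      and Q: "\<theta> \<in> Lambda_minus_reg L" "Q = orbit3 (stabilizer L) \<theta>" by blast
    note l = Ct_typeD(2)[OF reg(2)[OF P(1)]] Ct_typeD(2)[OF reg(2)[OF Q(1)]]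
    have "\<theta> \<in> orbit3 AutV \<eta>"
      using eq orbit3_self[OF subgroup_AutV_AutV l(2)] unfolding P(2) Q(2) \<Psi>[OF P(1)] \<Psi>[OF Q(1)] by simp
    then obtain A where A: "A \<in> AutV" "\<theta> = Lambda3_map UNIV A \<eta>" unfolding orbit3_def by blast
    \<comment> \<open>Automorphisms carry supports to supports, and both supports are L.\<close>
    have "A ` L = L" using supp_Lambda3_map[OF A(1) l(1)] reg(1)[OF P(1)] reg(1)[OF Q(1)] A(2) by simp
    then have "\<theta> \<in> orbit3 (stabilizer L) \<eta>" using A unfolding orbit3_def stabilizer_def by blast
    then show "P = Q" using orbit3_eq[OF subgroup_AutV_stabilizer l(1)] P Q by simp
  qed
  moreover have "?\<Psi> ` orbit3 (stabilizer L) ` Lambda_minus_reg L = orbit3 AutV ` ?C"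
  proof (intro equalityI subsetI)
    fix S assume "S \<in> orbit3 AutV ` ?C"
    then obtain \<eta> where \<eta>: "\<eta> \<in> ?C" "S = orbit3 AutV \<eta>" by blast
    have ct: "\<eta> \<in> Ct" "has_type (supp \<eta>) p q" using \<eta>(1) unfolding Ct_type_def by auto
    obtain A where A: "A \<in> AutV" "A ` supp \<eta> = L"
      using AutV_transitive[OF isotropic_supp[OF ct(1)] ct(2) iso L n] by blast
    let ?\<theta> = "Lambda3_map UNIV A \<eta>"
    have "supp ?\<theta> = L" using supp_Lambda3_map[OF A(1) Ct_typeD(2)[OF \<eta>(1)]] A(2) by simp
    then have \<theta>: "?\<theta> \<in> Lambda_minus_reg L"
      using Lambda_minus_regI[OF Lambda3_map_in_Ct_type[OF A(1) \<eta>(1)] n] by simp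
    moreover have "orbit3 AutV ?\<theta> = S"
      unfolding \<eta>(2) using A(1) by (intro orbit3_eq[OF subgroup_AutV_AutV Ct_typeD(2)[OF \<eta>(1)]]) (simp add: orbit3_def)
    ultimately show "S \<in> ?\<Psi> ` orbit3 (stabilizer L) ` Lambda_minus_reg L"
      using \<Psi>[OF \<theta>] by (intro image_eqI[of _ _ "orbit3 (stabilizer L) ?\<theta>"]) auto
  next
    fix S assume "S \<in> ?\<Psi> ` orbit3 (stabilizer L) ` Lambda_minus_reg L"
    then obtain \<eta> where "\<eta> \<in> Lambda_minus_reg L" "S = orbit3 AutV \<eta>" using \<Psi> by auto
    then show "S \<in> orbit3 AutV ` ?C" using reg(2) by blast
  qed
  ultimately have "bij_betw ?\<Psi> (orbit3 (stabilizer L) ` Lambda_minus_reg L) (orbit3 AutV ` ?C)"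
    unfolding bij_betw_def by blast
  then show ?thesis unfolding orbits_eq by (simp only: orbit3_def)
qed

section \<open>Orbits on the two pure summands\<close>

lemma Lambda3_eig_vanish:
  assumes "\<eta> \<in> Lambda3 W" "\<And>u. u \<in> W \<Longrightarrow> gcan u X = 0"
  shows "\<eta> X Y Z = 0"
proof -
  obtain ts where ts: "set ts \<subseteq> W \<times> W \<times> W" "\<eta> = trivector ts" using assms(1) unfolding Lambda3_def by blast
  have "trivector ts X Y Z = 0" using ts(1)
    by (induction ts) (auto simp: wedge3_def assms(2))
  then show ?thesis using ts(2) by simp
qed

lemma gcan_same_eigenvalue:
  assumes "tcan u = c *\<^sub>R u" "tcan X = c *\<^sub>R X" "c \<noteq> 0"
  shows "gcan u X = 0"
proof -
  have "c * gcan u X = - (c * gcan u X)"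
    using gcan_tcan_left[of u X] by (simp add: assms(1,2) gcan_simps)
  then show ?thesis using assms(3) by simp
qed

text \<open>Each eigenspace of \<tau> is isotropic, so a form built from +1 eigenvectors vanishes
  when an argument is a +1 eigenvector, and likewise for -1. A form of both kinds vanishes on both
  components of its first argument.\<close>

lemma Lambda3_eig_plus_inter_minus:
  assumes "\<eta> \<in> Lambda3 (eig_plus L)" "\<eta> \<in> Lambda3 (eig_minus L)"
  shows "\<eta> = (\<lambda>X Y Z. 0)"
proof (intro ext)
  fix X Y Z :: "'a pc"
  let ?p = "(1/2) *\<^sub>R (X + tcan X)" and ?m = "(1/2) *\<^sub>R (X - tcan X)"
  have "tau_invariant (UNIV :: 'a pc set)" unfolding tau_invariant_def by simp
  note d = eig_decomp[OF this UNIV_I, of X]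
  have "\<eta> ?p Y Z = 0"
    using d(1) by (intro Lambda3_eig_vanish[OF assms(1)] gcan_same_eigenvalue[where c = 1]) (auto simp: eig_plus_def)
  moreover have "\<eta> ?m Y Z = 0"
    using d(2) by (intro Lambda3_eig_vanish[OF assms(2)] gcan_same_eigenvalue[where c = "-1"]) (auto simp: eig_minus_def)
  ultimately show "\<eta> X Y Z = 0"
    using alternating3_expand(1)[OF Lambda3_alternating3[OF assms(1)], of ?p ?m Y Z] d(3) by simp
qed

text \<open>Elements of \<open>Lambda3 W\<close> are sums of decomposables without coefficients; a
  minus sign is produced by negating all three factors, an odd number.\<close>

lemma Lambda3_diff:
  assumes "\<eta> \<in> Lambda3 W" "\<theta> \<in> Lambda3 W" "subspace W"
  shows "(\<lambda>X Y Z. \<eta> X Y Z - \<theta> X Y Z) \<in> Lambda3 W"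
proof -
  have "pullback3 (\<lambda>x. - x) \<theta> \<in> Lambda3 W"
    by (rule pullback3_in_Lambda3[OF assms(2), of "\<lambda>x. - x"]) (use subspace_neg[OF assms(3)] in \<open>simp_all add: gcan_simps image_subset_iff\<close>)
  moreover have "pullback3 (\<lambda>x. - x) \<theta> = (\<lambda>X Y Z. - \<theta> X Y Z)"
    unfolding pullback3_def
    by (simp add: alternating3_expand(3,6,9)[OF Lambda3_alternating3[OF assms(2)], where c = "-1", simplified])
  ultimately show ?thesis using Lambda3_add[OF assms(1)] by fastforce
qed

lemma Lambda_minus_unique:
  assumes "a \<in> Lambda3 (eig_plus L)" "a' \<in> Lambda3 (eig_plus L)"
    and "b \<in> Lambda3 (eig_minus L)" "b' \<in> Lambda3 (eig_minus L)"
    and "subspace L" "(\<lambda>X Y Z. a X Y Z + b X Y Z) = (\<lambda>X Y Z. a' X Y Z + b' X Y Z)"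
  shows "a = a'" "b = b'"
proof -
  have e: "a X Y Z + b X Y Z = a' X Y Z + b' X Y Z" for X Y Z using assms(6) by metis
  have "(\<lambda>X Y Z. a X Y Z - a' X Y Z) = (\<lambda>X Y Z. b' X Y Z - b X Y Z)"
    using e by (intro ext) (simp add: algebra_simps eq_diff_eq)
  then have "(\<lambda>X Y Z. a X Y Z - a' X Y Z) = (\<lambda>X Y Z. 0)"
    using Lambda3_diff[OF assms(1,2) subspace_eig(1)[OF assms(5)]] Lambda3_diff[OF assms(4,3) subspace_eig(2)[OF assms(5)]]
    by (intro Lambda3_eig_plus_inter_minus) simp_all
  then have "a X Y Z = a' X Y Z" for X Y Z by (metis eq_iff_diff_eq_0)
  then show "a = a'" by blast
  then have "b X Y Z = b' X Y Z" for X Y Z using e[of X Y Z] by simp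
  then show "b = b'" by blast
qed

text \<open>An element of \<open>stabilizer L\<close> acts on \<alpha> + \<beta> through its two
  restrictions, and every pair from the two general linear groups arises so; hence adding two orbits
  elementwise gives exactly one orbit of the stabilizer. Directness of the sum lets both orbits be
  read off from it.\<close>

lemma bij_betw_product_orbits:
  fixes L :: "'n::finite pc set"
  assumes n: "p + q = CARD('n)" and iso: "isotropic L" and L: "has_type L p q"
  shows "bij_betw (\<lambda>(P, Q). {\<lambda>X Y Z. a X Y Z + b X Y Z | a b. a \<in> P \<and> b \<in> Q})
         (orbits (GL (eig_plus L)) (Lambda3_map (eig_plus L)) (Lambda3 (eig_plus L))
          \<times> orbits (GL (eig_minus L)) (Lambda3_map (eig_minus L)) (Lambda3 (eig_minus L)))
         (orbits (stabilizer L) (Lambda3_map UNIV) (Lambda_minus L))"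
proof -
  let ?p = "eig_plus L" and ?m = "eig_minus L"
  let ?S = "\<lambda>P Q :: 'n form3 set. {\<lambda>X Y Z. a X Y Z + b X Y Z | a b. a \<in> P \<and> b \<in> Q}"
  let ?\<Theta> = "\<lambda>(P, Q). ?S P Q"
  let ?Op = "\<lambda>\<alpha>. (\<lambda>A. Lambda3_map ?p A \<alpha>) ` GL ?p" and ?Om = "\<lambda>\<beta>. (\<lambda>B. Lambda3_map ?m B \<beta>) ` GL ?m"
  have sL: "subspace L" using L unfolding has_type_def tau_invariant_def by blast
  \<comment> \<open>If C extends A, then \<open>inv C\<close> is an adjoint of A on W, so actions of
    different groups are all pullbacks along the same map.\<close>
  have res: "Lambda3_map W A \<eta> = pullback3 (inv C) \<eta>" if "C \<in> AutV" "\<And>x. x \<in> W \<Longrightarrow> C x = A x" "\<eta> \<in> Lambda3 W"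
    for W :: "'n pc set" and A C \<eta>
    by (rule Lambda3_map_eq_pullback3[OF that(3)]) (metis that(1,2) AutV_adjoint)
  have ext: "\<exists>C\<in>stabilizer L. (\<forall>x\<in>?p. C x = A x) \<and> (\<forall>x\<in>?m. C x = B x)" if "A \<in> GL ?p" "B \<in> GL ?m" for A B
    using GL_pair_extends_to_stabilizer[OF iso L n that] by metis
  \<comment> \<open>The identities in extensional form: they complete a single A or B to a pair, and
    they show that each form lies in its own orbit.\<close>
  have id: "restrict id ?p \<in> GL ?p" "restrict id ?m \<in> GL ?m"
    using stabilizer_restrict_GL[OF _ sL, of id] subgroup_AutV_stabilizer[of L] unfolding subgroup_AutV_def by blast+
  have Op: "?Op \<alpha> \<subseteq> Lambda3 ?p" "\<alpha> \<in> ?Op \<alpha>" if \<alpha>: "\<alpha> \<in> Lambda3 ?p" for \<alpha>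
  proof -
    show "?Op \<alpha> \<subseteq> Lambda3 ?p"
    proof clarify
      fix A assume A: "A \<in> GL ?p"
      obtain C where C: "C \<in> stabilizer L" "\<forall>x\<in>?p. C x = A x" using ext[OF A id(2)] by blast
      then show "Lambda3_map ?p A \<alpha> \<in> Lambda3 ?p"
        using res[OF stabilizerD(1)[OF C(1)] _ \<alpha>, of A] pullback3_in_Lambda3[OF \<alpha> AutV_adjoint[OF stabilizerD(1)[OF C(1)]]] stabilizerD(3)[OF C(1)] by simp
    qed
    have "Lambda3_map ?p (restrict id ?p) \<alpha> = \<alpha>"
      using res[OF AutV_id _ \<alpha>, of "restrict id ?p"] by (simp add: pullback3_def)
    then show "\<alpha> \<in> ?Op \<alpha>" using id(1) by (metis imageI)
  qed
  have Om: "?Om \<beta> \<subseteq> Lambda3 ?m" "\<beta> \<in> ?Om \<beta>" if \<beta>: "\<beta> \<in> Lambda3 ?m" for \<beta>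
  proof -
    show "?Om \<beta> \<subseteq> Lambda3 ?m"
    proof clarify
      fix B assume B: "B \<in> GL ?m"
      obtain C where C: "C \<in> stabilizer L" "\<forall>x\<in>?m. C x = B x" using ext[OF id(1) B] by blast
      then show "Lambda3_map ?m B \<beta> \<in> Lambda3 ?m"
        using res[OF stabilizerD(1)[OF C(1)] _ \<beta>, of B] pullback3_in_Lambda3[OF \<beta> AutV_adjoint[OF stabilizerD(1)[OF C(1)]]] stabilizerD(4)[OF C(1)] by simp
    qed
    have "Lambda3_map ?m (restrict id ?m) \<beta> = \<beta>"
      using res[OF AutV_id _ \<beta>, of "restrict id ?m"] by (simp add: pullback3_def)
    then show "\<beta> \<in> ?Om \<beta>" using id(2) by (metis imageI)
  qed
  have \<Theta>: "?S (?Op \<alpha>) (?Om \<beta>) = orbit3 (stabilizer L) (\<lambda>X Y Z. \<alpha> X Y Z + \<beta> X Y Z)"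
    if \<alpha>: "\<alpha> \<in> Lambda3 ?p" and \<beta>: "\<beta> \<in> Lambda3 ?m" for \<alpha> \<beta>
  proof -
    have sum: "Lambda3_map UNIV C (\<lambda>X Y Z. \<alpha> X Y Z + \<beta> X Y Z) =
        (\<lambda>X Y Z. Lambda3_map ?p A \<alpha> X Y Z + Lambda3_map ?m B \<beta> X Y Z)"
      if C: "C \<in> stabilizer L" "\<And>x. x \<in> ?p \<Longrightarrow> C x = A x" "\<And>x. x \<in> ?m \<Longrightarrow> C x = B x" for A B C
    proof -
      have "(\<lambda>X Y Z. \<alpha> X Y Z + \<beta> X Y Z) \<in> Lambda3 UNIV"
        using Lambda3_add[OF Lambda3_UNIV[OF \<alpha>] Lambda3_UNIV[OF \<beta>]] .
      then show ?thesis
        using Lambda3_map_AutV[OF stabilizerD(1)[OF C(1)]] res[OF stabilizerD(1)[OF C(1)] C(2) \<alpha>] res[OF stabilizerD(1)[OF C(1)] C(3) \<beta>]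
        by (simp add: pullback3_def)
    qed
    show ?thesis
    proof (intro equalityI subsetI)
      fix \<theta> assume "\<theta> \<in> ?S (?Op \<alpha>) (?Om \<beta>)"
      then obtain A B where AB: "A \<in> GL ?p" "B \<in> GL ?m" "\<theta> = (\<lambda>X Y Z. Lambda3_map ?p A \<alpha> X Y Z + Lambda3_map ?m B \<beta> X Y Z)" by blast
      obtain C where C: "C \<in> stabilizer L" "\<And>x. x \<in> ?p \<Longrightarrow> C x = A x" "\<And>x. x \<in> ?m \<Longrightarrow> C x = B x" using ext[OF AB(1,2)] by blast
      show "\<theta> \<in> orbit3 (stabilizer L) (\<lambda>X Y Z. \<alpha> X Y Z + \<beta> X Y Z)"
        unfolding orbit3_def AB(3) using sum[OF C] C(1) by (intro image_eqI[of _ _ C]) auto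
    next
      fix \<theta> assume "\<theta> \<in> orbit3 (stabilizer L) (\<lambda>X Y Z. \<alpha> X Y Z + \<beta> X Y Z)"
      then obtain C where C: "C \<in> stabilizer L" "\<theta> = Lambda3_map UNIV C (\<lambda>X Y Z. \<alpha> X Y Z + \<beta> X Y Z)"
        unfolding orbit3_def by blast
      note G = stabilizer_restrict_GL[OF C(1) sL]
      have "\<theta> = (\<lambda>X Y Z. Lambda3_map ?p (restrict C ?p) \<alpha> X Y Z + Lambda3_map ?m (restrict C ?m) \<beta> X Y Z)"
        unfolding C(2) by (rule sum[OF C(1)]) simp_all
      then show "\<theta> \<in> ?S (?Op \<alpha>) (?Om \<beta>)" using G by blast
    qed
  qed
  have "inj_on ?\<Theta> (?Op ` Lambda3 ?p \<times> ?Om ` Lambda3 ?m)"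
  proof (rule inj_onI, clarify)
    fix \<alpha> \<beta> \<alpha>' \<beta>' assume m: "\<alpha> \<in> Lambda3 ?p" "\<beta> \<in> Lambda3 ?m" "\<alpha>' \<in> Lambda3 ?p" "\<beta>' \<in> Lambda3 ?m"
      and eq: "?S (?Op \<alpha>) (?Om \<beta>) = ?S (?Op \<alpha>') (?Om \<beta>')"
    have sub: "?Op \<alpha> \<subseteq> ?Op \<alpha>' \<and> ?Om \<beta> \<subseteq> ?Om \<beta>'"
      if m: "\<alpha> \<in> Lambda3 ?p" "\<beta> \<in> Lambda3 ?m" "\<alpha>' \<in> Lambda3 ?p" "\<beta>' \<in> Lambda3 ?m"
        and eq: "?S (?Op \<alpha>) (?Om \<beta>) = ?S (?Op \<alpha>') (?Om \<beta>')" for \<alpha> \<beta> \<alpha>' \<beta>'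
    proof -
      have *: "a \<in> ?Op \<alpha>' \<and> b \<in> ?Om \<beta>'" if ab: "a \<in> ?Op \<alpha>" "b \<in> ?Om \<beta>" for a b
      proof -
        have "(\<lambda>X Y Z. a X Y Z + b X Y Z) \<in> ?S (?Op \<alpha>') (?Om \<beta>')" using ab eq by blast
        then obtain a' b' where a': "a' \<in> ?Op \<alpha>'" "b' \<in> ?Om \<beta>'"
          "(\<lambda>X Y Z. a X Y Z + b X Y Z) = (\<lambda>X Y Z. a' X Y Z + b' X Y Z)" by blast
        have "a = a'" "b = b'"
          using Lambda_minus_unique[OF subsetD[OF Op(1)[OF m(1)] ab(1)] subsetD[OF Op(1)[OF m(3)] a'(1)]
            subsetD[OF Om(1)[OF m(2)] ab(2)] subsetD[OF Om(1)[OF m(4)] a'(2)] sL a'(3)] .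
        then show ?thesis using a' by simp
      qed
      \<comment> \<open>An element of one orbit can be compared only as part of a sum; \<alpha> and
        \<beta> serve as partners, since each lies in its own orbit.\<close>
      show ?thesis using * Op(2)[OF m(1)] Om(2)[OF m(2)] by blast
    qed
    show "?Op \<alpha> = ?Op \<alpha>' \<and> ?Om \<beta> = ?Om \<beta>'"
      using sub[OF m eq] sub[OF m(3,4,1,2) eq[symmetric]] by blast
  qed
  moreover have "?\<Theta> ` (?Op ` Lambda3 ?p \<times> ?Om ` Lambda3 ?m) = orbit3 (stabilizer L) ` Lambda_minus L"
  proof (intro equalityI subsetI)
    fix S assume "S \<in> ?\<Theta> ` (?Op ` Lambda3 ?p \<times> ?Om ` Lambda3 ?m)"
    then obtain \<alpha> \<beta> where m: "\<alpha> \<in> Lambda3 ?p" "\<beta> \<in> Lambda3 ?m" "S = ?S (?Op \<alpha>) (?Om \<beta>)" by blast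
    have "(\<lambda>X Y Z. \<alpha> X Y Z + \<beta> X Y Z) \<in> Lambda_minus L" unfolding Lambda_minus_def using m by blast
    then show "S \<in> orbit3 (stabilizer L) ` Lambda_minus L" unfolding m(3) \<Theta>[OF m(1,2)] by (rule imageI)
  next
    fix S assume "S \<in> orbit3 (stabilizer L) ` Lambda_minus L"
    then obtain \<alpha> \<beta> where m: "\<alpha> \<in> Lambda3 ?p" "\<beta> \<in> Lambda3 ?m"
      "S = orbit3 (stabilizer L) (\<lambda>X Y Z. \<alpha> X Y Z + \<beta> X Y Z)" unfolding Lambda_minus_def by blast
    have "S = ?\<Theta> (?Op \<alpha>, ?Om \<beta>)" unfolding m(3) using \<Theta>[OF m(1,2)] by simp
    then show "S \<in> ?\<Theta> ` (?Op ` Lambda3 ?p \<times> ?Om ` Lambda3 ?m)" using m(1,2) by blast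
  qed
  ultimately show ?thesis unfolding orbits_eq unfolding orbits_def bij_betw_def by blast
qed

theorem theorem6:
  fixes p q :: nat and L :: "'n::finite pc set"
  assumes "p + q = CARD('n)"
    and "maximally_isotropic L" and "has_type L p q"
  shows
    \<comment> \<open>isomorphism classes correspond to orbits via \<open>\<eta> \<mapsto> M(\<eta>)\<close>\<close>
    "bij_betw (\<lambda>P. \<Union>\<eta>\<in>P. iso_rel p q `` {M_of \<eta>})
       (orbits AutV (Lambda3_map UNIV) (Ct_type p q :: 'n form3 set))
       (iso_classes p q :: ('n pc, 'n pc) mfd set set)
    \<comment> \<open>the same classification for manifolds whose points are of arbitrary type\<close>
     \<and> (\<forall>M :: ('m1, 'n pc) mfd. flat_npK_type p q M \<longrightarrow>
          moduli p q M \<in> orbits AutV (Lambda3_map UNIV) (Ct_type p q))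
     \<and> (\<forall>(M :: ('m1, 'n pc) mfd) (N :: ('m2, 'n pc) mfd).
          flat_npK_type p q M \<and> flat_npK_type p q N \<longrightarrow>
          (isomorphic M N \<longleftrightarrow> moduli p q M = moduli p q N))
    \<comment> \<open>\<open>C\<^bsup>p,q\<^esup>/G \<cong> \<Lambda>\<^sup>-\<^bsub>reg\<^esub>L/G\<^sub>L\<close>, induced by the inclusion\<close>
     \<and> Lambda_minus_reg L \<subseteq> Ct_type p q
     \<and> bij_betw (\<lambda>P. \<Union>\<eta>\<in>P. (\<lambda>A. Lambda3_map UNIV A \<eta>) ` AutV)
         (orbits (stabilizer L) (Lambda3_map UNIV) (Lambda_minus_reg L))
         (orbits AutV (Lambda3_map UNIV) (Ct_type p q))
    \<comment> \<open>\<open>\<Lambda>\<^sup>-\<^bsub>reg\<^esub>L/G\<^sub>L \<subseteq> \<Lambda>\<^sup>-L/G\<^sub>L\<close>\<close>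
     \<and> orbits (stabilizer L) (Lambda3_map UNIV) (Lambda_minus_reg L)
         \<subseteq> orbits (stabilizer L) (Lambda3_map UNIV) (Lambda_minus L)
    \<comment> \<open>\<open>\<Lambda>\<^sup>3L\<^sup>+/GL(L\<^sup>+) \<times> \<Lambda>\<^sup>3L\<^sup>-/GL(L\<^sup>-) = \<Lambda>\<^sup>-L/G\<^sub>L\<close> via \<open>(\<alpha>, \<beta>) \<mapsto> \<alpha> + \<beta>\<close>\<close>
     \<and> bij_betw (\<lambda>(P, Q). {\<lambda>X Y Z. a X Y Z + b X Y Z | a b. a \<in> P \<and> b \<in> Q})
         (orbits (GL (eig_plus L)) (Lambda3_map (eig_plus L)) (Lambda3 (eig_plus L))
          \<times> orbits (GL (eig_minus L)) (Lambda3_map (eig_minus L)) (Lambda3 (eig_minus L)))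
         (orbits (stabilizer L) (Lambda3_map UNIV) (Lambda_minus L))"
proof -
  have iso: "isotropic L" using assms(2) unfolding maximally_isotropic_def by blast
  have A: "\<forall>M :: ('m1, 'n pc) mfd. flat_npK_type p q M \<longrightarrow>
      moduli p q M \<in> orbits AutV (Lambda3_map UNIV) (Ct_type p q)"
    unfolding orbits_eq by (metis flat_npK_typeE imageI moduli_eq_orbit3)
  have B: "\<forall>(M :: ('m1, 'n pc) mfd) (N :: ('m2, 'n pc) mfd).
      flat_npK_type p q M \<and> flat_npK_type p q N \<longrightarrow> (isomorphic M N \<longleftrightarrow> moduli p q M = moduli p q N)"
    using isomorphic_iff_moduli_eq by blast
  have C: "Lambda_minus_reg L \<subseteq> Ct_type p q" using Lambda_minus_regD(2)[OF assms(3,1)] by blast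
  have D: "orbits (stabilizer L) (Lambda3_map UNIV) (Lambda_minus_reg L)
      \<subseteq> orbits (stabilizer L) (Lambda3_map UNIV) (Lambda_minus L)"
    unfolding orbits_def Lambda_minus_reg_def by blast
  show ?thesis
    by (intro conjI bij_betw_orbits_iso_classes A B C D bij_betw_orbits_stabilizer[OF assms(1) iso assms(3)]
        bij_betw_product_orbits[OF assms(1) iso assms(3)])
qed

end
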